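(* Let $\mathfrak g=\mathfrak{sp}(n,\mathbb C)$ with $n\ge2$, and let $k\ge0$, $1\le p\le n$ be integers. Let $\mu\in\mathbb Z\varepsilon_1\oplus\dots\oplus\mathbb Z\varepsilon_n$. If $r(\mu):=(k+p-\|\mu\|)/2$ is a non-negative integer, then $$m_{\pi_{k\omega_1+\omega_p}}(\mu)=\sum_{j=1}^{p}(-1)^{j-1}\sum_{t=0}^{\lfloor\frac{p-j}{2}\rfloor}\frac{n-p+j+1}{n-p+j+t+1}\binom{n-p+j+2t}{t}\sum_{\beta=0}^{p-j-2t}2^{p-j-2t-\beta}\binom{n-Z(\mu)}{\beta}\binom{Z(\mu)}{p-j-2t-\beta}\sum_{\alpha=0}^{\beta}\binom{\beta}{\alpha}\sum_{i=0}^{j-1}\binom{r(\mu)-i-p+\alpha+t+j+n-1}{n-1}.$$ Otherwise $m_{\pi_{k\omega_1+\omega_p}}(\mu)=0$.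
   Context: $\mathfrak g=\mathfrak{sp}(n,\mathbb C)$ has Cartan subalgebra $\mathfrak h=\{\mathrm{diag}(\theta_1,\dots,\theta_n,-\theta_1,\dots,-\theta_n)\}$, with $\varepsilon_i$ picking out $\theta_i$. The positive roots are $\varepsilon_i\pm\varepsilon_j$ ($i<j$) and $2\varepsilon_i$. The weight lattice is $\mathbb Z^n$ in the $\varepsilon$-coordinates, and the fundamental weights are $\omega_p=\varepsilon_1+\dots+\varepsilon_p$. $\pi_\lambda$ is the irreducible representation with highest weight $\lambda$, and $m_\pi(\mu)$ is the dimension of the $\mu$-weight space. For $\mu=\sum_j a_j\varepsilon_j$, set $\|\mu\|=\sum_j|a_j|$ and $Z(\mu)=\#\{j: a_j=0\}$. Convention: $\binom{b}{a}=0$ if $a<0$ or $b<a$. *)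

theory Defs
  imports "Jordan_Normal_Form.Matrix" Complex_Main
begin

definition J_mat :: "nat \<Rightarrow> complex mat" where
  "J_mat n = mat (2*n) (2*n) (\<lambda>(i,j).
     if i < n \<and> j = i + n then 1 else if n \<le> i \<and> j + n = i then -1 else 0)"

definition sp :: "nat \<Rightarrow> complex mat set" where
  "sp n = {X. X \<in> carrier_mat (2*n) (2*n) \<and> transpose_mat X * J_mat n + J_mat n * X = 0\<^sub>m (2*n) (2*n)}"

definition cartan :: "nat \<Rightarrow> (nat \<Rightarrow> complex) \<Rightarrow> complex mat" where
  "cartan n \<theta> = mat (2*n) (2*n) (\<lambda>(i,j).
     if i = j then (if i < n then \<theta> i else - \<theta> (i - n)) else 0)"

text \<open>Evaluation of an integral weight mu = sum a_j eps_j (a : nat => int, indices 0..n-1)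
  on the Cartan element with parameters theta.\<close>
definition wt_eval :: "nat \<Rightarrow> (nat \<Rightarrow> int) \<Rightarrow> (nat \<Rightarrow> complex) \<Rightarrow> complex" where
  "wt_eval n \<mu> \<theta> = (\<Sum>i<n. of_int (\<mu> i) * \<theta> i)"

definition pos_roots :: "nat \<Rightarrow> (nat \<Rightarrow> int) set" where
  "pos_roots n =
     {\<lambda>l. (if l = i then 1 else 0) - (if l = j then 1 else 0) | i j. i < j \<and> j < n}
   \<union> {\<lambda>l. (if l = i then 1 else 0) + (if l = j then 1 else 0) | i j. i < j \<and> j < n}
   \<union> {\<lambda>l. if l = i then 2 else 0 | i. i < n}"

definition root_space :: "nat \<Rightarrow> (nat \<Rightarrow> int) \<Rightarrow> complex mat set" where
  "root_space n \<alpha> = {X \<in> sp n. \<forall>\<theta>.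
      cartan n \<theta> * X - X * cartan n \<theta> = wt_eval n \<alpha> \<theta> \<cdot>\<^sub>m X}"

definition is_rep :: "nat \<Rightarrow> nat \<Rightarrow> (complex mat \<Rightarrow> complex mat) \<Rightarrow> bool" where
  "is_rep n d \<rho> \<longleftrightarrow>
     (\<forall>X \<in> sp n. \<rho> X \<in> carrier_mat d d) \<and>
     (\<forall>X \<in> sp n. \<forall>Y \<in> sp n. \<forall>a b. \<rho> (a \<cdot>\<^sub>m X + b \<cdot>\<^sub>m Y) = a \<cdot>\<^sub>m \<rho> X + b \<cdot>\<^sub>m \<rho> Y) \<and>
     (\<forall>X \<in> sp n. \<forall>Y \<in> sp n. \<rho> (X * Y - Y * X) = \<rho> X * \<rho> Y - \<rho> Y * \<rho> X)"

definition is_subspace :: "nat \<Rightarrow> complex vec set \<Rightarrow> bool" where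
  "is_subspace d W \<longleftrightarrow> W \<subseteq> carrier_vec d \<and> 0\<^sub>v d \<in> W \<and>
     (\<forall>v \<in> W. \<forall>w \<in> W. v + w \<in> W) \<and> (\<forall>v \<in> W. \<forall>a. a \<cdot>\<^sub>v v \<in> W)"

definition irreducible_rep :: "nat \<Rightarrow> nat \<Rightarrow> (complex mat \<Rightarrow> complex mat) \<Rightarrow> bool" where
  "irreducible_rep n d \<rho> \<longleftrightarrow> is_rep n d \<rho> \<and> d > 0 \<and>
     (\<forall>W. is_subspace d W \<and> (\<forall>X \<in> sp n. \<forall>w \<in> W. \<rho> X *\<^sub>v w \<in> W)
          \<longrightarrow> W = {0\<^sub>v d} \<or> W = carrier_vec d)"

definition weight_space :: "nat \<Rightarrow> nat \<Rightarrow> (complex mat \<Rightarrow> complex mat) \<Rightarrow> (nat \<Rightarrow> int) \<Rightarrow> complex vec set" where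
  "weight_space n d \<rho> \<mu> = {v \<in> carrier_vec d.
      \<forall>\<theta>. \<rho> (cartan n \<theta>) *\<^sub>v v = wt_eval n \<mu> \<theta> \<cdot>\<^sub>v v}"

definition lin_indep :: "nat \<Rightarrow> complex vec list \<Rightarrow> bool" where
  "lin_indep d vs \<longleftrightarrow> (\<forall>c \<in> carrier_vec (length vs).
      mat_of_cols d vs *\<^sub>v c = 0\<^sub>v d \<longrightarrow> c = 0\<^sub>v (length vs))"

definition subspace_dim :: "nat \<Rightarrow> complex vec set \<Rightarrow> nat" where
  "subspace_dim d W = (GREATEST k. \<exists>vs. length vs = k \<and> set vs \<subseteq> W \<and> lin_indep d vs)"

definition weight_mult :: "nat \<Rightarrow> nat \<Rightarrow> (complex mat \<Rightarrow> complex mat) \<Rightarrow> (nat \<Rightarrow> int) \<Rightarrow> nat" where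
  "weight_mult n d \<rho> \<mu> = subspace_dim d (weight_space n d \<rho> \<mu>)"

definition has_highest_weight :: "nat \<Rightarrow> nat \<Rightarrow> (complex mat \<Rightarrow> complex mat) \<Rightarrow> (nat \<Rightarrow> int) \<Rightarrow> bool" where
  "has_highest_weight n d \<rho> hw \<longleftrightarrow> (\<exists>v \<in> weight_space n d \<rho> hw. v \<noteq> 0\<^sub>v d \<and>
      (\<forall>\<alpha> \<in> pos_roots n. \<forall>X \<in> root_space n \<alpha>. \<rho> X *\<^sub>v v = 0\<^sub>v d))"

definition omega :: "nat \<Rightarrow> nat \<Rightarrow> int" where
  "omega p i = (if i < p then 1 else 0)"

definition wnorm :: "nat \<Rightarrow> (nat \<Rightarrow> int) \<Rightarrow> int" where
  "wnorm n \<mu> = (\<Sum>i<n. \<bar>\<mu> i\<bar>)"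

definition Zc :: "nat \<Rightarrow> (nat \<Rightarrow> int) \<Rightarrow> int" where
  "Zc n \<mu> = int (card {i. i < n \<and> \<mu> i = 0})"

definition ibinom :: "int \<Rightarrow> int \<Rightarrow> real" where
  "ibinom b a = (if a < 0 \<or> b < a then 0 else real (nat b choose nat a))"

end

(*
  Write p for the index of the fundamental weight, K = k + p, N = ||mu|| and l for the number of
  nonzero entries of mu. Expanding the virtual decomposition into Sym (x) Lambda, the claimed value
  is the coefficient of z^p w^((K - N)/2) in
    z (1 - w z^2) ((1 + z)(1 + w z))^(l-1) (1 + 2wz + wz^2)^(n-l) / (1 - w)^n.
  This series satisfies two differential equations which together say that the formula obeys
  Freudenthal's recursion at dominant weights.

  The weight multiplicities of an irreducible representation obey the same recursion: the Casimir
  element acts by a scalar, and its trace on a weight space is computed along root strings using only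
  cyclicity of the trace and the commutation relations. They are moreover invariant under the Weyl
  group (sl2 theory), supported below the highest weight, and equal to 1 there.

  The formula has these three properties too. If the difference of the two functions did not vanish,
  then a weight of maximal height in its support would be dominant, below the highest weight lambda,
  and have the same Casimir eigenvalue as lambda, hence would be lambda, where the difference is 0.
*)

theory Submission
  imports Defs "HOL-Computational_Algebra.Formal_Power_Series"
    "HOL-Computational_Algebra.Polynomial_Factorial" "HOL-Library.Function_Algebras"
begin

text \<open>With s marking Sym and u marking Lambda, a coordinate contributes the coefficient of x^a
  in (1 + ux)(1 + u/x) / ((1 - sx)(1 - s/x)). This is s^|a| (1 + us)(1 + u/s) / (1 - s^2) for a
  \<noteq> 0 and (1 + 2us + u^2) / (1 - s^2) for a = 0. Putting w = s^2 and z = u/s gives the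
  factors of the series; 1 - wz^2 passes from exterior powers to fundamental representations, and z
  / ((1 + z)(1 + wz)) is the alternating sum that isolates the wanted irreducible. The decomposition
  only motivates the series; the proof verifies the recursion instead. The values depend on a weight
  only through l and N. A string that starts at or passes through a zero entry changes the number of
  nonzero entries, so l - 1, l, l + 1 and l + 2 have to be handled together. This works because
  changing l by one multiplies the series by a rational function, and both Euler operators act by
  rational logarithmic derivatives. Each differential equation thus becomes an identity of rational
  functions, polynomial in l and n - l, and is settled coefficient by coefficient.\<close>

unbundle fps_syntax
no_notation vec_index (infixl "$" 100)

section \<open>The generating function of the multiplicities\<close>

locale derivation =
  fixes D :: "'a::comm_ring_1 \<Rightarrow> 'a"
  assumes add: "D (x + y) = D x + D y"
    and mult: "D (x * y) = D x * y + x * D y"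
begin

lemma zero: "D 0 = 0"
  using add[of 0 0] by simp

lemma one: "D 1 = 0"
  using mult[of 1 1] by simp

lemma minus: "D (- x) = - D x"
  using add[of x "- x"] zero by (simp add: eq_neg_iff_add_eq_0 add.commute)

lemma diff: "D (x - y) = D x - D y"
  using add[of x "- y"] minus by simp

lemma of_nat: "D (of_nat m) = 0"
  by (induction m) (simp_all add: zero one add)

lemma numeral: "D (numeral m) = 0"
  using of_nat[of "numeral m"] by simp

lemma power2: "D (x^2) = 2 * x * D x"
  by (simp add: power2_eq_square mult algebra_simps)

lemma unit_inverse:
  assumes "x * i = 1"
  shows "D i = - (i * i) * D x"
proof -
  have "D x * i + x * D i = 0"
    using mult[of x i] assms one by simp
  then have "i * (D x * i + x * D i) = 0"
    by simp
  then have "(x * i) * D i = - (i * i) * D x"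
    by (simp add: algebra_simps eq_neg_iff_add_eq_0)
  then show ?thesis
    using assms by simp
qed

lemmas rules = zero one add minus diff mult of_nat numeral power2

text \<open>The form \<open>D x = x * a\<close> makes \<open>a\<close> a logarithmic derivative of
  \<open>x\<close> without any division, so it also covers factors such as z that are not units.
  Products add these \<open>a\<close>, powers scale them.\<close>

lemma log_mult: "D x = x * a \<Longrightarrow> D y = y * b \<Longrightarrow> D (x * y) = x * y * (a + b)"
  by (simp add: mult algebra_simps)

lemma log_power: "D x = x * a \<Longrightarrow> D (x ^ m) = x ^ m * (of_nat m * a)"
  by (induction m) (simp_all add: one mult algebra_simps)

lemma log_unit: "x * i = 1 \<Longrightarrow> D x = x * (i * D x)"
  by (metis mult.assoc mult_1)

lemma log_unit_inverse: "x * i = 1 \<Longrightarrow> D i = i * (- i * D x)"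
  by (simp add: unit_inverse mult.assoc)

end

section \<open>Double power series: z is the outer variable, w the inner one\<close>

definition ser_z :: "real fps fps" where "ser_z = fps_X"
definition ser_w :: "real fps fps" where "ser_w = fps_const fps_X"
text \<open>z d/dz and w d/dw act diagonally on coefficients, so differential equations in them turn
  directly into recursions.\<close>

definition euler_z :: "real fps fps \<Rightarrow> real fps fps" where "euler_z F = fps_X * fps_deriv F"
definition euler_w :: "real fps fps \<Rightarrow> real fps fps" where "euler_w F = Abs_fps (\<lambda>p. fps_X * fps_deriv (F $ p))"

lemma euler_z_nth: "euler_z F $ p $ r = real p * F $ p $ r"
  by (cases p) (simp_all add: euler_z_def fps_of_nat[symmetric])

lemma euler_w_nth: "euler_w F $ p $ r = real r * F $ p $ r"
  by (cases r) (simp_all add: euler_w_def)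

lemma derivation_euler_z: "derivation euler_z"
  by unfold_locales (simp_all add: euler_z_def algebra_simps)

lemma derivation_euler_w: "derivation euler_w"
proof
  fix F G :: "real fps fps"
  show "euler_w (F + G) = euler_w F + euler_w G"
    by (simp add: euler_w_def fps_eq_iff algebra_simps)
  have "euler_w (F * G) $ p = (euler_w F * G + F * euler_w G) $ p" for p
  proof -
    have "fps_deriv (\<Sum>i=0..p. F $ i * G $ (p - i)) = (\<Sum>i=0..p. fps_deriv (F $ i * G $ (p - i)))"
      by (rule fps_deriv_sum)
    then have "euler_w (F * G) $ p = (\<Sum>i=0..p. fps_X * fps_deriv (F $ i * G $ (p - i)))"
      by (simp add: euler_w_def fps_mult_nth sum_distrib_left)
    also have "\<dots> = (\<Sum>i=0..p. fps_X * fps_deriv (F $ i) * G $ (p - i) + F $ i * (fps_X * fps_deriv (G $ (p - i))))"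
      by (intro sum.cong refl) (simp add: algebra_simps)
    also have "\<dots> = (euler_w F * G + F * euler_w G) $ p"
      by (simp add: euler_w_def fps_mult_nth sum.distrib)
    finally show ?thesis .
  qed
  then show "euler_w (F * G) = euler_w F * G + F * euler_w G"
    by (simp add: fps_eq_iff)
qed

interpretation dz: derivation euler_z by (rule derivation_euler_z)
interpretation dw: derivation euler_w by (rule derivation_euler_w)

lemma euler_gen: "euler_z ser_z = ser_z" "euler_z ser_w = 0" "euler_w ser_z = 0" "euler_w ser_w = ser_w"
proof -
  show "euler_z ser_z = ser_z" "euler_z ser_w = 0" "euler_w ser_w = ser_w"
    by (simp_all add: euler_z_def euler_w_def ser_z_def ser_w_def fps_eq_iff)
  show "euler_w ser_z = 0"
    by (simp add: euler_w_def ser_z_def fps_eq_iff fps_X_def)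
qed

text \<open>Four of the inverted factors have constant term 1 in z and are inverted as power series
  in z. The factor 1 - w is constant in z, so \<open>inv3\<close> is formed in the inner
  ring.\<close>

definition inv1 where "inv1 = fps_right_inverse (1 + ser_z) 1"
definition inv2 where "inv2 = fps_right_inverse (1 + ser_w * ser_z) 1"
definition inv3 where "inv3 = (fps_const (inverse (1 - fps_X)) :: real fps fps)"
definition inv4 where "inv4 = fps_right_inverse (1 + 2 * ser_w * ser_z + ser_w * ser_z^2) 1"
definition inv5 where "inv5 = fps_right_inverse (1 - ser_w * ser_z^2) 1"

lemma inv_eqs:
  "(1 + ser_z) * inv1 = 1" "(1 + ser_w * ser_z) * inv2 = 1" "(1 - ser_w) * inv3 = 1"
  "(1 + 2 * ser_w * ser_z + ser_w * ser_z^2) * inv4 = 1" "(1 - ser_w * ser_z^2) * inv5 = 1"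
proof -
  show "(1 - ser_w) * inv3 = 1"
    by (simp add: inv3_def ser_w_def fps_const_1_eq_1[symmetric] inverse_mult_eq_1' del: fps_const_1_eq_1)
qed (unfold inv1_def inv2_def inv4_def inv5_def, (rule fps_right_inverse; simp add: ser_z_def ser_w_def)+)

text \<open>\<open>a\<close> and \<open>b\<close> play the roles of the logarithmic derivatives in w
  and in z, with w-derivatives \<open>d\<close> and \<open>e\<close>, all affine in \<open>l\<close>
  and \<open>m\<close>. The six equations compare the coefficients of l^2, lm, m^2, l, m and 1, so
  that the rational identities to be checked involve neither \<open>l\<close> nor
  \<open>m\<close>.\<close>

lemma quadratic_combination:
  fixes l m :: "'a::comm_ring_1"
  assumes "a1 * a1 - a1 * b1 + a1 = x"
    "2 * a1 * a2 - a1 * b2 - a2 * b1 + a1 + a2 = x * (2 * k)"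
    "a2 * a2 - a2 * b2 + a2 = x * (k * k)"
    "2 * a0 * a1 - a0 * b1 - a1 * b0 + a1 + a0 + d1 - e1 = x"
    "2 * a0 * a2 - a0 * b2 - a2 * b0 + a2 + a0 + d2 - e2 = x * (2 * k - k * k)"
    "a0 * a0 - a0 * b0 + a0 + d0 - e0 = 0"
    and a: "a = a0 + l * a1 + m * a2"
  shows "(a * a + (d0 + l * d1 + m * d2)) - (a * (b0 + l * b1 + m * b2) + (e0 + l * e1 + m * e2)) + (l + m + 1) * a
    = x * (l * (l + 1) + 2 * m * (l + 1) * k + m * (m - 1) * (k * k))"
proof -
  have "(a * a + (d0 + l * d1 + m * d2)) - (a * (b0 + l * b1 + m * b2) + (e0 + l * e1 + m * e2)) + (l + m + 1) * a
    = l * l * (a1 * a1 - a1 * b1 + a1) + l * m * (2 * a1 * a2 - a1 * b2 - a2 * b1 + a1 + a2)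
     + m * m * (a2 * a2 - a2 * b2 + a2) + l * (2 * a0 * a1 - a0 * b1 - a1 * b0 + a1 + a0 + d1 - e1)
     + m * (2 * a0 * a2 - a0 * b2 - a2 * b0 + a2 + a0 + d2 - e2) + (a0 * a0 - a0 * b0 + a0 + d0 - e0)"
    unfolding a by (simp add: algebra_simps)
  then show ?thesis
    unfolding assms(1-6) by (simp add: algebra_simps)
qed

section \<open>Rational function identities behind the two differential equations\<close>

context
  fixes z w q1 q2 q3 q4 q5 i1 i2 i3 i4 i5 a0 a1 a2 b0 b1 b2 :: "'a::field"
  assumes q_def: "q1 = 1 + z" "q2 = 1 + w * z" "q3 = 1 - w" "q4 = 1 + 2 * w * z + w * (z * z)" "q5 = 1 - w * (z * z)"
    and q: "(1 + z) * i1 = 1" "(1 + w * z) * i2 = 1" "(1 - w) * i3 = 1"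
    "(1 + 2 * w * z + w * (z * z)) * i4 = 1" "(1 - w * (z * z)) * i5 = 1"
  assumes a: "a0 = - z * z * (w * i5) - z * (w * i2)"
    "a1 = z * (w * i2) + w * i3"
    "a2 = (2 * z + z * z) * (w * i4) + w * i3"
  assumes b: "b0 = 1 - 2 * (z * z) * (w * i5) - z * i1 - z * (w * i2)"
    "b1 = z * i1 + z * (w * i2)"
    "b2 = (2 * z + 2 * z * z) * (w * i4)"
begin

private lemma nz: "q1 \<noteq> 0" "q2 \<noteq> 0" "q3 \<noteq> 0" "q4 \<noteq> 0" "q5 \<noteq> 0"
  using q unfolding q_def by auto

private lemma i: "i1 = 1 / q1" "i2 = 1 / q2" "i3 = 1 / q3" "i4 = 1 / q4" "i5 = 1 / q5"
  using q nz unfolding q_def by (simp_all add: nonzero_eq_divide_eq mult.commute)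

text \<open>Both sides are affine in \<open>l\<close> and \<open>m\<close>, which leaves three
  identities in z and w. The expressions \<open>q4 * (i1 * i2)\<close> and
  \<open>q1 * q2 * i4\<close> are the ratios by which the series changes when \<open>l\<close> drops
  or grows by one.\<close>

lemma log_A_identity:
  "4 * (a0 + l * a1 + m * a2) - 2 * (b0 + l * b1 + m * b2) + 2 * l
   = 2 * (l - 1) * (q4 * (i1 * i2)) + 4 * (w * i3) * (l + m * (q1 * q2 * i4))"
proof -
  \<comment> \<open>The denominators \<open>q1\<close>, ..., \<open>q5\<close> stay atomic while
    fractions are cleared; unfolding them afterwards leaves a polynomial identity.\<close>
  have "4 * a1 - 2 * b1 + 2 = 2 * (q4 * (i1 * i2)) + 4 * (w * i3)"
    using nz unfolding a b i by (simp add: divide_simps) (unfold q_def, Groebner_Basis.algebra)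
  moreover have "4 * a2 - 2 * b2 = 4 * (w * i3) * (q1 * q2 * i4)"
    using nz unfolding a b i by (simp add: divide_simps) (unfold q_def, Groebner_Basis.algebra)
  moreover have "4 * a0 - 2 * b0 = - 2 * (q4 * (i1 * i2))"
    using nz unfolding a b i by (simp add: divide_simps) (unfold q_def, Groebner_Basis.algebra)
  moreover have "4 * (a0 + l * a1 + m * a2) - 2 * (b0 + l * b1 + m * b2) + 2 * l
      = (4 * a0 - 2 * b0) + l * (4 * a1 - 2 * b1 + 2) + m * (4 * a2 - 2 * b2)"
    by (simp add: algebra_simps)
  ultimately show ?thesis by (simp only:) (simp add: algebra_simps)
qed

lemma log_B_identity:
  assumes d: "da = - z * z * (w * (i5 * i5)) - z * (w * (i2 * i2)) + l * (z * (w * (i2 * i2)) + w * (i3 * i3))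
       + m * ((2 * z + z * z) * (w * (i4 * i4)) + w * (i3 * i3))"
    "db = - 2 * (z * z) * (w * (i5 * i5)) - z * (w * (i2 * i2)) + l * (z * (w * (i2 * i2)))
       + m * ((2 * z + 2 * z * z) * (w * (i4 * i4)))"
    and k: "k = q1 * q2 * i4"
    and ab: "a = a0 + l * a1 + m * a2" "b = b0 + l * b1 + m * b2"
  shows "(a * a + da) - (a * b + db) + (l + m + 1) * a
    = w * (i3 * i3) * (l * (l + 1) + 2 * m * (l + 1) * k + m * (m - 1) * (k * k))"
proof -
  have 1: "a1 * a1 - a1 * b1 + a1 = w * (i3 * i3)"
    using nz unfolding a b i by (simp add: divide_simps) (unfold q_def, Groebner_Basis.algebra)
  have 2: "2 * a1 * a2 - a1 * b2 - a2 * b1 + a1 + a2 = w * (i3 * i3) * (2 * k)"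
    using nz unfolding a b i k by (simp add: divide_simps) (unfold q_def, Groebner_Basis.algebra)
  have 3: "a2 * a2 - a2 * b2 + a2 = w * (i3 * i3) * (k * k)"
    using nz unfolding a b i k by (simp add: divide_simps) (unfold q_def, Groebner_Basis.algebra)
  have 4: "2 * a0 * a1 - a0 * b1 - a1 * b0 + a1 + a0 + (z * (w * (i2 * i2)) + w * (i3 * i3)) - z * (w * (i2 * i2))
      = w * (i3 * i3)"
    using nz unfolding a b i by (simp add: divide_simps) (unfold q_def, Groebner_Basis.algebra)
  have 5: "2 * a0 * a2 - a0 * b2 - a2 * b0 + a2 + a0 + ((2 * z + z * z) * (w * (i4 * i4)) + w * (i3 * i3))
      - (2 * z + 2 * z * z) * (w * (i4 * i4)) = w * (i3 * i3) * (2 * k - k * k)"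
    using nz unfolding a b i k by (simp add: divide_simps) (unfold q_def, Groebner_Basis.algebra)
  have 6: "a0 * a0 - a0 * b0 + a0 + (- z * z * (w * (i5 * i5)) - z * (w * (i2 * i2)))
      - (- 2 * (z * z) * (w * (i5 * i5)) - z * (w * (i2 * i2))) = 0"
    using nz unfolding a b i by (simp add: divide_simps) (unfold q_def, Groebner_Basis.algebra)
  show ?thesis
    unfolding d ab(2) by (rule quadratic_combination[OF 1 2 3 4 5 6 ab(1)])
qed

end

text \<open>The condition \<open>x - D x = 1\<close> holds when \<open>x\<close> is 1 plus a term of
  degree one in w, and \<open>x - D x\<close> is the factor that the quotient rule for w / x leaves
  in the numerator.\<close>

lemma (in derivation) unit_inverse_linear:
  assumes "x * i = 1" "D w = w" "x - D x = 1"
  shows "D (w * i) = w * (i * i)"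
proof -
  have "D (w * i) = w * (i * (x * i) - (i * i) * D x)"
    using assms by (simp add: mult unit_inverse algebra_simps)
  also have "\<dots> = w * (i * i) * (x - D x)"
    by (simp add: algebra_simps)
  finally show ?thesis using assms(3) by simp
qed

section \<open>The series and its two differential equations\<close>

definition pol12 where "pol12 = (1 + ser_z) * (1 + ser_w * ser_z)"
definition pol4 where "pol4 = 1 + 2 * ser_w * ser_z + ser_w * ser_z^2"

text \<open>For l >= 1 the factor \<open>inv1 * inv2\<close> cancels one \<open>pol12\<close>,
  giving exponent l - 1. Keeping it separate also gives the correct series at l = 0, the case of the
  zero weight, where l - 1 would be truncated.\<close>

definition gen :: "nat \<Rightarrow> nat \<Rightarrow> real fps fps" where
  "gen n l = ser_z * inv1 * inv2 * (1 - ser_w * ser_z^2) * pol12 ^ l * pol4 ^ (n - l) * inv3 ^ n"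

definition log_w :: "nat \<Rightarrow> nat \<Rightarrow> real fps fps" where
  "log_w l m = - ser_z * ser_z * (ser_w * inv5) - ser_z * (ser_w * inv2)
    + of_nat l * (ser_z * (ser_w * inv2) + ser_w * inv3)
    + of_nat m * ((2 * ser_z + ser_z * ser_z) * (ser_w * inv4) + ser_w * inv3)"

definition log_z :: "nat \<Rightarrow> nat \<Rightarrow> real fps fps" where
  "log_z l m = 1 - 2 * (ser_z * ser_z) * (ser_w * inv5) - ser_z * inv1 - ser_z * (ser_w * inv2)
    + of_nat l * (ser_z * inv1 + ser_z * (ser_w * inv2))
    + of_nat m * ((2 * ser_z + 2 * ser_z * ser_z) * (ser_w * inv4))"

lemma unit12: "pol12 * (inv1 * inv2) = 1"
  using inv_eqs(1,2) unfolding pol12_def by Groebner_Basis.algebra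

lemma unit4: "pol4 * inv4 = 1"
  using inv_eqs(4) unfolding pol4_def .

lemma euler_w_gen:
  assumes "l \<le> n"
  shows "euler_w (gen n l) = gen n l * log_w l (n - l)"
proof -
  note s = dw.rules euler_gen
  have i1: "euler_w inv1 = inv1 * 0"
    using dw.log_unit_inverse[OF inv_eqs(1)] by (simp add: s)
  have i2: "euler_w inv2 = inv2 * (- inv2 * (ser_w * ser_z))"
    using dw.log_unit_inverse[OF inv_eqs(2)] by (simp add: s)
  have i3: "euler_w inv3 = inv3 * (inv3 * ser_w)"
    using dw.log_unit_inverse[OF inv_eqs(3)] by (simp add: s)
  have p5: "euler_w (1 - ser_w * ser_z^2) = (1 - ser_w * ser_z^2) * (inv5 * (- ser_w * ser_z^2))"
    using dw.log_unit[OF inv_eqs(5)] by (simp add: s)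
  have p4: "euler_w pol4 = pol4 * (inv4 * (2 * ser_w * ser_z + ser_w * ser_z^2))"
    using dw.log_unit[OF unit4] by (simp add: s pol4_def)
  have "euler_w pol12 = (1 + ser_z) * (ser_w * ser_z)"
    by (simp add: s pol12_def)
  also have "\<dots> = pol12 * (inv2 * (ser_w * ser_z))"
    using inv_eqs(2) unfolding pol12_def by Groebner_Basis.algebra
  finally have p12: "euler_w pol12 = pol12 * (inv2 * (ser_w * ser_z))" .
  have z: "euler_w ser_z = ser_z * 0" by (simp add: s)
  have "euler_w (gen n l) = gen n l * (0 + 0 + - inv2 * (ser_w * ser_z) + inv5 * (- ser_w * ser_z^2)
     + of_nat l * (inv2 * (ser_w * ser_z)) + of_nat (n - l) * (inv4 * (2 * ser_w * ser_z + ser_w * ser_z^2))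
     + of_nat n * (inv3 * ser_w))"
    unfolding gen_def
    by (intro dw.log_mult dw.log_power z i1 i2 i3 p5 p4 p12)
  also have "of_nat n = of_nat l + (of_nat (n - l) :: real fps fps)"
    using assms by (metis le_add_diff_inverse of_nat_add)
  finally show ?thesis
    by (simp add: log_w_def algebra_simps power2_eq_square)
qed

lemma euler_z_gen:
  assumes "l \<le> n"
  shows "euler_z (gen n l) = gen n l * log_z l (n - l)"
proof -
  note s = dz.rules euler_gen
  have i1: "euler_z inv1 = inv1 * (- inv1 * ser_z)"
    using dz.log_unit_inverse[OF inv_eqs(1)] by (simp add: s)
  have i2: "euler_z inv2 = inv2 * (- inv2 * (ser_w * ser_z))"
    using dz.log_unit_inverse[OF inv_eqs(2)] by (simp add: s)
  have i3: "euler_z inv3 = inv3 * 0"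
    using dz.log_unit_inverse[OF inv_eqs(3)] by (simp add: s)
  have p5: "euler_z (1 - ser_w * ser_z^2) = (1 - ser_w * ser_z^2) * (inv5 * (- 2 * ser_w * ser_z^2))"
  proof -
    have "euler_z (1 - ser_w * ser_z^2) = - 2 * ser_w * ser_z^2"
      by (simp add: s power2_eq_square)
    with dz.log_unit[OF inv_eqs(5)] show ?thesis by metis
  qed
  have p4: "euler_z pol4 = pol4 * (inv4 * (2 * ser_w * ser_z + 2 * ser_w * ser_z^2))"
  proof -
    have "euler_z pol4 = 2 * ser_w * ser_z + 2 * ser_w * ser_z^2"
      by (simp add: s pol4_def power2_eq_square)
    with dz.log_unit[OF unit4] show ?thesis by metis
  qed
  have "euler_z pol12 = ser_z * (1 + ser_w * ser_z) + (1 + ser_z) * (ser_w * ser_z)"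
    by (simp add: s pol12_def)
  also have "\<dots> = pol12 * (inv1 * ser_z + inv2 * (ser_w * ser_z))"
    using inv_eqs(1,2) unfolding pol12_def by Groebner_Basis.algebra
  finally have p12: "euler_z pol12 = pol12 * (inv1 * ser_z + inv2 * (ser_w * ser_z))" .
  have z: "euler_z ser_z = ser_z * 1" by (simp add: s)
  have "euler_z (gen n l) = gen n l * (1 + - inv1 * ser_z + - inv2 * (ser_w * ser_z) + inv5 * (- 2 * ser_w * ser_z^2)
     + of_nat l * (inv1 * ser_z + inv2 * (ser_w * ser_z)) + of_nat (n - l) * (inv4 * (2 * ser_w * ser_z + 2 * ser_w * ser_z^2))
     + of_nat n * 0)"
    unfolding gen_def
    by (intro dz.log_mult dz.log_power z i1 i2 i3 p5 p4 p12)
  then show ?thesis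
    by (simp add: log_z_def algebra_simps power2_eq_square)
qed

lemma euler_w_logs:
  "euler_w (log_w l m) = - ser_z * ser_z * (ser_w * (inv5 * inv5)) - ser_z * (ser_w * (inv2 * inv2))
    + of_nat l * (ser_z * (ser_w * (inv2 * inv2)) + ser_w * (inv3 * inv3))
    + of_nat m * ((2 * ser_z + ser_z * ser_z) * (ser_w * (inv4 * inv4)) + ser_w * (inv3 * inv3))"
  "euler_w (log_z l m) = - 2 * (ser_z * ser_z) * (ser_w * (inv5 * inv5)) - ser_z * (ser_w * (inv2 * inv2))
    + of_nat l * (ser_z * (ser_w * (inv2 * inv2)))
    + of_nat m * ((2 * ser_z + 2 * ser_z * ser_z) * (ser_w * (inv4 * inv4)))"
proof -
  note s = dw.rules euler_gen
  have i1: "euler_w inv1 = 0"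
    using dw.log_unit_inverse[OF inv_eqs(1)] by (simp add: s)
  have i2: "euler_w (ser_w * inv2) = ser_w * (inv2 * inv2)"
    by (rule dw.unit_inverse_linear[OF inv_eqs(2)]) (simp_all add: s)
  have i3: "euler_w (ser_w * inv3) = ser_w * (inv3 * inv3)"
    by (rule dw.unit_inverse_linear[OF inv_eqs(3)]) (simp_all add: s)
  have i4: "euler_w (ser_w * inv4) = ser_w * (inv4 * inv4)"
    by (rule dw.unit_inverse_linear[OF inv_eqs(4)]) (simp_all add: s)
  have i5: "euler_w (ser_w * inv5) = ser_w * (inv5 * inv5)"
    by (rule dw.unit_inverse_linear[OF inv_eqs(5)]) (simp_all add: s)
  have lin: "euler_w (c * x) = c * euler_w x" if "euler_w c = 0" for c x
    using that by (simp add: dw.mult)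
  show "euler_w (log_w l m) = - ser_z * ser_z * (ser_w * (inv5 * inv5)) - ser_z * (ser_w * (inv2 * inv2))
    + of_nat l * (ser_z * (ser_w * (inv2 * inv2)) + ser_w * (inv3 * inv3))
    + of_nat m * ((2 * ser_z + ser_z * ser_z) * (ser_w * (inv4 * inv4)) + ser_w * (inv3 * inv3))"
    unfolding log_w_def by (simp add: dw.add dw.diff lin i1 i2 i3 i4 i5 s(1-5,7-) dw.mult[of ser_z ser_z])
  show "euler_w (log_z l m) = - 2 * (ser_z * ser_z) * (ser_w * (inv5 * inv5)) - ser_z * (ser_w * (inv2 * inv2))
    + of_nat l * (ser_z * (ser_w * (inv2 * inv2)))
    + of_nat m * ((2 * ser_z + 2 * ser_z * ser_z) * (ser_w * (inv4 * inv4)))"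
    unfolding log_z_def by (simp add: dw.add dw.diff lin i1 i2 i3 i4 i5 s(1-5,7-) dw.mult[of ser_z ser_z])
qed

text \<open>Double power series form an integral domain. The identities proved for fields hold in
  its fraction field and come back along the injective map \<open>to_fract\<close>.\<close>

lemma log_identities:
  fixes l m :: nat
  defines "k \<equiv> pol12 * inv4"
  shows "4 * log_w l m - 2 * log_z l m + 2 * of_nat l
      = 2 * (of_nat l - 1) * (pol4 * (inv1 * inv2)) + 4 * (ser_w * inv3) * (of_nat l + of_nat m * k)"
   and "(log_w l m * log_w l m + euler_w (log_w l m)) - (log_w l m * log_z l m + euler_w (log_z l m))
        + (of_nat l + of_nat m + 1) * log_w l m
      = ser_w * (inv3 * inv3) * (of_nat l * (of_nat l + 1) + 2 * of_nat m * (of_nat l + 1) * k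
          + of_nat m * (of_nat m - 1) * (k * k))"
proof -
  note q = inv_eqs[unfolded power2_eq_square]
  have two: "to_fract 2 = (2 :: real fps fps fract)"
    by (metis one_add_one to_fract_1 to_fract_add)
  then have four: "to_fract 4 = (4 :: real fps fps fract)"
    by (metis numeral_Bit0 to_fract_add)
  note hom = to_fract_add to_fract_diff to_fract_mult to_fract_uminus to_fract_1 two four
  note q' = q[THEN arg_cong[of _ _ to_fract], unfolded hom]
  have inj: "x = y" if "to_fract x = to_fract y" for x y :: "real fps fps"
    using that by simp
  show "4 * log_w l m - 2 * log_z l m + 2 * of_nat l
      = 2 * (of_nat l - 1) * (pol4 * (inv1 * inv2)) + 4 * (ser_w * inv3) * (of_nat l + of_nat m * k)"
    by (rule inj, unfold k_def log_w_def log_z_def pol12_def pol4_def power2_eq_square hom,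
        rule log_A_identity[OF refl refl refl refl refl q' refl refl refl refl refl refl])
  show "(log_w l m * log_w l m + euler_w (log_w l m)) - (log_w l m * log_z l m + euler_w (log_z l m))
        + (of_nat l + of_nat m + 1) * log_w l m
      = ser_w * (inv3 * inv3) * (of_nat l * (of_nat l + 1) + 2 * of_nat m * (of_nat l + 1) * k
          + of_nat m * (of_nat m - 1) * (k * k))"
    by (rule inj, unfold euler_w_logs, unfold k_def log_w_def log_z_def pol12_def pol4_def power2_eq_square hom,
        rule log_B_identity[OF refl refl refl refl refl q' refl refl refl refl refl refl refl refl refl refl refl])
qed

lemma gen_pred:
  assumes "1 \<le> l" "l \<le> n"
  shows "gen n (l - 1) = gen n l * (pol4 * (inv1 * inv2))"
proof -
  have l: "pol12 ^ l = pol12 * pol12 ^ (l - 1)" "pol4 ^ (n - (l - 1)) = pol4 * pol4 ^ (n - l)"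
    using assms by (simp_all add: power_eq_if Suc_diff_le)
  have r: "gen n l * (pol4 * (inv1 * inv2)) = gen n (l - 1) * (pol12 * (inv1 * inv2))"
    unfolding gen_def l by (simp only: mult_ac)
  show ?thesis
    using unit12 by (simp add: r)
qed

lemma gen_Suc:
  assumes "l < n"
  shows "gen n (l + 1) = gen n l * (pol12 * inv4)"
proof -
  have l: "pol12 ^ (l + 1) = pol12 * pol12 ^ l" "pol4 ^ (n - l) = pol4 * pol4 ^ (n - (l + 1))"
    using assms by (simp_all add: Suc_diff_Suc flip: power_Suc)
  have r: "gen n l * (pol12 * inv4) = gen n (l + 1) * (pol4 * inv4)"
    unfolding gen_def l by (simp only: mult_ac)
  show ?thesis
    using unit4 by (simp add: r)
qed

text \<open>First differential equation; its operator takes the value 4r - 2p + 2l at z^p w^r. The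
  two ratios in the logarithmic identity become neighbouring series by \<open>gen_pred\<close> and
  \<open>gen_Suc\<close>.\<close>

lemma gen_A:
  assumes "1 \<le> l" "l \<le> n"
  shows "4 * euler_w (gen n l) - 2 * euler_z (gen n l) + 2 * of_nat l * gen n l
    = 2 * (of_nat l - 1) * gen n (l - 1) + 4 * (ser_w * inv3 * (of_nat l * gen n l + of_nat (n - l) * gen n (l + 1)))"
proof -
  \<comment> \<open>For l = n the exponent in \<open>gen n (l + 1)\<close> is truncated and the
    ratio formula fails, but the coefficient n - l is then zero.\<close>
  have "of_nat (n - l) * gen n (l + 1) = gen n l * (of_nat (n - l) * (pol12 * inv4))"
    using assms gen_Suc[of l n] by (cases "l = n") (auto simp: algebra_simps)
  then have "2 * (of_nat l - 1) * gen n (l - 1) + 4 * (ser_w * inv3 * (of_nat l * gen n l + of_nat (n - l) * gen n (l + 1)))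
      = gen n l * (2 * (of_nat l - 1) * (pol4 * (inv1 * inv2)) + 4 * (ser_w * inv3) * (of_nat l + of_nat (n - l) * (pol12 * inv4)))"
    unfolding gen_pred[OF assms] by (simp add: algebra_simps)
  also have "\<dots> = gen n l * (4 * log_w l (n - l) - 2 * log_z l (n - l) + 2 * of_nat l)"
    unfolding log_identities(1) ..
  finally show ?thesis
    using assms by (simp add: euler_w_gen euler_z_gen algebra_simps)
qed

text \<open>Second differential equation; its operator takes the value r (r - p + n + 1) at z^p w^r.
  Up to a factor 4, the coefficients on the right count how often the root strings contribute
  weighted tails with l, l + 1 and l + 2 nonzero entries.\<close>

lemma gen_B:
  assumes "l \<le> n"
  shows "euler_w (euler_w (gen n l)) - euler_w (euler_z (gen n l)) + (of_nat n + 1) * euler_w (gen n l)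
    = ser_w * (inv3 * inv3) * (of_nat l * (of_nat l + 1) * gen n l
       + 2 * of_nat (n - l) * (of_nat l + 1) * gen n (l + 1) + of_nat (n - l) * (of_nat (n - l) - 1) * gen n (l + 2))"
proof -
  define k where "k = pol12 * inv4"
  have 1: "of_nat (n - l) * gen n (l + 1) = gen n l * (of_nat (n - l) * k)"
    using assms gen_Suc[of l n] by (cases "l = n") (auto simp: k_def algebra_simps)
  have 2: "of_nat (n - l) * (of_nat (n - l) - 1) * gen n (l + 2) = gen n l * (of_nat (n - l) * (of_nat (n - l) - 1) * (k * k))"
  proof (cases "l + 1 < n")
    case True
    then have "gen n (l + 2) = gen n l * (k * k)"
      using gen_Suc[of l n] gen_Suc[of "l + 1" n] by (simp add: k_def algebra_simps)
    then show ?thesis by (simp add: algebra_simps)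
  next
    case False
    then have "n = l \<or> n = l + 1" using assms by auto
    then show ?thesis by auto
  qed
  have n: "(of_nat n :: real fps fps) = of_nat l + of_nat (n - l)"
    using assms by (metis le_add_diff_inverse of_nat_add)
  have "euler_w (euler_w (gen n l)) - euler_w (euler_z (gen n l)) + (of_nat n + 1) * euler_w (gen n l)
    = gen n l * ((log_w l (n - l) * log_w l (n - l) + euler_w (log_w l (n - l)))
        - (log_w l (n - l) * log_z l (n - l) + euler_w (log_z l (n - l)))
        + (of_nat l + of_nat (n - l) + 1) * log_w l (n - l))"
    unfolding n using assms by (simp add: euler_w_gen euler_z_gen dw.mult algebra_simps)
  also have "\<dots> = ser_w * (inv3 * inv3) * (of_nat l * (of_nat l + 1) * gen n l
       + 2 * (of_nat l + 1) * (gen n l * (of_nat (n - l) * k)) + gen n l * (of_nat (n - l) * (of_nat (n - l) - 1) * (k * k)))"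
    unfolding log_identities(2) k_def by (simp add: algebra_simps)
  finally show ?thesis
    unfolding 1[symmetric] 2[symmetric] by (simp add: algebra_simps)
qed

section \<open>Recursions for the coefficients\<close>

lemma inverse_one_minus_X: "inverse (1 - fps_X) = (Abs_fps (\<lambda>_. 1) :: real fps)"
  by (rule fps_inverse_unique) (simp add: fps_eq_iff algebra_simps)

lemma X_times_inverse_squared: "fps_X * (inverse (1 - fps_X) * inverse (1 - fps_X)) = (Abs_fps real :: real fps)"
proof -
  have "(1 - fps_X) * Abs_fps real = fps_X * Abs_fps (\<lambda>_. 1 :: real)"
    by (auto simp: fps_eq_iff algebra_simps of_nat_diff)
  moreover have "inverse (1 - fps_X) * (1 - fps_X) = (1 :: real fps)"
    by (simp add: inverse_mult_eq_1)
  ultimately show ?thesis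
    unfolding inverse_one_minus_X by Groebner_Basis.algebra
qed

text \<open>Multiplication by w/(1 - w) sums over all smaller exponents of w. A step outward on a
  root string raises the norm by 2 and lowers \<open>r\<close> by 1, so these are sums along
  strings; w/(1 - w)^2 in the next lemma adds the weight j.\<close>

lemma tail_sum_nth: "(ser_w * inv3 * F) $ p $ r = (\<Sum>j=1..r. F $ p $ (r - j))"
proof -
  have "(ser_w * inv3 * F) $ p = fps_X * Abs_fps (\<lambda>_. 1) * F $ p"
    by (simp add: ser_w_def inv3_def inverse_one_minus_X fps_const_mult[symmetric] mult.assoc del: fps_const_mult)
  also have "fps_X * Abs_fps (\<lambda>_. 1) = Abs_fps (\<lambda>j. if j = 0 then 0 else 1 :: real)"
    by (simp add: fps_eq_iff)
  also have "(\<dots> * F $ p) $ r = (\<Sum>j=0..r. (if j = 0 then 0 else 1) * F $ p $ (r - j))"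
    by (simp add: fps_mult_nth)
  also have "\<dots> = (\<Sum>j=1..r. F $ p $ (r - j))"
    by (intro sum.mono_neutral_cong_right) auto
  finally show ?thesis .
qed

lemma weighted_tail_sum_nth: "(ser_w * (inv3 * inv3) * F) $ p $ r = (\<Sum>j=1..r. real j * F $ p $ (r - j))"
proof -
  have "(ser_w * (inv3 * inv3) * F) $ p = fps_X * (inverse (1 - fps_X) * inverse (1 - fps_X)) * F $ p"
    by (simp add: ser_w_def inv3_def fps_const_mult[symmetric] mult.assoc del: fps_const_mult)
  then have "(ser_w * (inv3 * inv3) * F) $ p $ r = (\<Sum>j=0..r. real j * F $ p $ (r - j))"
    by (simp add: X_times_inverse_squared fps_mult_nth)
  also have "\<dots> = (\<Sum>j=1..r. real j * F $ p $ (r - j))"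
    by (intro sum.mono_neutral_cong_right) auto
  finally show ?thesis .
qed

definition gen_coeff :: "nat \<Rightarrow> nat \<Rightarrow> nat \<Rightarrow> nat \<Rightarrow> real" where
  "gen_coeff n p l r = gen n l $ p $ r"

lemma of_nat_mult_nth: "(of_nat m * F :: real fps fps) $ p $ r = real m * F $ p $ r"
  by (induction m) (simp_all add: algebra_simps)

lemma gen_coeff_A:
  assumes "1 \<le> l" "l \<le> n"
  shows "(4 * real r - 2 * real p + 2 * real l) * gen_coeff n p l r
    = 2 * (real l - 1) * gen_coeff n p (l - 1) r
      + 4 * (\<Sum>j=1..r. real l * gen_coeff n p l (r - j) + real (n - l) * gen_coeff n p (l + 1) (r - j))"
proof -
  \<comment> \<open>Numerical factors are rewritten as casts of naturals, the form in which
    \<open>of_nat_mult_nth\<close> extracts coefficients.\<close>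
  have e: "of_nat 4 * euler_w (gen n l) - of_nat 2 * euler_z (gen n l) + of_nat (2 * l) * gen n l
    = of_nat (2 * (l - 1)) * gen n (l - 1) + of_nat 4 * (ser_w * inv3 * (of_nat l * gen n l + of_nat (n - l) * gen n (l + 1)))"
    using gen_A[OF assms] assms by (simp add: of_nat_diff)
  have "(4 * real r - 2 * real p + 2 * real l) * gen_coeff n p l r
      = (of_nat 4 * euler_w (gen n l) - of_nat 2 * euler_z (gen n l) + of_nat (2 * l) * gen n l) $ p $ r"
    unfolding fps_add_nth fps_sub_nth of_nat_mult_nth euler_w_nth euler_z_nth gen_coeff_def by (simp add: algebra_simps)
  then show ?thesis
    unfolding e fps_add_nth fps_sub_nth of_nat_mult_nth tail_sum_nth gen_coeff_def
    using assms by (simp add: of_nat_diff)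
qed

lemma gen_coeff_B:
  assumes "l \<le> n"
  shows "real r * (real r - real p + real n + 1) * gen_coeff n p l r
    = (\<Sum>j=1..r. real j * (real l * (real l + 1) * gen_coeff n p l (r - j)
        + 2 * real (n - l) * (real l + 1) * gen_coeff n p (l + 1) (r - j)
        + real (n - l) * (real (n - l) - 1) * gen_coeff n p (l + 2) (r - j)))"
proof -
  have m: "of_nat (n - l) * (of_nat (n - l) - 1) = (of_nat ((n - l) * (n - l - 1)) :: 'a::ring_1)"
    by (cases "n - l") (simp_all add: algebra_simps)
  have e: "euler_w (euler_w (gen n l)) - euler_w (euler_z (gen n l)) + of_nat (n + 1) * euler_w (gen n l)
    = ser_w * (inv3 * inv3) * (of_nat (l * (l + 1)) * gen n l
       + of_nat (2 * (n - l) * (l + 1)) * gen n (l + 1) + of_nat ((n - l) * (n - l - 1)) * gen n (l + 2))"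
    using gen_B[OF assms] unfolding m by (simp only: of_nat_mult of_nat_add of_nat_1 of_nat_numeral mult.assoc)
  have "real r * (real r - real p + real n + 1) * gen_coeff n p l r
      = (euler_w (euler_w (gen n l)) - euler_w (euler_z (gen n l)) + of_nat (n + 1) * euler_w (gen n l)) $ p $ r"
    unfolding fps_add_nth fps_sub_nth of_nat_mult_nth euler_w_nth euler_z_nth gen_coeff_def by (simp add: algebra_simps)
  then show ?thesis
    unfolding e fps_add_nth fps_sub_nth of_nat_mult_nth weighted_tail_sum_nth gen_coeff_def m
    by (simp only: of_nat_mult of_nat_add of_nat_1 of_nat_numeral mult.assoc)
qed

section \<open>Expansion of the series into the closed formula\<close>

lemma inverse_power_nth:
  "(inverse (1 - fps_X) ^ Suc m :: real fps) $ r = real ((r + m) choose m)"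
proof (induction m arbitrary: r)
  case 0
  then show ?case by (simp add: inverse_one_minus_X)
next
  case (Suc m)
  have "(inverse (1 - fps_X) ^ Suc (Suc m) :: real fps) $ r
      = (inverse (1 - fps_X) * inverse (1 - fps_X) ^ Suc m) $ r" by simp
  also have "\<dots> = (\<Sum>s=0..r. real ((r - s + m) choose m))"
    by (subst inverse_one_minus_X) (simp add: fps_mult_nth Suc.IH del: power_Suc)
  also have "\<dots> = (\<Sum>s=0..r. real ((s + m) choose m))"
    by (rule sum.reindex_bij_witness[of _ "\<lambda>s. r - s" "\<lambda>s. r - s"]) auto
  also have "\<dots> = real (\<Sum>s\<le>r. (m + s) choose m)"
    by (simp add: atMost_atLeast0 add.commute)
  also have "\<dots> = real ((r + Suc m) choose Suc m)"
    by (subst choose_rising_sum(1)) (simp add: add.commute)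
  finally show ?case .
qed

lemma right_unit_unique: "x * a = 1 \<Longrightarrow> x * b = 1 \<Longrightarrow> a = b" for x :: "'a::comm_ring_1"
  by (metis mult.assoc mult.commute mult_1)

lemma inv1_nth: "inv1 $ i = (-1) ^ i"
proof -
  have "(1 + ser_z) * Abs_fps (\<lambda>i. (-1) ^ i) = 1"
    by (auto simp: ser_z_def fps_eq_iff algebra_simps power_eq_if)
  then have "inv1 = Abs_fps (\<lambda>i. (-1) ^ i)" using right_unit_unique inv_eqs(1) by blast
  then show ?thesis by (metis fps_nth_Abs_fps)
qed

lemma inv2_nth: "inv2 $ i = (- fps_X) ^ i"
proof -
  have "(1 + ser_w * ser_z) * Abs_fps (\<lambda>i. (- fps_X) ^ i) = 1"
    by (auto simp: ser_z_def ser_w_def fps_eq_iff[where 'a = "real fps"] algebra_simps power_eq_if)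
  then have "inv2 = Abs_fps (\<lambda>i. (- fps_X) ^ i)" using right_unit_unique inv_eqs(2) by blast
  then show ?thesis by (metis fps_nth_Abs_fps)
qed

text \<open>Source of the sign (-1)^(j-1) and of the innermost sum over i in the formula: dividing
  by (1 + z)(1 + wz) produces the complete homogeneous sums in -1 and -w.\<close>

lemma prefactor_nth:
  "(ser_z * inv1 * inv2) $ j = (if j = 0 then 0 else (-1) ^ (j - 1) * (\<Sum>i<j. fps_X ^ i))"
proof (cases j)
  case (Suc m)
  have "(ser_z * inv1 * inv2) $ j = (inv1 * inv2) $ m"
    by (simp add: Suc ser_z_def mult.assoc)
  also have "\<dots> = (inv2 * inv1) $ m" by (simp add: mult.commute)
  also have "\<dots> = (\<Sum>i=0..m. (-1) ^ m * fps_X ^ i)"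
    unfolding fps_mult_nth
  proof (rule sum.cong)
    fix i assume "i \<in> {0..m}"
    then have "(-1 :: real fps) ^ m = (-1) ^ i * (-1) ^ (m - i)"
      by (simp flip: power_add)
    then show "inv2 $ i * inv1 $ (m - i) = (-1) ^ m * fps_X ^ i"
      by (simp add: inv1_nth inv2_nth power_minus[of fps_X])
  qed simp
  also have "\<dots> = (-1) ^ (j - 1) * (\<Sum>i<j. fps_X ^ i)"
    by (simp add: Suc sum_distrib_left atLeast0AtMost lessThan_Suc_atMost)
  finally show ?thesis using Suc by simp
qed (simp add: ser_z_def)

text \<open>Coefficient of y^t in (1 - y)(1 + y)^m, a ballot number when 2t <= m. At t = 0 the
  truncated t - 1 would wrongly subtract 1, hence the case split.\<close>

definition ballot :: "nat \<Rightarrow> nat \<Rightarrow> real" where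
  "ballot m t = real (m choose t) - (if t = 0 then 0 else real (m choose (t - 1)))"

text \<open>At most one summand is nonzero. Written as a sum over t with a degree condition, it can
  be merged with the other sums in \<open>pol_product_nth\<close>.\<close>

lemma ballot_nth:
  "((1 - ser_w * ser_z^2) * (1 + ser_w * ser_z^2) ^ m) $ s
   = (\<Sum>t\<le>s div 2. if s = 2 * t then fps_const (ballot m t) * fps_X ^ t else 0)"
proof -
  define y where "y = ser_w * ser_z^2"
  have y: "y ^ k = fps_const (fps_X ^ k) * fps_X ^ (2 * k)" for k
    by (simp add: y_def ser_w_def ser_z_def power_mult_distrib fps_const_power power_mult)
  have b: "(1 + y) ^ m = (\<Sum>k\<le>m. of_nat (m choose k) * y ^ k)"
    using binomial_ring[of y 1 m] by (simp add: add.commute)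
  have "(1 - y) * (1 + y) ^ m = (1 + y) ^ m - y * (1 + y) ^ m" by (simp add: algebra_simps)
  then have e: "(1 - y) * (1 + y) ^ m
      = (\<Sum>k\<le>m. of_nat (m choose k) * y ^ k) - (\<Sum>k\<le>m. of_nat (m choose k) * y ^ (Suc k))"
    by (simp add: b sum_distrib_left mult.left_commute[of y])
  have c: "(of_nat b * y ^ k) $ s = (if s = 2 * k then of_nat b * fps_X ^ k else 0)" for b k
    unfolding y by (simp add: fps_of_nat[symmetric] mult.assoc[symmetric] fps_X_power_nth del: fps_of_nat)
  have "((1 - y) * (1 + y) ^ m) $ s
      = (\<Sum>k\<le>m. if s = 2 * k then of_nat (m choose k) * fps_X ^ k else 0)
        - (\<Sum>k\<le>m. if s = 2 * Suc k then of_nat (m choose k) * fps_X ^ Suc k else 0)"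
    unfolding e fps_sub_nth fps_sum_nth c ..
  also have "\<dots> = (\<Sum>t\<le>s div 2. if s = 2 * t then fps_const (ballot m t) * fps_X ^ t else 0)"
  proof (cases "even s")
    case True
    then obtain t where s: "s = 2 * t" by (elim evenE)
    have 1: "(\<Sum>k\<le>m. if s = 2 * k then of_nat (m choose k) * fps_X ^ k else 0)
       = (of_nat (m choose t) * fps_X ^ t :: real fps)"
      unfolding s by simp
    have 2: "(\<Sum>k\<le>m. if s = 2 * Suc k then of_nat (m choose k) * fps_X ^ Suc k else 0)
       = (if t = 0 then 0 else of_nat (m choose (t - 1)) * fps_X ^ t :: real fps)"
    proof (cases t)
      case (Suc u)
      then show ?thesis unfolding s by simp
    qed (simp add: s)
    have 3: "(\<Sum>u\<le>s div 2. if s = 2 * u then fps_const (ballot m u) * fps_X ^ u else 0)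
       = fps_const (ballot m t) * fps_X ^ t"
      unfolding s by simp
    show ?thesis
      unfolding 1 2 3
      by (simp add: ballot_def fps_of_nat algebra_simps flip: fps_const_sub)
  next
    case False
    then have "(s = 2 * k) = False" for k by auto
    then show ?thesis by (simp only: if_False) simp
  qed
  finally show ?thesis unfolding y_def .
qed

text \<open>With y = 1 + wz^2 one has \<open>pol12\<close> = z(1 + w) + y and \<open>pol4\<close> =
  2wz + y. Choosing \<beta> factors z(1 + w) and \<gamma> factors 2wz in the two binomial expansions
  leaves (1 - wz^2) y^(n - \<beta> - \<gamma>), whose coefficients are the \<open>ballot\<close>
  numbers.\<close>

lemma pol_product_nth:
  assumes "l \<le> n" "q \<le> n"
  shows "((1 - ser_w * ser_z^2) * pol12 ^ l * pol4 ^ (n - l)) $ q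
    = (\<Sum>t\<le>q div 2. \<Sum>\<beta>\<le>q - 2 * t. fps_const (ballot (n - q + 2 * t) t * 2 ^ (q - 2 * t - \<beta>)
         * real (l choose \<beta>) * real ((n - l) choose (q - 2 * t - \<beta>)))
         * ((1 + fps_X) ^ \<beta> * fps_X ^ (q - 2 * t - \<beta> + t)))"
proof -
  define y where "y = 1 + ser_w * ser_z^2"
  define m where "m = n - l"
  have p12: "pol12 = ser_z * (1 + ser_w) + y"
    by (simp add: pol12_def y_def algebra_simps power2_eq_square)
  have p4: "pol4 = 2 * ser_w * ser_z + y"
    by (simp add: pol4_def y_def algebra_simps power2_eq_square)
  let ?c = "\<lambda>\<beta> \<gamma>. of_nat (l choose \<beta>) * of_nat (m choose \<gamma>) * ((1 + ser_w) ^ \<beta> * (2 * ser_w) ^ \<gamma>)"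
  let ?h = "\<lambda>\<beta> \<gamma> t. fps_const (ballot (n - \<beta> - \<gamma>) t * 2 ^ \<gamma> * real (l choose \<beta>) * real (m choose \<gamma>))
     * ((1 + fps_X) ^ \<beta> * fps_X ^ (\<gamma> + t)) :: real fps"
  let ?a = "\<lambda>\<beta>. of_nat (l choose \<beta>) * (ser_z * (1 + ser_w)) ^ \<beta> * y ^ (l - \<beta>)"
  let ?b = "\<lambda>\<gamma>. of_nat (m choose \<gamma>) * (2 * ser_w * ser_z) ^ \<gamma> * y ^ (m - \<gamma>)"
  have "pol12 ^ l * pol4 ^ m = (\<Sum>\<beta>\<le>l. \<Sum>\<gamma>\<le>m. ?a \<beta> * ?b \<gamma>)"
    by (simp only: p12 p4 binomial_ring sum_product)
  then have "(1 - ser_w * ser_z^2) * pol12 ^ l * pol4 ^ m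
      = (\<Sum>\<beta>\<le>l. \<Sum>\<gamma>\<le>m. (1 - ser_w * ser_z^2) * (?a \<beta> * ?b \<gamma>))"
    by (simp only: mult.assoc[of _ "pol12 ^ l"] sum_distrib_left)
  also have "\<dots> = (\<Sum>\<beta>\<le>l. \<Sum>\<gamma>\<le>m. ?c \<beta> \<gamma> * (ser_z ^ (\<beta> + \<gamma>) * ((1 - ser_w * ser_z^2) * y ^ (n - \<beta> - \<gamma>))))"
  proof (intro sum.cong refl)
    fix \<beta> \<gamma> assume "\<beta> \<in> {..l}" "\<gamma> \<in> {..m}"
    then have "y ^ (n - \<beta> - \<gamma>) = y ^ (l - \<beta>) * y ^ (m - \<gamma>)"
      using assms by (simp add: m_def flip: power_add)
    then show "(1 - ser_w * ser_z\<^sup>2) * (?a \<beta> * ?b \<gamma>)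
      = ?c \<beta> \<gamma> * (ser_z ^ (\<beta> + \<gamma>) * ((1 - ser_w * ser_z\<^sup>2) * y ^ (n - \<beta> - \<gamma>)))"
      by (simp add: power_mult_distrib power_add mult_ac)
  qed
  finally have "(1 - ser_w * ser_z^2) * pol12 ^ l * pol4 ^ m
      = (\<Sum>\<beta>\<le>l. \<Sum>\<gamma>\<le>m. ?c \<beta> \<gamma> * (ser_z ^ (\<beta> + \<gamma>) * ((1 - ser_w * ser_z^2) * y ^ (n - \<beta> - \<gamma>))))" .
  then have "((1 - ser_w * ser_z\<^sup>2) * pol12 ^ l * pol4 ^ m) $ q
      = (\<Sum>\<beta>\<le>l. \<Sum>\<gamma>\<le>m. (?c \<beta> \<gamma> * (ser_z ^ (\<beta> + \<gamma>) * ((1 - ser_w * ser_z^2) * y ^ (n - \<beta> - \<gamma>)))) $ q)"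
    by (simp only: fps_sum_nth)
  also have "\<dots> = (\<Sum>\<beta>\<le>l. \<Sum>\<gamma>\<le>m. \<Sum>t\<le>q div 2. if \<beta> + \<gamma> + 2 * t = q then ?h \<beta> \<gamma> t else 0)"
  proof (intro sum.cong refl)
    fix \<beta> \<gamma>
    have c: "?c \<beta> \<gamma> = fps_const (fps_const (2 ^ \<gamma> * real (l choose \<beta>) * real (m choose \<gamma>)) * ((1 + fps_X) ^ \<beta> * fps_X ^ \<gamma>))"
      by (simp add: ser_w_def fps_of_nat[symmetric] fps_const_power[symmetric] power_mult_distrib
          fps_const_mult[symmetric] fps_const_add[symmetric] numeral_fps_const mult_ac
          del: fps_of_nat fps_const_power fps_const_mult fps_const_add)
    have "(?c \<beta> \<gamma> * (ser_z ^ (\<beta> + \<gamma>) * ((1 - ser_w * ser_z^2) * y ^ (n - \<beta> - \<gamma>)))) $ q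
        = fps_const (2 ^ \<gamma> * real (l choose \<beta>) * real (m choose \<gamma>)) * ((1 + fps_X) ^ \<beta> * fps_X ^ \<gamma>)
          * (if q < \<beta> + \<gamma> then 0 else \<Sum>t\<le>(q - (\<beta> + \<gamma>)) div 2.
             if q - (\<beta> + \<gamma>) = 2 * t then fps_const (ballot (n - \<beta> - \<gamma>) t) * fps_X ^ t else 0)"
      unfolding c ser_z_def[symmetric] fps_mult_left_const_nth
      by (simp add: ser_z_def fps_X_power_mult_nth ballot_nth[unfolded ser_z_def] y_def del: diff_diff_left)
    also have "\<dots> = (\<Sum>t\<le>q div 2. if \<beta> + \<gamma> + 2 * t = q then ?h \<beta> \<gamma> t else 0)"
    proof (cases "q < \<beta> + \<gamma>")
      case False
      then show ?thesis
        unfolding sum_distrib_left if_not_P[OF False]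
        by (intro sum.mono_neutral_cong_left)
          (auto simp: power_add fps_const_mult[symmetric] mult_ac simp del: fps_const_mult)
    qed (auto intro!: sum.neutral)
    finally show "(?c \<beta> \<gamma> * (ser_z ^ (\<beta> + \<gamma>) * ((1 - ser_w * ser_z^2) * y ^ (n - \<beta> - \<gamma>)))) $ q
        = (\<Sum>t\<le>q div 2. if \<beta> + \<gamma> + 2 * t = q then ?h \<beta> \<gamma> t else 0)" .
  qed
  also have "\<dots> = (\<Sum>\<beta>\<le>l. \<Sum>t\<le>q div 2. \<Sum>\<gamma>\<le>m. if \<beta> + \<gamma> + 2 * t = q then ?h \<beta> \<gamma> t else 0)"
    by (intro sum.cong refl sum.swap)
  also have "\<dots> = (\<Sum>t\<le>q div 2. \<Sum>\<beta>\<le>l. \<Sum>\<gamma>\<le>m. if \<beta> + \<gamma> + 2 * t = q then ?h \<beta> \<gamma> t else 0)"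
    by (rule sum.swap)
  \<comment> \<open>The degree condition fixes \<gamma> = q - 2t - \<beta>. The ranges of \<beta>
    and \<gamma> can be exchanged for \<beta> <= q - 2t because binomials outside their range
    vanish.\<close>
  also have "\<dots> = (\<Sum>t\<le>q div 2. \<Sum>\<beta>\<le>q - 2 * t. ?h \<beta> (q - 2 * t - \<beta>) t)"
  proof (rule sum.cong[OF refl])
    fix t assume "t \<in> {..q div 2}"
    then have t: "2 * t \<le> q" by auto
    have "(\<Sum>\<gamma>\<le>m. if \<beta> + \<gamma> + 2 * t = q then ?h \<beta> \<gamma> t else 0)
        = (if \<beta> \<le> q - 2 * t then ?h \<beta> (q - 2 * t - \<beta>) t else 0)" for \<beta>
    proof (cases "\<beta> \<le> q - 2 * t")
      case True
      then have e: "\<beta> + \<gamma> + 2 * t = q \<longleftrightarrow> \<gamma> = q - 2 * t - \<beta>" for \<gamma> using t by auto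
      show ?thesis
        unfolding e using True by (auto simp: binomial_eq_0)
    next
      case False
      then have "\<beta> + \<gamma> + 2 * t \<noteq> q" for \<gamma> using t by auto
      then show ?thesis using False by simp
    qed
    then have "(\<Sum>\<beta>\<le>l. \<Sum>\<gamma>\<le>m. if \<beta> + \<gamma> + 2 * t = q then ?h \<beta> \<gamma> t else 0)
        = (\<Sum>\<beta>\<le>l. if \<beta> \<le> q - 2 * t then ?h \<beta> (q - 2 * t - \<beta>) t else 0)" by simp
    also have "\<dots> = (\<Sum>\<beta>\<in>{..l} \<inter> {..q - 2 * t}. ?h \<beta> (q - 2 * t - \<beta>) t)"
      by (simp only: sum.inter_restrict finite_atMost atMost_iff)
    also have "\<dots> = (\<Sum>\<beta>\<le>q - 2 * t. ?h \<beta> (q - 2 * t - \<beta>) t)"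
      by (rule sum.mono_neutral_left) (auto simp: binomial_eq_0)
    finally show "(\<Sum>\<beta>\<le>l. \<Sum>\<gamma>\<le>m. if \<beta> + \<gamma> + 2 * t = q then ?h \<beta> \<gamma> t else 0)
        = (\<Sum>\<beta>\<le>q - 2 * t. ?h \<beta> (q - 2 * t - \<beta>) t)" .
  qed
  also have "\<dots> = (\<Sum>t\<le>q div 2. \<Sum>\<beta>\<le>q - 2 * t. fps_const (ballot (n - q + 2 * t) t * 2 ^ (q - 2 * t - \<beta>)
         * real (l choose \<beta>) * real (m choose (q - 2 * t - \<beta>)))
         * ((1 + fps_X) ^ \<beta> * fps_X ^ (q - 2 * t - \<beta> + t)))"
  proof (intro sum.cong refl)
    fix t \<beta> assume "t \<in> {..q div 2}" "\<beta> \<in> {..q - 2 * t}"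
    then have "n - \<beta> - (q - 2 * t - \<beta>) = n - q + 2 * t" using assms by auto
    then show "?h \<beta> (q - 2 * t - \<beta>) t = fps_const (ballot (n - q + 2 * t) t * 2 ^ (q - 2 * t - \<beta>)
         * real (l choose \<beta>) * real (m choose (q - 2 * t - \<beta>)))
         * ((1 + fps_X) ^ \<beta> * fps_X ^ (q - 2 * t - \<beta> + t))"
      by simp
  qed
  finally show ?thesis unfolding m_def .
qed

text \<open>The convention of \<open>ibinom\<close> fits: for e > r the upper entry falls below n -
  1 and the value is 0, like the coefficient.\<close>

lemma X_power_inverse_nth:
  assumes "1 \<le> n"
  shows "(fps_X ^ e * inverse (1 - fps_X) ^ n :: real fps) $ r = ibinom (int r - int e + int n - 1) (int n - 1)"
proof -
  obtain m where n: "n = Suc m" using assms by (cases n) auto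
  have "nat (1 + int r + int m - int e - 1) = r - e + m" if "e \<le> r"
    using that by auto
  then show ?thesis
    unfolding n fps_X_power_mult_nth inverse_power_nth ibinom_def by (auto simp: nat_diff_distrib)
qed

lemma gen_coeff_expand:
  assumes "1 \<le> n" "p \<le> n" "l \<le> n"
  shows "gen_coeff n p l r = (\<Sum>j=1..p. (-1) ^ (j - 1) *
      (\<Sum>t\<le>(p - j) div 2. \<Sum>\<beta>\<le>p - j - 2 * t.
        ballot (n - (p - j) + 2 * t) t * 2 ^ (p - j - 2 * t - \<beta>)
         * real (l choose \<beta>) * real ((n - l) choose (p - j - 2 * t - \<beta>)) *
        (\<Sum>\<alpha>\<le>\<beta>. real (\<beta> choose \<alpha>) * (\<Sum>i<j.
          ibinom (int r - int (i + (p - j - 2 * t - \<beta>) + t + (\<beta> - \<alpha>)) + int n - 1) (int n - 1)))))"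
proof -
  define I where "I = (inverse (1 - fps_X) ^ n :: real fps)"
  let ?Q = "(1 - ser_w * ser_z^2) * pol12 ^ l * pol4 ^ (n - l)"
  have lin: "(fps_const c * F) $ r = c * F $ r" for c :: real and F by simp
  have "gen n l = fps_const I * (ser_z * inv1 * inv2 * ?Q)"
    by (simp add: gen_def inv3_def I_def fps_const_power[symmetric] mult_ac del: fps_const_power)
  then have "gen n l $ p = I * (\<Sum>j=0..p. (ser_z * inv1 * inv2) $ j * ?Q $ (p - j))"
    by (simp only: fps_mult_left_const_nth fps_mult_nth[of "ser_z * inv1 * inv2" ?Q p])
  also have "(\<Sum>j=0..p. (ser_z * inv1 * inv2) $ j * ?Q $ (p - j))
      = (\<Sum>j=1..p. (ser_z * inv1 * inv2) $ j * ?Q $ (p - j))"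
    by (intro sum.mono_neutral_right) (auto simp: prefactor_nth)
  also have "\<dots> = (\<Sum>j=1..p. ((-1) ^ (j - 1) * (\<Sum>i<j. fps_X ^ i)) * ?Q $ (p - j))"
    by (intro sum.cong refl) (simp add: prefactor_nth)
  finally have "gen_coeff n p l r = (\<Sum>j=1..p. (I * ((-1) ^ (j - 1) * (\<Sum>i<j. fps_X ^ i) * ?Q $ (p - j))) $ r)"
    by (simp only: gen_coeff_def sum_distrib_left fps_sum_nth)
  also have "\<dots> = (\<Sum>j=1..p. (-1) ^ (j - 1) *
      (\<Sum>t\<le>(p - j) div 2. \<Sum>\<beta>\<le>p - j - 2 * t.
        ballot (n - (p - j) + 2 * t) t * 2 ^ (p - j - 2 * t - \<beta>)
         * real (l choose \<beta>) * real ((n - l) choose (p - j - 2 * t - \<beta>)) *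
        (\<Sum>\<alpha>\<le>\<beta>. real (\<beta> choose \<alpha>) * (\<Sum>i<j.
          ibinom (int r - int (i + (p - j - 2 * t - \<beta>) + t + (\<beta> - \<alpha>)) + int n - 1) (int n - 1)))))"
  proof (intro sum.cong refl)
    fix j assume "j \<in> {1..p}"
    define q where "q = p - j"
    have q: "q \<le> n" using assms by (simp add: q_def)
    let ?d = "\<lambda>t \<beta>. ballot (n - q + 2 * t) t * 2 ^ (q - 2 * t - \<beta>)
         * real (l choose \<beta>) * real ((n - l) choose (q - 2 * t - \<beta>))"
    have sgn: "(-1 :: real fps) ^ (j - 1) = fps_const ((-1) ^ (j - 1))"
      by (simp add: fps_const_power[symmetric] fps_const_neg[symmetric] del: fps_const_power fps_const_neg)
    \<comment> \<open>The exponent is \<beta> - \<alpha> rather than \<alpha>, so that \<alpha>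
      enters the upper entry of the last binomial with a plus sign.\<close>
    have pow: "(1 + fps_X :: real fps) ^ \<beta> = (\<Sum>\<alpha>\<le>\<beta>. fps_const (real (\<beta> choose \<alpha>)) * fps_X ^ (\<beta> - \<alpha>))" for \<beta>
      using binomial_ring[of 1 "fps_X :: real fps" \<beta>] by (simp add: fps_of_nat)
    have tm: "I * ((\<Sum>i<j. fps_X ^ i) * ((1 + fps_X) ^ \<beta> * fps_X ^ (q - 2 * t - \<beta> + t)))
        = (\<Sum>\<alpha>\<le>\<beta>. fps_const (real (\<beta> choose \<alpha>)) * (\<Sum>i<j. fps_X ^ (i + (q - 2 * t - \<beta>) + t + (\<beta> - \<alpha>)) * I))" for t \<beta>
    proof -
      have 1: "fps_X ^ (\<beta> - \<alpha>) * ((\<Sum>i<j. fps_X ^ i) * (fps_X ^ (q - 2 * t - \<beta> + t) * I))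
          = (\<Sum>i<j. fps_X ^ (i + (q - 2 * t - \<beta>) + t + (\<beta> - \<alpha>)) * I)" for \<alpha>
        unfolding sum_distrib_right sum_distrib_left
        by (intro sum.cong refl) (simp only: power_add mult.assoc mult.commute mult.left_commute)
      have "I * ((\<Sum>i<j. fps_X ^ i) * ((1 + fps_X) ^ \<beta> * fps_X ^ (q - 2 * t - \<beta> + t)))
        = (1 + fps_X) ^ \<beta> * ((\<Sum>i<j. fps_X ^ i) * (fps_X ^ (q - 2 * t - \<beta> + t) * I))"
        by (simp only: mult.assoc mult.commute mult.left_commute)
      also have "\<dots> = (\<Sum>\<alpha>\<le>\<beta>. fps_const (real (\<beta> choose \<alpha>)) *
          (fps_X ^ (\<beta> - \<alpha>) * ((\<Sum>i<j. fps_X ^ i) * (fps_X ^ (q - 2 * t - \<beta> + t) * I))))"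
        unfolding pow by (subst sum_distrib_right) (simp only: mult.assoc)
      finally show ?thesis unfolding 1 .
    qed
    have "I * ((-1) ^ (j - 1) * (\<Sum>i<j. fps_X ^ i) * ?Q $ q)
        = fps_const ((-1) ^ (j - 1)) * (\<Sum>t\<le>q div 2. \<Sum>\<beta>\<le>q - 2 * t. fps_const (?d t \<beta>) *
            (I * ((\<Sum>i<j. fps_X ^ i) * ((1 + fps_X) ^ \<beta> * fps_X ^ (q - 2 * t - \<beta> + t)))))"
    proof -
      let ?s = "\<Sum>i<j. fps_X ^ i :: real fps"
      let ?e = "\<lambda>t \<beta>. (1 + fps_X) ^ \<beta> * fps_X ^ (q - 2 * t - \<beta> + t) :: real fps"
      have "I * ((-1) ^ (j - 1) * ?s * ?Q $ q)
          = fps_const ((-1) ^ (j - 1)) * ((\<Sum>t\<le>q div 2. \<Sum>\<beta>\<le>q - 2 * t. fps_const (?d t \<beta>) * ?e t \<beta>) * (I * ?s))"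
        unfolding pol_product_nth[OF assms(3) q] sgn by (simp only: mult.assoc mult.commute mult.left_commute)
      also have "(\<Sum>t\<le>q div 2. \<Sum>\<beta>\<le>q - 2 * t. fps_const (?d t \<beta>) * ?e t \<beta>) * (I * ?s)
          = (\<Sum>t\<le>q div 2. \<Sum>\<beta>\<le>q - 2 * t. fps_const (?d t \<beta>) * (I * (?s * ?e t \<beta>)))"
        unfolding sum_distrib_right[where A = "{.._}"]
        by (intro sum.cong refl) (simp only: mult.assoc mult.commute mult.left_commute)
      finally show ?thesis .
    qed
    then have "(I * ((-1) ^ (j - 1) * (\<Sum>i<j. fps_X ^ i) * ?Q $ q)) $ r
        = (-1) ^ (j - 1) * (\<Sum>t\<le>q div 2. \<Sum>\<beta>\<le>q - 2 * t. ?d t \<beta> *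
            (\<Sum>\<alpha>\<le>\<beta>. real (\<beta> choose \<alpha>) * (\<Sum>i<j. (fps_X ^ (i + (q - 2 * t - \<beta>) + t + (\<beta> - \<alpha>)) * I) $ r)))"
      unfolding tm by (simp only: lin fps_sum_nth)
    then show "(I * ((-1) ^ (j - 1) * (\<Sum>i<j. fps_X ^ i) * ?Q $ (p - j))) $ r = (-1) ^ (j - 1) *
      (\<Sum>t\<le>(p - j) div 2. \<Sum>\<beta>\<le>p - j - 2 * t.
        ballot (n - (p - j) + 2 * t) t * 2 ^ (p - j - 2 * t - \<beta>)
         * real (l choose \<beta>) * real ((n - l) choose (p - j - 2 * t - \<beta>)) *
        (\<Sum>\<alpha>\<le>\<beta>. real (\<beta> choose \<alpha>) * (\<Sum>i<j.
          ibinom (int r - int (i + (p - j - 2 * t - \<beta>) + t + (\<beta> - \<alpha>)) + int n - 1) (int n - 1))))"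
      unfolding I_def q_def by (simp only: X_power_inverse_nth[OF assms(1)])
  qed
  finally show ?thesis .
qed

text \<open>With m = n - p + j + 2t this is the quotient in the theorem. It follows from (u + 1)
  C(m, u + 1) = (m - u) C(m, u) at t = u + 1.\<close>

lemma ballot_quotient:
  assumes "2 * t \<le> m"
  shows "ballot m t = real (m - 2 * t + 1) / real (m - t + 1) * real (m choose t)"
proof (cases t)
  case (Suc u)
  have "Suc u * (m choose Suc u) = (m - u) * (m choose u)"
    by (metis binomial_absorb_comp binomial_absorption mult.commute binomial_absorption diff_Suc_1)
  then have "real (Suc u) * real (m choose Suc u) = real (m - u) * real (m choose u)"
    by (metis of_nat_mult)
  moreover have "real (m - u) > 0" using assms Suc by simp
  moreover have "m - t + 1 = m - u" "real (m - 2 * t + 1) = real (m - u) - real (Suc u)"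
    using assms Suc by (auto simp: of_nat_diff)
  ultimately show ?thesis
    unfolding ballot_def using Suc by (simp add: field_simps)
qed (simp add: ballot_def)

lemma sum_int_interval: "(\<Sum>j=0..int m. f j) = (\<Sum>j\<le>m. f (int j))"
  by (rule sum.reindex_bij_witness[of _ int nat]) auto

lemma sum_int_interval_pred: "(\<Sum>j=0..int m - 1. f j) = (\<Sum>j<m. f (int j))"
  by (rule sum.reindex_bij_witness[of _ int nat]) auto

lemma sum_int_interval_from_1: "(\<Sum>j=1..int m. f j) = (\<Sum>j=1..m. f (int j))"
  by (rule sum.reindex_bij_witness[of _ int nat]) auto

text \<open>Bridge from natural to integer summation ranges, with the ballot numbers put into
  quotient form.\<close>

lemma gen_coeff_formula:
  fixes n p l r :: nat
  assumes "1 \<le> n" "p \<le> n" "l \<le> n"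
  defines "N \<equiv> int n" and "P \<equiv> int p" and "Z \<equiv> int (n - l)"
  shows "gen_coeff n p l r = (\<Sum>j = 1..P. (-1) ^ nat (j - 1) *
        (\<Sum>t = 0..(P - j) div 2.
          (real_of_int (N - P + j + 1) / real_of_int (N - P + j + t + 1)) *
          ibinom (N - P + j + 2*t) t *
          (\<Sum>\<beta> = 0..P - j - 2*t.
             2 ^ nat (P - j - 2*t - \<beta>) * ibinom (N - Z) \<beta> * ibinom Z (P - j - 2*t - \<beta>) *
             (\<Sum>\<alpha> = 0..\<beta>. ibinom \<beta> \<alpha> *
                (\<Sum>i = 0..j - 1. ibinom (int r - i - P + \<alpha> + t + j + N - 1) (N - 1))))))"
proof -
  have ib: "ibinom (int a) (int b) = real (a choose b)" for a b
    by (simp add: ibinom_def binomial_eq_0)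
  show ?thesis
    unfolding gen_coeff_expand[OF assms(1-3)] P_def sum_int_interval_from_1
  proof (intro sum.cong refl arg_cong2[where f = "(*)"])
    fix j assume j: "j \<in> {1..p}"
    show "(-1 :: real) ^ (j - 1) = (-1) ^ nat (int j - 1)"
      by (simp add: nat_diff_distrib')
    have J: "(int p - int j) div 2 = int ((p - j) div 2)" using j by (simp add: zdiv_int of_nat_diff)
    show "(\<Sum>t\<le>(p - j) div 2. \<Sum>\<beta>\<le>p - j - 2 * t.
        ballot (n - (p - j) + 2 * t) t * 2 ^ (p - j - 2 * t - \<beta>)
         * real (l choose \<beta>) * real ((n - l) choose (p - j - 2 * t - \<beta>)) *
        (\<Sum>\<alpha>\<le>\<beta>. real (\<beta> choose \<alpha>) * (\<Sum>i<j.
          ibinom (int r - int (i + (p - j - 2 * t - \<beta>) + t + (\<beta> - \<alpha>)) + int n - 1) (int n - 1))))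
      = (\<Sum>t = 0..(int p - int j) div 2.
          (real_of_int (N - int p + int j + 1) / real_of_int (N - int p + int j + t + 1)) *
          ibinom (N - int p + int j + 2*t) t *
          (\<Sum>\<beta> = 0..int p - int j - 2*t.
             2 ^ nat (int p - int j - 2*t - \<beta>) * ibinom (N - Z) \<beta> * ibinom Z (int p - int j - 2*t - \<beta>) *
             (\<Sum>\<alpha> = 0..\<beta>. ibinom \<beta> \<alpha> *
                (\<Sum>i = 0..int j - 1. ibinom (int r - i - int p + \<alpha> + t + int j + N - 1) (N - 1)))))"
      unfolding J sum_int_interval
    proof (intro sum.cong refl)
      fix t assume "t \<in> {..(p - j) div 2}"
      then have t: "2 * t \<le> p - j" by auto
      define m where "m = n - (p - j) + 2 * t"
      have m: "2 * t \<le> m" "N - int p + int j + 2 * int t = int m" "N - int p + int j + 1 = int (m - 2 * t + 1)"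
        "N - int p + int j + int t + 1 = int (m - t + 1)"
        using assms j t by (auto simp: m_def of_nat_diff)
      have B: "int p - int j - 2 * int t = int (p - j - 2 * t)" using j t by auto
      have "(\<Sum>\<beta>\<le>p - j - 2 * t. ballot m t * 2 ^ (p - j - 2 * t - \<beta>)
         * real (l choose \<beta>) * real ((n - l) choose (p - j - 2 * t - \<beta>)) *
        (\<Sum>\<alpha>\<le>\<beta>. real (\<beta> choose \<alpha>) * (\<Sum>i<j.
          ibinom (int r - int (i + (p - j - 2 * t - \<beta>) + t + (\<beta> - \<alpha>)) + int n - 1) (int n - 1))))
       = ballot m t * (\<Sum>\<beta>\<le>p - j - 2 * t. 2 ^ (p - j - 2 * t - \<beta>)
         * real (l choose \<beta>) * real ((n - l) choose (p - j - 2 * t - \<beta>)) *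
        (\<Sum>\<alpha>\<le>\<beta>. real (\<beta> choose \<alpha>) * (\<Sum>i<j.
          ibinom (int r - int (i + (p - j - 2 * t - \<beta>) + t + (\<beta> - \<alpha>)) + int n - 1) (int n - 1))))"
        by (simp add: sum_distrib_left mult.assoc)
      also have "(\<Sum>\<beta>\<le>p - j - 2 * t. 2 ^ (p - j - 2 * t - \<beta>)
         * real (l choose \<beta>) * real ((n - l) choose (p - j - 2 * t - \<beta>)) *
        (\<Sum>\<alpha>\<le>\<beta>. real (\<beta> choose \<alpha>) * (\<Sum>i<j.
          ibinom (int r - int (i + (p - j - 2 * t - \<beta>) + t + (\<beta> - \<alpha>)) + int n - 1) (int n - 1))))
        = (\<Sum>\<beta> = 0..int p - int j - 2 * int t.
             2 ^ nat (int p - int j - 2 * int t - \<beta>) * ibinom (N - Z) \<beta> * ibinom Z (int p - int j - 2 * int t - \<beta>) *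
             (\<Sum>\<alpha> = 0..\<beta>. ibinom \<beta> \<alpha> *
                (\<Sum>i = 0..int j - 1. ibinom (int r - i - int p + \<alpha> + t + int j + N - 1) (N - 1))))"
        unfolding B sum_int_interval
      proof (intro sum.cong refl)
        fix \<beta> assume b: "\<beta> \<in> {..p - j - 2 * t}"
        have e: "nat (int (p - j - 2 * t) - int \<beta>) = p - j - 2 * t - \<beta>"
          "N - Z = int l" "int (p - j - 2 * t) - int \<beta> = int (p - j - 2 * t - \<beta>)"
          using b assms by (auto simp: of_nat_diff)
        have "(\<Sum>i<j. ibinom (int r - int (i + (p - j - 2 * t - \<beta>) + t + (\<beta> - \<alpha>)) + int n - 1) (int n - 1))
           = (\<Sum>i = 0..int j - 1. ibinom (int r - i - int p + int \<alpha> + t + int j + N - 1) (N - 1))" if "\<alpha> \<le> \<beta>" for \<alpha>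
          unfolding sum_int_interval_pred
        proof (intro sum.cong refl arg_cong2[where f = ibinom])
          fix i show "int r - int (i + (p - j - 2 * t - \<beta>) + t + (\<beta> - \<alpha>)) + int n - 1
             = int r - int i - int p + int \<alpha> + int t + int j + N - 1"
            using that b j t by (auto simp: N_def of_nat_diff)
        qed (simp add: N_def)
        then show "2 ^ (p - j - 2 * t - \<beta>)
         * real (l choose \<beta>) * real ((n - l) choose (p - j - 2 * t - \<beta>)) *
        (\<Sum>\<alpha>\<le>\<beta>. real (\<beta> choose \<alpha>) * (\<Sum>i<j.
          ibinom (int r - int (i + (p - j - 2 * t - \<beta>) + t + (\<beta> - \<alpha>)) + int n - 1) (int n - 1)))
         = 2 ^ nat (int (p - j - 2 * t) - int \<beta>) * ibinom (N - Z) (int \<beta>) * ibinom Z (int (p - j - 2 * t) - int \<beta>) *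
             (\<Sum>\<alpha> \<le> \<beta>. ibinom (int \<beta>) (int \<alpha>) *
                (\<Sum>i = 0..int j - 1. ibinom (int r - i - int p + int \<alpha> + t + int j + N - 1) (N - 1)))"
          unfolding e unfolding Z_def ib by (intro arg_cong2[where f = "(*)"] sum.cong refl) auto
      qed
      finally show "(\<Sum>\<beta>\<le>p - j - 2 * t. ballot (n - (p - j) + 2 * t) t * 2 ^ (p - j - 2 * t - \<beta>)
         * real (l choose \<beta>) * real ((n - l) choose (p - j - 2 * t - \<beta>)) *
        (\<Sum>\<alpha>\<le>\<beta>. real (\<beta> choose \<alpha>) * (\<Sum>i<j.
          ibinom (int r - int (i + (p - j - 2 * t - \<beta>) + t + (\<beta> - \<alpha>)) + int n - 1) (int n - 1))))
        = (real_of_int (N - int p + int j + 1) / real_of_int (N - int p + int j + int t + 1)) *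
          ibinom (N - int p + int j + 2 * int t) (int t) *
          (\<Sum>\<beta> = 0..int p - int j - 2 * int t.
             2 ^ nat (int p - int j - 2 * int t - \<beta>) * ibinom (N - Z) \<beta> * ibinom Z (int p - int j - 2 * int t - \<beta>) *
             (\<Sum>\<alpha> = 0..\<beta>. ibinom \<beta> \<alpha> *
                (\<Sum>i = 0..int j - 1. ibinom (int r - i - int p + \<alpha> + int t + int j + N - 1) (N - 1))))"
        unfolding m(2-4) ib of_int_of_nat_eq ballot_quotient[OF m(1), symmetric] unfolding m_def .
    qed
  qed
qed

section \<open>Support and leading coefficient of the series\<close>

definition zdeg_le :: "nat \<Rightarrow> real fps fps \<Rightarrow> bool" where
  "zdeg_le c F \<longleftrightarrow> (\<forall>p r. F $ p $ r \<noteq> 0 \<longrightarrow> p \<le> c + 2 * r)"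

text \<open>The bounds add because the degrees in z and in w both add. In
  \<open>gen_coeff_support\<close> only z and 1 + z need c = 1; in the other factors each w pays for
  at most two z.\<close>

lemma zdeg_le_mult:
  assumes "zdeg_le c F" "zdeg_le c' G"
  shows "zdeg_le (c + c') (F * G)"
  unfolding zdeg_le_def
proof (intro allI impI)
  fix p r assume "(F * G) $ p $ r \<noteq> 0"
  then have "(\<Sum>i=0..p. \<Sum>j=0..r. F $ i $ j * G $ (p - i) $ (r - j)) \<noteq> 0"
    by (simp add: fps_mult_nth fps_sum_nth)
  then obtain i where i: "i \<in> {0..p}" "(\<Sum>j=0..r. F $ i $ j * G $ (p - i) $ (r - j)) \<noteq> 0"
    by (rule sum.not_neutral_contains_not_neutral)
  then obtain j where j: "j \<in> {0..r}" "F $ i $ j * G $ (p - i) $ (r - j) \<noteq> 0"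
    using sum.not_neutral_contains_not_neutral by blast
  then have "i \<le> c + 2 * j" "p - i \<le> c' + 2 * (r - j)"
    using assms unfolding zdeg_le_def by auto
  then show "p \<le> c + c' + 2 * r" using i j by auto
qed

lemma zdeg_le_1: "zdeg_le 0 1"
  by (auto simp: zdeg_le_def fps_one_nth split: if_splits)

lemma zdeg_le_power: "zdeg_le c F \<Longrightarrow> zdeg_le (m * c) (F ^ m)"
  by (induction m) (auto simp: zdeg_le_1 intro: zdeg_le_mult)

lemma zdeg_le_add: "zdeg_le c F \<Longrightarrow> zdeg_le c G \<Longrightarrow> zdeg_le c (F + G)"
  unfolding zdeg_le_def by (metis add.right_neutral fps_add_nth)

lemma zdeg_le_diff: "zdeg_le c F \<Longrightarrow> zdeg_le c G \<Longrightarrow> zdeg_le c (F - G)"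
  unfolding zdeg_le_def by (metis diff_zero fps_sub_nth)

lemma zdeg_le_mono: "zdeg_le c F \<Longrightarrow> c \<le> c' \<Longrightarrow> zdeg_le c' F"
  unfolding zdeg_le_def by (meson add_le_mono1 le_trans)

lemma zdeg_le_const: "zdeg_le 0 (fps_const F)"
  by (auto simp: zdeg_le_def split: if_splits)

lemma zdeg_le_z: "zdeg_le 1 ser_z"
  by (auto simp: zdeg_le_def ser_z_def fps_X_def split: if_splits)

lemma zdeg_le_wz: "zdeg_le 0 (ser_w * ser_z)" and zdeg_le_wz2: "zdeg_le 0 (ser_w * ser_z^2)"
  by (auto simp: zdeg_le_def ser_z_def ser_w_def fps_X_nth fps_X_power_nth split: if_splits)

text \<open>For l >= 1 the infinite series 1/(1 + z), which satisfies no bound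
  \<open>zdeg_le\<close>, cancels against a factor of \<open>pol12 ^ l\<close>.\<close>

lemma gen_eq_pred:
  assumes "1 \<le> l"
  shows "gen n l = ser_z * (1 - ser_w * ser_z^2) * pol12 ^ (l - 1) * pol4 ^ (n - l) * inv3 ^ n"
proof -
  have l: "pol12 ^ l = pol12 * pol12 ^ (l - 1)" using assms by (simp add: power_eq_if)
  have "gen n l = (pol12 * (inv1 * inv2)) * (ser_z * (1 - ser_w * ser_z^2) * pol12 ^ (l - 1) * pol4 ^ (n - l) * inv3 ^ n)"
    unfolding gen_def l by (simp only: mult_ac)
  then show ?thesis using unit12 by simp
qed

text \<open>With k + p - N = 2r the conclusion reads N - l <= k, and in this form it bounds the
  support of the formula.\<close>

lemma gen_coeff_support:
  assumes "gen_coeff n p l r \<noteq> 0" "1 \<le> l"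
  shows "p \<le> l + 2 * r"
proof -
  have one: "zdeg_le 0 1" by (rule zdeg_le_1)
  have p2: "zdeg_le 0 (1 + ser_w * ser_z)" by (rule zdeg_le_add[OF one zdeg_le_wz])
  have p1: "zdeg_le 1 (1 + ser_z)" by (rule zdeg_le_add[OF zdeg_le_mono[OF one] zdeg_le_z]) simp
  have "pol4 = 1 + (ser_w * ser_z + ser_w * ser_z) + ser_w * ser_z^2" by (simp add: pol4_def)
  then have p4: "zdeg_le 0 pol4" by (metis zdeg_le_add one zdeg_le_wz zdeg_le_wz2)
  have p5: "zdeg_le 0 (1 - ser_w * ser_z^2)" by (rule zdeg_le_diff[OF one zdeg_le_wz2])
  have p12: "zdeg_le 1 pol12" unfolding pol12_def using zdeg_le_mult[OF p1 p2] by simp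
  have i3: "zdeg_le 0 inv3" unfolding inv3_def by (rule zdeg_le_const)
  have "zdeg_le (1 + 0 + (l - 1) * 1 + (n - l) * 0 + n * 0) (gen n l)"
    unfolding gen_eq_pred[OF assms(2)]
    by (intro zdeg_le_mult zdeg_le_power zdeg_le_z p5 p12 p4 i3)
  then show ?thesis using assms unfolding zdeg_le_def gen_coeff_def by force
qed

definition w_zero :: "real fps fps \<Rightarrow> real fps" where
  "w_zero F = Abs_fps (\<lambda>p. F $ p $ 0)"

lemma w_zero_mult: "w_zero (F * G) = w_zero F * w_zero G"
  by (simp add: w_zero_def fps_eq_iff fps_mult_nth fps_sum_nth)

lemma w_zero_power: "w_zero (F ^ m) = w_zero F ^ m"
  by (induction m) (simp_all add: w_zero_mult, simp add: w_zero_def fps_eq_iff fps_one_nth)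

text \<open>The ring homomorphism w = 0 leaves z (1 + z)^(p-1), whose top coefficient is 1. The
  highest weight has l = p and r = 0, so this is the value there.\<close>

lemma gen_coeff_leading:
  assumes "1 \<le> p"
  shows "gen_coeff n p p 0 = 1"
proof -
  have z: "w_zero ser_z = fps_X" "w_zero (1 - ser_w * ser_z^2) = 1" "w_zero pol12 = 1 + fps_X" "w_zero pol4 = 1" "w_zero inv3 = 1"
    by (simp_all add: w_zero_def fps_eq_iff ser_z_def ser_w_def pol12_def pol4_def inv3_def fps_one_nth fps_X_nth algebra_simps numeral_fps_const)
  have "gen_coeff n p p 0 = w_zero (gen n p) $ p" by (simp add: gen_coeff_def w_zero_def)
  also have "w_zero (gen n p) = fps_X * (1 + fps_X) ^ (p - 1)"
    unfolding gen_eq_pred[OF assms] w_zero_mult w_zero_power z by simp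
  also have "\<dots> $ p = ((1 + fps_X) ^ (p - 1) :: real fps) $ (p - 1)" using assms by simp
  also have "\<dots> = 1"
  proof -
    have "(1 + fps_X :: real fps) ^ (p - 1) = (\<Sum>k\<le>p - 1. of_nat (p - 1 choose k) * fps_X ^ k)"
      using binomial_ring[of "fps_X :: real fps" 1 "p - 1"] by (simp add: add.commute)
    then show ?thesis by (simp add: fps_sum_nth fps_X_power_nth fps_of_nat[symmetric] if_distrib cong: if_cong del: fps_of_nat)
  qed
  finally show ?thesis .
qed

section \<open>Freudenthal's recursion for the closed formula\<close>

definition nonzero_count :: "nat \<Rightarrow> (nat \<Rightarrow> int) \<Rightarrow> nat" where
  "nonzero_count n \<mu> = card {i. i < n \<and> \<mu> i \<noteq> 0}"

text \<open>Extension by zero for N > K and for the wrong parity lets string sums run past the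
  support.\<close>

definition shell_coeff :: "nat \<Rightarrow> nat \<Rightarrow> int \<Rightarrow> nat \<Rightarrow> int \<Rightarrow> real" where
  "shell_coeff n p K l N = (if N \<le> K \<and> even (K - N) then gen_coeff n p l (nat ((K - N) div 2)) else 0)"

definition mult_formula :: "nat \<Rightarrow> nat \<Rightarrow> int \<Rightarrow> (nat \<Rightarrow> int) \<Rightarrow> real" where
  "mult_formula n p K \<mu> = shell_coeff n p K (nonzero_count n \<mu>) (wnorm n \<mu>)"

lemma even_diff_half:
  assumes "N \<le> K" "even (K - N)"
  obtains r :: nat where "K - N = 2 * int r"
proof -
  obtain t where t: "K - N = 2 * t" using assms(2) by (elim evenE)
  then have "K - N = 2 * int (nat t)" using assms(1) by simp
  then show ?thesis by (rule that)
qed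

text \<open>Terms with N + 2j > K vanish, so every cutoff from K on gives the same sum. This is what
  makes the finite cutoff of root strings harmless.\<close>

lemma shell_coeff_tail:
  assumes "0 \<le> N" "K \<le> int M"
  shows "(\<Sum>j=1..M. g j * shell_coeff n p K l (N + 2 * int j))
    = (if N \<le> K \<and> even (K - N) then \<Sum>j=1..nat ((K - N) div 2). g j * gen_coeff n p l (nat ((K - N) div 2) - j) else 0)"
proof (cases "N \<le> K \<and> even (K - N)")
  case True
  then obtain q where q: "K - N = 2 * int q" using even_diff_half by blast
  have "shell_coeff n p K l (N + 2 * int j) = (if j \<le> q then gen_coeff n p l (q - j) else 0)" for j
    using q by (auto simp: shell_coeff_def algebra_simps of_nat_diff nat_diff_distrib' intro!: arg_cong[where f = "gen_coeff n p l"])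
  then have "(\<Sum>j=1..M. g j * shell_coeff n p K l (N + 2 * int j)) = (\<Sum>j=1..M. if j \<le> q then g j * gen_coeff n p l (q - j) else 0)"
    by (intro sum.cong) auto
  also have "\<dots> = (\<Sum>j=1..q. g j * gen_coeff n p l (q - j))"
    using assms q by (intro sum.mono_neutral_cong_right) auto
  finally show ?thesis using True q by simp
next
  case False
  then have "shell_coeff n p K l (N + 2 * int j) = 0" for j
    by (auto simp: shell_coeff_def)
  then show ?thesis unfolding if_not_P[OF False] by simp
qed

context
  fixes n p :: nat and K :: int and J :: nat
  assumes J: "K \<le> int J"
begin

private abbreviation "f \<equiv> shell_coeff n p K"

lemma shell_coeff_A:
  assumes "1 \<le> l" "l \<le> n" "0 \<le> N"
  shows "(2 * real_of_int (K - N) - 2 * real p + 2 * real l) * f l N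
    = 2 * (real l - 1) * f (l - 1) N
      + 4 * (real l * (\<Sum>j=1..J. f l (N + 2 * int j)) + real (n - l) * (\<Sum>j=1..J. f (l + 1) (N + 2 * int j)))"
proof (cases "N \<le> K \<and> even (K - N)")
  case True
  then obtain r where K: "K - N = 2 * int r" using even_diff_half by blast
  have r: "real_of_int (K - N) = 2 * real r" unfolding K by simp
  have r_def: "r = nat ((K - N) div 2)" unfolding K by simp
  have t: "(\<Sum>j=1..J. f l' (N + 2 * int j)) = (\<Sum>j=1..r. gen_coeff n p l' (r - j))" for l'
    using shell_coeff_tail[OF assms(3) J, of "\<lambda>_. 1"] unfolding if_P[OF True] by (simp add: r_def)
  have "f l' N = gen_coeff n p l' r" for l'
    using True by (simp add: shell_coeff_def r_def)
  then show ?thesis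
    using gen_coeff_A[OF assms(1,2), of r p] unfolding t r by (simp add: sum.distrib sum_distrib_left)
next
  case False
  have t: "(\<Sum>j=1..J. f l' (N + 2 * int j)) = 0" for l'
    using shell_coeff_tail[OF assms(3) J, of "\<lambda>_. 1"] unfolding if_not_P[OF False] by simp
  have "f l' N = 0" for l'
    using False by (auto simp: shell_coeff_def)
  then show ?thesis
    unfolding t by simp
qed

lemma shell_coeff_B:
  assumes "l \<le> n" "0 \<le> N"
  shows "real_of_int (K - N) * (real_of_int (K - N) - 2 * real p + 2 * real n + 2) * f l N
    = 4 * (real l * (real l + 1) * (\<Sum>j=1..J. real j * f l (N + 2 * int j))
       + 2 * real (n - l) * (real l + 1) * (\<Sum>j=1..J. real j * f (l + 1) (N + 2 * int j))
       + real (n - l) * (real (n - l) - 1) * (\<Sum>j=1..J. real j * f (l + 2) (N + 2 * int j)))"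
proof (cases "N \<le> K \<and> even (K - N)")
  case True
  then obtain r where K: "K - N = 2 * int r" using even_diff_half by blast
  have r: "real_of_int (K - N) = 2 * real r" unfolding K by simp
  have r_def: "r = nat ((K - N) div 2)" unfolding K by simp
  have t: "(\<Sum>j=1..J. real j * f l' (N + 2 * int j)) = (\<Sum>j=1..r. real j * gen_coeff n p l' (r - j))" for l'
    using shell_coeff_tail[OF assms(2) J] True by (simp add: r_def)
  have "4 * (real r * (real r - real p + real n + 1) * gen_coeff n p l r)
    = 4 * (real l * (real l + 1) * (\<Sum>j=1..r. real j * gen_coeff n p l (r - j))
       + 2 * real (n - l) * (real l + 1) * (\<Sum>j=1..r. real j * gen_coeff n p (l + 1) (r - j))
       + real (n - l) * (real (n - l) - 1) * (\<Sum>j=1..r. real j * gen_coeff n p (l + 2) (r - j)))"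
    unfolding gen_coeff_B[OF assms(1)] sum_distrib_left sum.distrib[symmetric] by (intro sum.cong refl) (simp add: algebra_simps)
  then show ?thesis
    unfolding t r using True by (simp add: shell_coeff_def r_def[symmetric] algebra_simps)
next
  case False
  have t: "(\<Sum>j=1..J. real j * f l' (N + 2 * int j)) = 0" for l'
    using shell_coeff_tail[OF assms(2) J] unfolding if_not_P[OF False] by simp
  have "f l N = 0"
    using False by (auto simp: shell_coeff_def)
  then show ?thesis
    unfolding t by simp
qed

text \<open>The pairing with a root grows linearly along its string, so string sums reduce to these
  plain and weighted tails.\<close>

definition tA where "tA l N = (\<Sum>j=1..J. f l (N + 2 * int j))"
definition tB where "tB l N = (\<Sum>j=1..J. real j * f l (N + 2 * int j))"

lemma tail_linear:
  assumes "0 \<le> N" "J \<le> M"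
  shows "(\<Sum>j=1..M. (c + 2 * real j) * f l (N + 2 * int j)) = c * tA l N + 2 * tB l N"
proof -
  have "K \<le> int M" using J assms by simp
  have "(\<Sum>j=1..M. (c + 2 * real j) * f l (N + 2 * int j)) = (\<Sum>j=1..J. (c + 2 * real j) * f l (N + 2 * int j))"
    unfolding shell_coeff_tail[OF assms(1) J] shell_coeff_tail[OF assms(1) \<open>K \<le> int M\<close>] ..
  also have "\<dots> = c * tA l N + 2 * tB l N"
    unfolding tA_def tB_def sum_distrib_left sum.distrib[symmetric] by (intro sum.cong refl) (simp add: algebra_simps)
  finally show ?thesis .
qed

text \<open>The contribution of the roots \<open>\<epsilon>\<^sub>i \<plusminus> \<epsilon>\<^sub>j\<close>, where \<open>a, b\<close> are the entries at \<open>i, j\<close>.\<close>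

lemma pair_strings:
  fixes a b :: int and l0 :: nat and N0 :: int and g :: "int \<Rightarrow> int \<Rightarrow> real" and u v :: real
  defines "g \<equiv> \<lambda>a b. f (l0 + of_bool (a \<noteq> 0) + of_bool (b \<noteq> 0)) (N0 + \<bar>a\<bar> + \<bar>b\<bar>)"
    and "u \<equiv> of_bool (a \<noteq> 0)" and "v \<equiv> of_bool (b \<noteq> 0)"
    and "l \<equiv> l0 + of_bool (a \<noteq> 0) + of_bool (b \<noteq> 0)" and "N \<equiv> N0 + \<bar>a\<bar> + \<bar>b\<bar>"
  assumes ab: "0 \<le> b" "b \<le> a" and N0: "0 \<le> N0" and H: "int J + N \<le> int H"
  shows "(a - b) * g a b + 2 * (\<Sum>h=1..H. (a - b + 2 * int h) * g (a + int h) (b - int h))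
       + ((a + b) * g a b + 2 * (\<Sum>h=1..H. (a + b + 2 * int h) * g (a + int h) (b + int h)))
    = 2 * a * b * f l N + 2 * (a * v + b * u) * f (l - 1) N + 4 * (a * v + b * u) * tA l N + 8 * u * v * tB l N
      + (a * (1 - v) + b * (1 - u)) * (2 * f l N + 4 * tA (l + 1) N)
      + 8 * (u * (1 - v) + v * (1 - u)) * tB (l + 1) N + 8 * (1 - u) * (1 - v) * tB (l + 2) N"
proof -
  have N: "0 \<le> N" using N0 by (simp add: N_def)
  have HJ: "J \<le> H" using H N by simp
  have plus: "(\<Sum>h=1..H. (a + b + 2 * int h) * g (a + int h) (b + int h)) = (a + b) * tA (l0 + 2) N + 2 * tB (l0 + 2) N"
  proof -
    have "(\<Sum>h=1..H. (a + b + 2 * int h) * g (a + int h) (b + int h))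
        = (\<Sum>h=1..H. (real_of_int (a + b) + 2 * real h) * f (l0 + 2) (N + 2 * int h))"
    proof (intro sum.cong refl)
      fix h assume h: "h \<in> {1..H}"
      have "N0 + \<bar>a + int h\<bar> + \<bar>b + int h\<bar> = N + 2 * int h" using ab by (simp add: N_def)
      moreover have "a + int h \<noteq> 0" "b + int h \<noteq> 0" using ab h by auto
      ultimately have "g (a + int h) (b + int h) = f (l0 + 2) (N + 2 * int h)"
        by (simp add: g_def)
      then show "(a + b + 2 * int h) * g (a + int h) (b + int h)
          = (real_of_int (a + b) + 2 * real h) * f (l0 + 2) (N + 2 * int h)" by simp
    qed
    then show ?thesis unfolding tail_linear[OF N HJ] .
  qed
  \<comment> \<open>The indicators \<open>u\<close> and \<open>v\<close> encode the three cases in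
    one right-hand side. For b = 0 the entries h and -h have the same absolute value, so both
    strings give equal sums.\<close>
  consider "b = 0" "a = 0" | "b = 0" "0 < a" | "0 < b" using ab by linarith
  then show ?thesis
  proof cases
    case 1
    have "(\<Sum>h=1..H. (a - b + 2 * int h) * g (a + int h) (b - int h)) = (\<Sum>h=1..H. (a + b + 2 * int h) * g (a + int h) (b + int h))"
      using 1 by (intro sum.cong refl) (simp add: g_def)
    then show ?thesis unfolding plus using 1 by (simp add: u_def v_def l_def g_def)
  next
    case 2
    have "(\<Sum>h=1..H. (a - b + 2 * int h) * g (a + int h) (b - int h)) = (\<Sum>h=1..H. (a + b + 2 * int h) * g (a + int h) (b + int h))"
      using 2 by (intro sum.cong refl) (simp add: g_def)
    then show ?thesis unfolding plus using 2 by (simp add: u_def v_def l_def g_def N_def algebra_simps)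
  next
    case 3
    then have l: "l = l0 + 2" and uv: "u = 1" "v = 1" using ab by (auto simp: l_def u_def v_def)
    \<comment> \<open>The string of \<open>\<epsilon>\<^sub>i - \<epsilon>\<^sub>j\<close> has three
      stretches: for h < b both entries are nonzero and the norm stays \<open>N\<close>; at h = b
      one entry is zero, giving l - 1; for h > b the norm grows by 2 per step.\<close>
    define c where "c = nat b - 1"
    have c: "b = int c + 1" using 3 by (simp add: c_def)
    \<comment> \<open>At least \<open>J\<close> steps remain after the first b, so the last stretch
      is a complete tail.\<close>
    have cH: "c + 1 \<le> H" "J \<le> H - (c + 1)" using H 3 N0 ab by (auto simp: N_def c)
    let ?t = "\<lambda>h. (a - b + 2 * int h) * g (a + int h) (b - int h)"
    have "{1..H} = {1..c} \<union> {c + 1} \<union> {c + 2..H}" using cH by auto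
    then have "(\<Sum>h=1..H. ?t h) = (\<Sum>h\<in>({1..c} \<union> {c + 1}) \<union> {c + 2..H}. ?t h)" by simp
    also have "\<dots> = (\<Sum>h=1..c. ?t h) + ?t (c + 1) + (\<Sum>h=c + 2..H. ?t h)"
      by (subst sum.union_disjoint; simp)
    also have "(\<Sum>h=1..c. ?t h) = (\<Sum>h=1..c. (a - b + 2 * int h)) * f l N"
    proof -
      have "?t h = real_of_int (a - b + 2 * int h) * f l N" if "h \<in> {1..c}" for h
      proof -
        have "N0 + \<bar>a + int h\<bar> + \<bar>b - int h\<bar> = N" "a + int h \<noteq> 0" "b - int h \<noteq> 0"
          using that ab 3 by (auto simp: N_def c)
        then show ?thesis by (simp add: g_def l)
      qed
      then show ?thesis unfolding of_int_sum sum_distrib_right by (intro sum.cong) auto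
    qed
    also have "(\<Sum>h=1..c. (a - b + 2 * int h)) = (b - 1) * a"
    proof -
      have "(\<Sum>h=1..c. (a - b + 2 * int h)) = int c * (a - b) + int c * (int c + 1)"
        by (induction c) (auto simp: algebra_simps)
      then show ?thesis by (simp add: c algebra_simps)
    qed
    also have "?t (c + 1) = (a + b) * f (l - 1) N"
    proof -
      have "a + b = a + int (c + 1)" "b - int (c + 1) = 0" "a - b + 2 * int (c + 1) = a + b" using c by auto
      moreover have "a + b \<noteq> 0" "\<bar>a + b\<bar> = \<bar>a\<bar> + \<bar>b\<bar>" using 3 ab by auto
      ultimately show ?thesis by (simp add: g_def l N_def add.assoc)
    qed
    also have "(\<Sum>h=c + 2..H. ?t h) = (\<Sum>j=1..H - (c + 1). (real_of_int (a + b) + 2 * real j) * f l (N + 2 * int j))"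
    proof (rule sum.reindex_bij_witness[of _ "\<lambda>j. j + (c + 1)" "\<lambda>h. h - (c + 1)"])
      fix h assume h: "h \<in> {c + 2..H}"
      then obtain j where j: "h = j + (c + 1)" "j \<noteq> 0" by (metis add.assoc add_cancel_right_left atLeastAtMost_iff le_iff_add nat_1_add_1 add.commute Suc_1 not_less_eq_eq One_nat_def)
      have "N0 + \<bar>a + int h\<bar> + \<bar>b - int h\<bar> = N + 2 * int j" "a + int h \<noteq> 0" "b - int h \<noteq> 0" "a - b + 2 * int h = a + b + 2 * int j"
        using j ab 3 by (auto simp: N_def c)
      then show "(real_of_int (a + b) + 2 * real (h - (c + 1))) * f l (N + 2 * int (h - (c + 1))) = ?t h"
      proof -
        have "h - (c + 1) = j" using j by simp
        moreover have "g (a + int h) (b - int h) = f l (N + 2 * int j)"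
          unfolding g_def l \<open>N0 + \<bar>a + int h\<bar> + \<bar>b - int h\<bar> = N + 2 * int j\<close>
          using \<open>a + int h \<noteq> 0\<close> \<open>b - int h \<noteq> 0\<close> by (simp only: of_bool_eq not_False_eq_True) simp
        moreover have "real_of_int (a - b + 2 * int h) = real_of_int (a + b) + 2 * real j"
          unfolding \<open>a - b + 2 * int h = a + b + 2 * int j\<close> by simp
        ultimately show ?thesis by simp
      qed
    qed (use cH in auto)
    also have "\<dots> = (a + b) * tA l N + 2 * tB l N"
      unfolding tail_linear[OF N cH(2)] ..
    finally have minus: "(\<Sum>h=1..H. ?t h)
        = real_of_int ((b - 1) * a) * f l N + real_of_int (a + b) * f (l - 1) N + (real_of_int (a + b) * tA l N + 2 * tB l N)" .
    have "g a b = f l N" by (simp add: g_def l_def N_def)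
    then show ?thesis
      unfolding plus minus l[symmetric] uv by (simp add: algebra_simps)
  qed
qed

text \<open>A long root shifts one entry by two, so the string from a >= 0 moves away from zero and
  runs through the shells N + 2h.\<close>

lemma single_strings:
  fixes a :: int and l0 :: nat and N0 :: int and g :: "int \<Rightarrow> real" and u :: real
  defines "g \<equiv> \<lambda>a. f (l0 + of_bool (a \<noteq> 0)) (N0 + \<bar>a\<bar>)"
    and "u \<equiv> of_bool (a \<noteq> 0)"
    and "l \<equiv> l0 + of_bool (a \<noteq> 0)" and "N \<equiv> N0 + \<bar>a\<bar>"
  assumes a: "0 \<le> a" and N0: "0 \<le> N0" and H: "int J + N \<le> int H"
  shows "2 * a * g a + 2 * (\<Sum>h=1..H. (2 * a + 4 * int h) * g (a + 2 * int h))
    = 2 * a * f l N + 4 * a * tA l N + 8 * u * tB l N + 8 * (1 - u) * tB (l + 1) N"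
proof -
  have N: "0 \<le> N" using N0 by (simp add: N_def)
  have HJ: "J \<le> H" using H N by simp
  have "(\<Sum>h=1..H. (2 * a + 4 * int h) * g (a + 2 * int h)) = 2 * (\<Sum>h=1..H. (real_of_int a + 2 * real h) * f (l0 + 1) (N + 2 * int h))"
    unfolding sum_distrib_left
  proof (intro sum.cong refl)
    fix h assume h: "h \<in> {1..H}"
    have "N0 + \<bar>a + 2 * int h\<bar> = N + 2 * int h" using a by (simp add: N_def)
    moreover have "a + 2 * int h \<noteq> 0" using a h by auto
    ultimately show "(2 * a + 4 * int h) * g (a + 2 * int h) = 2 * ((real_of_int a + 2 * real h) * f (l0 + 1) (N + 2 * int h))"
      by (simp add: g_def)
  qed
  also have "\<dots> = 2 * (a * tA (l0 + 1) N + 2 * tB (l0 + 1) N)"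
    unfolding tail_linear[OF N HJ] ..
  finally show ?thesis
    by (cases "a = 0") (simp_all add: g_def u_def l_def N_def algebra_simps)
qed

end

text \<open>For a positive root \<alpha> these are (\<mu>, \<alpha>) f(\<mu>) plus twice the sum of
  (\<mu> + h\<alpha>, \<alpha>) f(\<mu> + h\<alpha>) over 1 <= h <= H. The first terms add up to
  (\<mu>, 2\<rho>) f(\<mu>), so with (\<mu>, \<mu>) f(\<mu>) the total is, by Freudenthal's formula,
  the Casimir eigenvalue times f(\<mu>).\<close>

definition str_diff where
  "str_diff H f \<mu> i j = real_of_int (\<mu> i - \<mu> j) * f \<mu>
     + 2 * (\<Sum>h=1..H. real_of_int (\<mu> i - \<mu> j + 2 * int h) * f (\<mu>(i := \<mu> i + int h, j := \<mu> j - int h)))"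

definition str_sum where
  "str_sum H f \<mu> i j = real_of_int (\<mu> i + \<mu> j) * f \<mu>
     + 2 * (\<Sum>h=1..H. real_of_int (\<mu> i + \<mu> j + 2 * int h) * f (\<mu>(i := \<mu> i + int h, j := \<mu> j + int h)))"

definition str_long where
  "str_long H f \<mu> i = real_of_int (2 * \<mu> i) * f \<mu>
     + 2 * (\<Sum>h=1..H. real_of_int (2 * \<mu> i + 4 * int h) * f (\<mu>(i := \<mu> i + 2 * int h)))"

text \<open>The infinite root strings are cut off at \<open>H\<close>, which is taken beyond the support of \<open>f\<close>.\<close>

definition freudenthal :: "nat \<Rightarrow> nat \<Rightarrow> ((nat \<Rightarrow> int) \<Rightarrow> real) \<Rightarrow> (nat \<Rightarrow> int) \<Rightarrow> real" where
  "freudenthal n H f \<mu> = (\<Sum>i<n. (real_of_int (\<mu> i))\<^sup>2) * f \<mu>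
     + (\<Sum>j<n. \<Sum>i<j. str_diff H f \<mu> i j + str_sum H f \<mu> i j) + (\<Sum>i<n. str_long H f \<mu> i)"

lemma sum_fun_upd2:
  fixes \<phi> :: "int \<Rightarrow> 'a::comm_monoid_add" and n :: nat
  assumes "i < n" "j < n" "i \<noteq> j"
  shows "(\<Sum>t<n. \<phi> ((\<mu>(i := a, j := b)) t)) = (\<Sum>t\<in>{..<n} - {i, j}. \<phi> (\<mu> t)) + \<phi> a + \<phi> b"
proof -
  have "(\<Sum>t<n. g t) = g i + (g j + (\<Sum>t\<in>{..<n} - {i, j}. g t))" for g :: "nat \<Rightarrow> 'a"
    using assms by (simp add: sum.remove[of "{..<n}" i] sum.remove[of "{..<n} - {i}" j] Diff_insert2[of _ i "{j}"])
  moreover have "(\<Sum>t\<in>{..<n} - {i, j}. \<phi> ((\<mu>(i := a, j := b)) t)) = (\<Sum>t\<in>{..<n} - {i, j}. \<phi> (\<mu> t))"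
    by (intro sum.cong) auto
  ultimately show ?thesis using assms by (simp add: ac_simps)
qed

lemma sum_fun_upd:
  fixes \<phi> :: "int \<Rightarrow> 'a::comm_monoid_add" and n :: nat
  assumes "i < n"
  shows "(\<Sum>t<n. \<phi> ((\<mu>(i := a)) t)) = (\<Sum>t\<in>{..<n} - {i}. \<phi> (\<mu> t)) + \<phi> a"
proof -
  have "(\<Sum>t<n. g t) = g i + (\<Sum>t\<in>{..<n} - {i}. g t)" for g :: "nat \<Rightarrow> 'a"
    using assms by (simp add: sum.remove[of "{..<n}" i])
  moreover have "(\<Sum>t\<in>{..<n} - {i}. \<phi> ((\<mu>(i := a)) t)) = (\<Sum>t\<in>{..<n} - {i}. \<phi> (\<mu> t))"
    by (intro sum.cong) auto
  ultimately show ?thesis by (simp add: ac_simps)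
qed

lemma nonzero_count_sum: "nonzero_count n \<mu> = (\<Sum>t<n. of_bool (\<mu> t \<noteq> 0))"
proof -
  have "{i. i < n \<and> \<mu> i \<noteq> 0} = {t \<in> {..<n}. \<mu> t \<noteq> 0}" by auto
  then show ?thesis by (simp add: nonzero_count_def sum.If_cases of_bool_def Int_def)
qed

lemma nonzero_count_le: "nonzero_count n \<mu> \<le> n"
  unfolding nonzero_count_sum using sum_mono[of "{..<n}" "\<lambda>t. of_bool (\<mu> t \<noteq> 0)" "\<lambda>_. 1::nat"] by simp

lemma sum_pairs:
  fixes W :: "nat \<Rightarrow> nat \<Rightarrow> 'a::comm_ring_1"
  assumes "\<And>i j. W i j = W j i"
  shows "2 * (\<Sum>j<n. \<Sum>i<j. W i j) = (\<Sum>i<n. \<Sum>j<n. W i j) - (\<Sum>i<n. W i i)"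
proof (induction n)
  case (Suc n)
  have "(\<Sum>j<n. W n j) = (\<Sum>i<n. W i n)" using assms by (intro sum.cong) auto
  with Suc show ?case by (simp add: sum.distrib algebra_simps)
qed simp

text \<open>Applied with \<open>a\<close> the entries of a dominant weight and \<open>u\<close> the
  indicator of nonzero entries: the sum over pairs then depends only on the entry sum, the number of
  nonzero entries and the sum of squares. It is half of the full double sum minus the diagonal,
  where \<open>u\<close> is idempotent and absorbed by \<open>a\<close>.\<close>

lemma sum_pairs_quadratic:
  fixes a u :: "nat \<Rightarrow> real" and c1 c2 c3 c4 c5 c6 :: real
  assumes u: "\<And>i. i < n \<Longrightarrow> u i * u i = u i" "\<And>i. i < n \<Longrightarrow> a i * u i = a i"
  defines "S \<equiv> \<Sum>i<n. a i" and "l \<equiv> \<Sum>i<n. u i" and "z \<equiv> real n - (\<Sum>i<n. u i)"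
  shows "(\<Sum>j<n. \<Sum>i<j. 2 * a i * a j * c1 + 2 * (a i * u j + a j * u i) * c2 + u i * u j * c3
     + (a i * (1 - u j) + a j * (1 - u i)) * c4 + (u i * (1 - u j) + u j * (1 - u i)) * c5 + (1 - u i) * (1 - u j) * c6)
   = (S * S - (\<Sum>i<n. a i ^ 2)) * c1 + 2 * S * (l - 1) * c2 + l * (l - 1) / 2 * c3 + S * z * c4 + l * z * c5 + z * (z - 1) / 2 * c6"
proof -
  let ?W = "\<lambda>i j. 2 * a i * a j * c1 + 2 * (a i * u j + a j * u i) * c2 + u i * u j * c3
     + (a i * (1 - u j) + a j * (1 - u i)) * c4 + (u i * (1 - u j) + u j * (1 - u i)) * c5 + (1 - u i) * (1 - u j) * c6"
  \<comment> \<open>Written as a sum of products of a function of \<open>i\<close> and a function of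
    \<open>j\<close>, so that each double sum factors.\<close>
  have "?W i j = a i * a j * (2 * c1) + (a i * u j) * (2 * c2 - c4) + (u i * a j) * (2 * c2 - c4) + u i * u j * (c3 - 2 * c5 + c6)
      + a i * 1 * c4 + 1 * a j * c4 + u i * 1 * (c5 - c6) + 1 * u j * (c5 - c6) + 1 * 1 * c6" for i j
    by (simp add: algebra_simps)
  then have "(\<Sum>i<n. \<Sum>j<n. ?W i j) = S * S * (2 * c1) + S * l * (2 * c2 - c4) + l * S * (2 * c2 - c4) + l * l * (c3 - 2 * c5 + c6)
      + S * n * c4 + n * S * c4 + l * n * (c5 - c6) + n * l * (c5 - c6) + n * n * c6"
    by (simp only: sum.distrib sum_distrib_right[symmetric] sum_product[symmetric] S_def[symmetric] l_def[symmetric])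
      (simp add: sum_distrib_left[symmetric] S_def[symmetric] l_def[symmetric] algebra_simps)
  moreover have "(\<Sum>i<n. ?W i i) = (\<Sum>i<n. a i ^ 2) * (2 * c1) + S * 4 * c2 + l * c3 + (real n - l) * c6"
  proof -
    have "?W i i = a i ^ 2 * (2 * c1) + a i * 4 * c2 + u i * c3 + (1 - u i) * c6" if "i < n" for i
      using u[OF that] by (cases "u i = 0") (auto simp: algebra_simps power2_eq_square)
    then have "(\<Sum>i<n. ?W i i) = (\<Sum>i<n. a i ^ 2 * (2 * c1) + a i * 4 * c2 + u i * c3 + (1 - u i) * c6)"
      by (intro sum.cong) auto
    also have "\<dots> = (\<Sum>i<n. a i ^ 2) * (2 * c1) + S * 4 * c2 + l * c3 + (real n - l) * c6"
      by (simp only: sum.distrib sum_distrib_right[symmetric] S_def[symmetric] l_def[symmetric] sum_subtractf) simp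
    finally show ?thesis .
  qed
  moreover have "2 * (\<Sum>j<n. \<Sum>i<j. ?W i j) = (\<Sum>i<n. \<Sum>j<n. ?W i j) - (\<Sum>i<n. ?W i i)"
    by (rule sum_pairs) (simp add: algebra_simps)
  ultimately show ?thesis
    unfolding z_def l_def[symmetric] by (simp add: field_simps)
qed

text \<open>The sum of squares in (\<mu>, \<mu>) cancels against the pair terms. What remains
  combines the second recursion with \<open>N\<close> times the first.\<close>

theorem freudenthal_mult_formula:
  assumes dom: "\<And>i j. i < j \<Longrightarrow> j < n \<Longrightarrow> \<mu> j \<le> \<mu> i" "\<And>i. i < n \<Longrightarrow> 0 \<le> \<mu> i"
    and J: "K \<le> int J" and H: "int J + wnorm n \<mu> \<le> int H"
  shows "freudenthal n H (mult_formula n p K) \<mu> = real_of_int (K * (K - 2 * int p + 2 * int n + 2)) * mult_formula n p K \<mu>"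
proof -
  define l where "l = nonzero_count n \<mu>"
  define N where "N = wnorm n \<mu>"
  define a where "a i = real_of_int (\<mu> i)" for i
  define u where "u i = (of_bool (\<mu> i \<noteq> 0) :: real)" for i
  note tA = tA_def[OF J] and tB = tB_def[OF J]
  let ?f = "shell_coeff n p K" and ?A = "tA n p K J" and ?B = "tB n p K J"
  have N: "0 \<le> N" unfolding N_def wnorm_def by (rule sum_nonneg) simp
  have l: "l \<le> n" unfolding l_def by (rule nonzero_count_le)
  have pair: "str_diff H (mult_formula n p K) \<mu> i j + str_sum H (mult_formula n p K) \<mu> i j
    = 2 * a i * a j * ?f l N + 2 * (a i * u j + a j * u i) * (?f (l - 1) N + 2 * ?A l N) + u i * u j * (8 * ?B l N)
      + (a i * (1 - u j) + a j * (1 - u i)) * (2 * ?f l N + 4 * ?A (l + 1) N)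
      + (u i * (1 - u j) + u j * (1 - u i)) * (8 * ?B (l + 1) N) + (1 - u i) * (1 - u j) * (8 * ?B (l + 2) N)"
    if ij: "i < j" "j < n" for i j
  proof -
    define l0 where "l0 = (\<Sum>t\<in>{..<n} - {i, j}. of_bool (\<mu> t \<noteq> 0) :: nat)"
    define N0 where "N0 = (\<Sum>t\<in>{..<n} - {i, j}. \<bar>\<mu> t\<bar>)"
    have F: "mult_formula n p K (\<mu>(i := x, j := y)) = ?f (l0 + of_bool (x \<noteq> 0) + of_bool (y \<noteq> 0)) (N0 + \<bar>x\<bar> + \<bar>y\<bar>)" for x y
      using ij sum_fun_upd2[of i n j "\<lambda>x. of_bool (x \<noteq> 0) :: nat" \<mu> x y] sum_fun_upd2[of i n j abs \<mu> x y]
      by (simp add: mult_formula_def nonzero_count_sum wnorm_def l0_def N0_def)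
    have id: "\<mu>(i := \<mu> i, j := \<mu> j) = \<mu>" by simp
    have lN: "l = l0 + of_bool (\<mu> i \<noteq> 0) + of_bool (\<mu> j \<noteq> 0)" "N = N0 + \<bar>\<mu> i\<bar> + \<bar>\<mu> j\<bar>"
      using ij sum_fun_upd2[of i n j "\<lambda>x. of_bool (x \<noteq> 0) :: nat" \<mu> "\<mu> i" "\<mu> j"] sum_fun_upd2[of i n j abs \<mu> "\<mu> i" "\<mu> j"]
      by (simp_all add: l_def N_def nonzero_count_sum wnorm_def l0_def N0_def)
    have N0: "0 \<le> N0" unfolding N0_def by (rule sum_nonneg) simp
    have F\<mu>: "mult_formula n p K \<mu> = ?f l N" by (simp add: mult_formula_def l_def N_def)
    have mu: "0 \<le> \<mu> j" "\<mu> j \<le> \<mu> i" using dom ij by auto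
    have "int J + (N0 + \<bar>\<mu> i\<bar> + \<bar>\<mu> j\<bar>) \<le> int H"
      using H unfolding lN(2)[symmetric] N_def .
    note P = pair_strings[OF J mu N0 this, of n p l0, folded lN]
    show ?thesis
      unfolding str_diff_def str_sum_def F F\<mu>
      by (rule trans[OF P]) (simp add: a_def u_def algebra_simps)
  qed
  have single: "str_long H (mult_formula n p K) \<mu> i = 2 * a i * ?f l N + 4 * a i * ?A l N + 8 * u i * ?B l N + 8 * (1 - u i) * ?B (l + 1) N"
    if i: "i < n" for i
  proof -
    define l0 where "l0 = (\<Sum>t\<in>{..<n} - {i}. of_bool (\<mu> t \<noteq> 0) :: nat)"
    define N0 where "N0 = (\<Sum>t\<in>{..<n} - {i}. \<bar>\<mu> t\<bar>)"
    have F: "mult_formula n p K (\<mu>(i := x)) = ?f (l0 + of_bool (x \<noteq> 0)) (N0 + \<bar>x\<bar>)" for x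
      using i sum_fun_upd[of i n "\<lambda>x. of_bool (x \<noteq> 0) :: nat" \<mu> x] sum_fun_upd[of i n abs \<mu> x]
      by (simp add: mult_formula_def nonzero_count_sum wnorm_def l0_def N0_def)
    have lN: "l = l0 + of_bool (\<mu> i \<noteq> 0)" "N = N0 + \<bar>\<mu> i\<bar>"
      using i sum_fun_upd[of i n "\<lambda>x. of_bool (x \<noteq> 0) :: nat" \<mu> "\<mu> i"] sum_fun_upd[of i n abs \<mu> "\<mu> i"]
      by (simp_all add: l_def N_def nonzero_count_sum wnorm_def l0_def N0_def)
    have N0: "0 \<le> N0" unfolding N0_def by (rule sum_nonneg) simp
    have F\<mu>: "mult_formula n p K \<mu> = ?f l N" by (simp add: mult_formula_def l_def N_def)
    have "int J + (N0 + \<bar>\<mu> i\<bar>) \<le> int H"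
      using H unfolding lN(2)[symmetric] N_def .
    note P = single_strings[OF J dom(2)[OF i] N0 this, of n p l0, folded lN]
    show ?thesis
      unfolding str_long_def F F\<mu>
      by (rule trans[OF P]) (simp add: a_def u_def)
  qed
  have S: "(\<Sum>i<n. a i) = real_of_int N"
    using dom(2) unfolding N_def wnorm_def a_def of_int_sum by (intro sum.cong) auto
  have L: "(\<Sum>i<n. u i) = real l"
    unfolding l_def nonzero_count_sum u_def by simp
  have z: "real n - real l = real (n - l)" using l by simp
  have F: "mult_formula n p K \<mu> = ?f l N" by (simp add: mult_formula_def l_def N_def)
  have "freudenthal n H (mult_formula n p K) \<mu> = (\<Sum>i<n. a i ^ 2) * ?f l N
     + ((N * N - (\<Sum>i<n. a i ^ 2)) * ?f l N + 2 * N * (real l - 1) * (?f (l - 1) N + 2 * ?A l N)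
       + real l * (real l - 1) / 2 * (8 * ?B l N) + N * real (n - l) * (2 * ?f l N + 4 * ?A (l + 1) N)
       + real l * real (n - l) * (8 * ?B (l + 1) N) + real (n - l) * (real (n - l) - 1) / 2 * (8 * ?B (l + 2) N))
     + (2 * N * ?f l N + 4 * N * ?A l N + 8 * real l * ?B l N + 8 * real (n - l) * ?B (l + 1) N)"
  proof -
    have 1: "(\<Sum>j<n. \<Sum>i<j. str_diff H (mult_formula n p K) \<mu> i j + str_sum H (mult_formula n p K) \<mu> i j)
      = (\<Sum>j<n. \<Sum>i<j. 2 * a i * a j * ?f l N + 2 * (a i * u j + a j * u i) * (?f (l - 1) N + 2 * ?A l N) + u i * u j * (8 * ?B l N)
      + (a i * (1 - u j) + a j * (1 - u i)) * (2 * ?f l N + 4 * ?A (l + 1) N)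
      + (u i * (1 - u j) + u j * (1 - u i)) * (8 * ?B (l + 1) N) + (1 - u i) * (1 - u j) * (8 * ?B (l + 2) N))"
      by (intro sum.cong refl pair) auto
    have 2: "(\<Sum>i<n. str_long H (mult_formula n p K) \<mu> i)
      = (\<Sum>i<n. a i * (2 * ?f l N) + a i * (4 * ?A l N) + u i * (8 * ?B l N) + (1 - u i) * (8 * ?B (l + 1) N))"
      by (intro sum.cong refl) (simp add: single)
    have 3: "\<dots> = N * (2 * ?f l N) + N * (4 * ?A l N) + real l * (8 * ?B l N) + real (n - l) * (8 * ?B (l + 1) N)"
      by (simp only: sum.distrib sum_distrib_right[symmetric] sum_subtractf S L z[symmetric]) simp
    have u: "u i * u i = u i" "a i * u i = a i" for i by (simp_all add: u_def a_def)
    show ?thesis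
      unfolding freudenthal_def 1 2 3 F a_def[symmetric] sum_pairs_quadratic[of n u a, OF u, unfolded L z S]
      by simp
  qed
  also have "\<dots> = real_of_int (K * (K - 2 * int p + 2 * int n + 2)) * ?f l N"
  proof -
    \<comment> \<open>The first recursion is available for l >= 1. Multiplied by \<open>N\<close> it
      also holds for l = 0, where N = 0.\<close>
    have A: "(2 * real_of_int (K - N) - 2 * real p + 2 * real l) * ?f l N * N
      = (2 * (real l - 1) * ?f (l - 1) N + 4 * (real l * ?A l N + real (n - l) * ?A (l + 1) N)) * N"
    proof (cases "l = 0")
      case True
      then have "{i. i < n \<and> \<mu> i \<noteq> 0} = {}" by (simp add: l_def nonzero_count_def)
      then have "a i = 0" if "i < n" for i
        using that by (auto simp: a_def)
      then have "N = 0" using S by simp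
      then show ?thesis by simp
    next
      case False
      then show ?thesis using shell_coeff_A[OF J _ l N, of p] unfolding tA_def[OF J] by simp
    qed
    have B: "real_of_int (K - N) * (real_of_int (K - N) - 2 * real p + 2 * real n + 2) * ?f l N
      = 4 * (real l * (real l + 1) * ?B l N + 2 * real (n - l) * (real l + 1) * ?B (l + 1) N
         + real (n - l) * (real (n - l) - 1) * ?B (l + 2) N)"
      using shell_coeff_B[OF J l N] unfolding tB_def[OF J] .
    have n: "real n = real l + real (n - l)" using l by simp
    define k where "k = real_of_int K"
    define x where "x = real_of_int N"
    \<comment> \<open>The eigenvalue splits as (K-N)(K-N-2p+2n+2) + N(2(K-N)-2p+2l) + N^2 + 2(n-l)N
      + 2N; the first two parts are the left-hand sides of \<open>B\<close> and
      \<open>A\<close>.\<close>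
    have "real_of_int (K * (K - 2 * int p + 2 * int n + 2)) * ?f l N
      = (k - x) * (k - x - 2 * real p + 2 * real n + 2) * ?f l N
        + (2 * (k - x) - 2 * real p + 2 * real l) * ?f l N * x + (x * x + 2 * real (n - l) * x + 2 * x) * ?f l N"
      unfolding k_def x_def by (simp add: n algebra_simps)
    also have "\<dots> = 4 * (real l * (real l + 1) * ?B l N + 2 * real (n - l) * (real l + 1) * ?B (l + 1) N
         + real (n - l) * (real (n - l) - 1) * ?B (l + 2) N)
       + (2 * (real l - 1) * ?f (l - 1) N + 4 * (real l * ?A l N + real (n - l) * ?A (l + 1) N)) * x
       + (x * x + 2 * real (n - l) * x + 2 * x) * ?f l N"
      using A B unfolding of_int_diff k_def[symmetric] x_def[symmetric] by (simp only:)
    finally show ?thesis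
      unfolding x_def[symmetric] of_int_mult by (simp add: field_simps)
  qed
  finally show ?thesis unfolding F .
qed

section \<open>Highest weight modules and weight multiplicities\<close>

definition bar :: "nat \<Rightarrow> nat \<Rightarrow> nat" where
  "bar n a = (if a < n then a + n else a - n)"

text \<open>The symplectic form pairs index \<open>a\<close> with index \<open>bar n a\<close>, and
  this is the sign of the pairing.\<close>

definition eps :: "nat \<Rightarrow> nat \<Rightarrow> 'a::ring_1" where
  "eps n a = (if a < n then 1 else - 1)"

text \<open>The root vector \<open>M a b\<close> below is a raising operator iff \<open>hpos n a < hpos n b\<close>.\<close>

definition hpos :: "nat \<Rightarrow> nat \<Rightarrow> nat" where
  "hpos n a = (if a < n then a else 3 * n - 1 - a)"

text \<open>Weight of the standard basis vector \<open>a\<close>. Then \<open>root_fun n a b\<close>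
  is the weight of the matrix unit at (a, b), and \<open>pairing\<close> is the inner product with
  the weight of \<open>a\<close>.\<close>

definition coord_wt :: "nat \<Rightarrow> nat \<Rightarrow> nat \<Rightarrow> int" where
  "coord_wt n a i = (if a = i then 1 else if a = i + n then - 1 else 0)"

definition root_fun :: "nat \<Rightarrow> nat \<Rightarrow> nat \<Rightarrow> nat \<Rightarrow> int" where
  "root_fun n a b i = coord_wt n a i - coord_wt n b i"

definition pairing :: "nat \<Rightarrow> (nat \<Rightarrow> int) \<Rightarrow> nat \<Rightarrow> int" where
  "pairing n \<mu> a = (if a < n then \<mu> a else - \<mu> (a - n))"

text \<open>These partial sums stand in for the dominance order: a negative root raises none of them
  and lowers at least one, by \<open>psum_root_fun_low\<close>.\<close>

definition psum :: "nat \<Rightarrow> (nat \<Rightarrow> int) \<Rightarrow> int" where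
  "psum q \<mu> = (\<Sum>i<q. \<mu> i)"

text \<open>Weights are functions on all naturals, but only their first \<open>n\<close> entries
  carry meaning; \<open>root_fun\<close>, for instance, can be nonzero beyond them.\<close>

definition agree :: "nat \<Rightarrow> (nat \<Rightarrow> int) \<Rightarrow> (nat \<Rightarrow> int) \<Rightarrow> bool" where
  "agree n \<mu> \<nu> \<longleftrightarrow> (\<forall>i<n. \<mu> i = \<nu> i)"

lemma bar_less: "a < 2 * n \<Longrightarrow> bar n a < 2 * n"
  by (auto simp: bar_def)

lemma bar_bar: "a < 2 * n \<Longrightarrow> bar n (bar n a) = a"
  by (auto simp: bar_def)

lemma hpos_inj: "a < 2 * n \<Longrightarrow> b < 2 * n \<Longrightarrow> hpos n a = hpos n b \<longleftrightarrow> a = b"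
  by (auto simp: hpos_def split: if_splits)

lemma psum_coord_wt:
  assumes "q \<le> n" "a < 2 * n"
  shows "psum q (coord_wt n a) = (if a < q then 1 else if n \<le> a \<and> a - n < q then - 1 else 0)"
proof -
  have "psum q (coord_wt n a) = (\<Sum>i<q. (if i = a then 1 else 0) - (if i = a - n \<and> n \<le> a then 1 else 0))"
    unfolding psum_def using assms by (intro sum.cong refl) (auto simp: coord_wt_def)
  also have "\<dots> = (if a < q then 1 else 0) - (if n \<le> a \<and> a - n < q then 1 else 0)"
    by (cases "n \<le> a") (simp_all add: sum_subtractf)
  finally show ?thesis using assms by auto
qed

lemma psum_add: "psum q (\<lambda>i. \<mu> i + \<nu> i) = psum q \<mu> + psum q \<nu>"
  by (simp add: psum_def sum.distrib)

lemma psum_root_fun: "psum q (root_fun n a b) = psum q (coord_wt n a) - psum q (coord_wt n b)"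
  by (simp add: psum_def root_fun_def sum_subtractf)

lemma psum_root_fun_low:
  assumes "a < 2 * n" "b < 2 * n" "hpos n b < hpos n a"
  shows "q \<le> n \<Longrightarrow> psum q (root_fun n a b) \<le> 0" and "\<exists>q\<le>n. psum q (root_fun n a b) < 0"
proof -
  show "psum q (root_fun n a b) \<le> 0" if "q \<le> n" for q
    using assms that unfolding psum_root_fun psum_coord_wt[OF that assms(1)] psum_coord_wt[OF that assms(2)]
    by (auto simp: hpos_def split: if_splits)
  show "\<exists>q\<le>n. psum q (root_fun n a b) < 0"
  proof (cases "b < n")
    case True
    then have "Suc b \<le> n" by simp
    then have "psum (Suc b) (root_fun n a b) < 0"
      using assms True unfolding psum_root_fun psum_coord_wt[OF \<open>Suc b \<le> n\<close> assms(1)] psum_coord_wt[OF \<open>Suc b \<le> n\<close> assms(2)]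
      by (auto simp: hpos_def split: if_splits)
    then show ?thesis using \<open>Suc b \<le> n\<close> by blast
  next
    case False
    then have a: "n \<le> a" "Suc (a - n) \<le> n" using assms by (auto simp: hpos_def split: if_splits)
    then have "psum (Suc (a - n)) (root_fun n a b) < 0"
      using assms False unfolding psum_root_fun psum_coord_wt[OF a(2) assms(1)] psum_coord_wt[OF a(2) assms(2)]
      by (auto simp: hpos_def split: if_splits)
    then show ?thesis using a by blast
  qed
qed

text \<open>With \<open>E\<close> the matrix units, \<open>M a b\<close> is the action of \<open>E\<^sub>a\<^sub>b - eps a * eps b * E\<^sub>b\<^sub>'\<^sub>a\<^sub>'\<close>, where \<open>a' = bar n a\<close>.\<close>

locale sp_hw = vector_space scale for scale :: "complex \<Rightarrow> 'v::ab_group_add \<Rightarrow> 'v" +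
  fixes n :: nat and M :: "nat \<Rightarrow> nat \<Rightarrow> 'v \<Rightarrow> 'v" and v :: 'v and hw :: "nat \<Rightarrow> int" and T :: "'v set"
  assumes linM: "\<And>a b. Vector_Spaces.linear scale scale (M a b)"
    and comm: "\<And>a b c e u. a < 2 * n \<Longrightarrow> b < 2 * n \<Longrightarrow> c < 2 * n \<Longrightarrow> e < 2 * n \<Longrightarrow>
      M a b (M c e u) - M c e (M a b u) = (if b = c then M a e u else 0) - (if a = e then M c b u else 0)
        - scale (eps n a * eps n b) ((if bar n a = c then M (bar n b) e u else 0) - (if bar n b = e then M c (bar n a) u else 0))"
    and sym: "\<And>a b u. a < 2 * n \<Longrightarrow> b < 2 * n \<Longrightarrow> M a b u = - scale (eps n a * eps n b) (M (bar n b) (bar n a) u)"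
    and hw_raise: "\<And>a b. a < 2 * n \<Longrightarrow> b < 2 * n \<Longrightarrow> hpos n a < hpos n b \<Longrightarrow> M a b v = 0"
    and hw_weight: "\<And>i. i < n \<Longrightarrow> M i i v = scale (of_int (hw i)) v"
    and v_nonzero: "v \<noteq> 0"
    and finite_T: "finite T" and range_T: "\<And>a b u. M a b u \<in> span T" and v_T: "v \<in> span T"
begin

lemmas M_add = module_hom.add[OF linM[unfolded linear_iff_module_hom]]
lemmas M_scale = module_hom.scale[OF linM[unfolded linear_iff_module_hom]]
lemmas M_zero = module_hom.zero[OF linM[unfolded linear_iff_module_hom]]
lemmas M_diff = module_hom.diff[OF linM[unfolded linear_iff_module_hom]]
lemmas M_sum = module_hom.sum[OF linM[unfolded linear_iff_module_hom]]

definition has_weight :: "(nat \<Rightarrow> int) \<Rightarrow> 'v \<Rightarrow> bool" where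
  "has_weight \<mu> u \<longleftrightarrow> (\<forall>i<n. M i i u = scale (of_int (\<mu> i)) u)"

lemma M_bar_diag: "i < n \<Longrightarrow> M (i + n) (i + n) u = - M i i u"
  using sym[of "i + n" "i + n" u] by (simp add: eps_def bar_def)

lemma has_weight_diag:
  assumes "has_weight \<mu> u" "a < 2 * n"
  shows "M a a u = scale (of_int (pairing n \<mu> a)) u"
proof (cases "a < n")
  case False
  then obtain i where "a = i + n" "i < n" using assms(2) by (metis add.commute add_less_cancel_left le_iff_add linorder_not_less mult_2)
  then show ?thesis using assms(1) M_bar_diag[of i u] by (simp add: has_weight_def pairing_def)
qed (use assms in \<open>auto simp: has_weight_def pairing_def\<close>)

lemma comm_diag:
  assumes "i < n" "a < 2 * n" "b < 2 * n"
  shows "M i i (M a b u) = M a b (M i i u) + scale (of_int (root_fun n a b i)) (M a b u)"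
proof -
  have "M i i (M a b u) - M a b (M i i u) = (if i = a then M a b u else 0) - (if i = b then M a b u else 0)
     - ((if i + n = a then M a b u else 0) - (if i + n = b then M a b u else 0))"
    using comm[of i i a b u] assms by (simp add: bar_def eps_def)
  also have "\<dots> = scale (of_int (root_fun n a b i)) (M a b u)"
    using assms by (auto simp: root_fun_def coord_wt_def scale_left_diff_distrib scale_left_distrib)
  finally show ?thesis by (simp add: algebra_simps)
qed

lemma has_weight_M:
  assumes "has_weight \<mu> u" "a < 2 * n" "b < 2 * n"
  shows "has_weight (\<lambda>i. \<mu> i + root_fun n a b i) (M a b u)"
  using assms unfolding has_weight_def by (simp add: comm_diag M_scale scale_left_distrib)

section \<open>Spanning by words in lowering operators\<close>

definition low :: "nat \<Rightarrow> nat \<Rightarrow> bool" where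
  "low a b \<longleftrightarrow> a < 2 * n \<and> b < 2 * n \<and> hpos n b < hpos n a"

fun word :: "(nat \<times> nat) list \<Rightarrow> 'v" where
  "word [] = v"
| "word ((a, b) # w) = M a b (word w)"

fun wwt :: "(nat \<times> nat) list \<Rightarrow> nat \<Rightarrow> int" where
  "wwt [] = hw"
| "wwt ((a, b) # w) = (\<lambda>i. wwt w i + root_fun n a b i)"

definition lowlist :: "(nat \<times> nat) list \<Rightarrow> bool" where
  "lowlist w \<longleftrightarrow> (\<forall>(a, b) \<in> set w. low a b)"

text \<open>Filtration by word length, which carries the straightening argument of
  \<open>not_low_word\<close>.\<close>

definition Wk :: "nat \<Rightarrow> 'v set" where
  "Wk k = {word w | w. lowlist w \<and> length w \<le> k}"

definition Words :: "'v set" where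
  "Words = {word w | w. lowlist w}"

lemma Wk_mono: "k \<le> k' \<Longrightarrow> Wk k \<subseteq> Wk k'"
  by (auto simp: Wk_def)

lemma M_span:
  assumes "u \<in> span S" "\<And>s. s \<in> S \<Longrightarrow> M a b s \<in> span S'"
  shows "M a b u \<in> span S'"
  using assms(1)
proof (induction rule: span_induct_alt)
  case base
  then show ?case by (simp add: M_zero span_zero)
next
  case (step c x y)
  then show ?case by (simp add: M_add M_scale span_add span_scale assms(2))
qed

lemma low_Wk:
  assumes "low a b" "u \<in> span (Wk k)"
  shows "M a b u \<in> span (Wk (Suc k))"
  using assms(2)
proof (rule M_span)
  fix s assume "s \<in> Wk k"
  then obtain w where "s = word w" "lowlist w" "length w \<le> k" by (auto simp: Wk_def)
  then have "M a b s = word ((a, b) # w)" "lowlist ((a, b) # w)" "length ((a, b) # w) \<le> Suc k"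
    using assms(1) by (auto simp: lowlist_def)
  then have "M a b s \<in> Wk (Suc k)" unfolding Wk_def by blast
  then show "M a b s \<in> span (Wk (Suc k))" by (rule span_base)
qed

lemma v_has_weight: "has_weight hw v"
  by (simp add: has_weight_def hw_weight)

text \<open>The operator is moved through the word. Its commutator with the first letter is a
  combination of single operators applied to the shorter word, each raising the filtration by at
  most one. At the end \<open>v\<close> is annihilated or scaled.\<close>

lemma not_low_word:
  assumes "lowlist w" "a < 2 * n" "b < 2 * n" "\<not> low a b"
  shows "M a b (word w) \<in> span (Wk (length w))"
  using assms
proof (induction w arbitrary: a b)
  case Nil
  have "v \<in> Wk 0" unfolding Wk_def lowlist_def by (auto intro: exI[of _ "[]"])
  then have v: "v \<in> span (Wk 0)" by (rule span_base)
  show ?case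
  proof (cases "a = b")
    case True
    then show ?thesis using has_weight_diag[OF v_has_weight Nil(2)] v by (simp add: span_scale)
  next
    case False
    then have "hpos n a < hpos n b" using Nil hpos_inj[of a n b] by (auto simp: low_def)
    then show ?thesis using hw_raise Nil by (simp add: span_zero)
  qed
next
  case (Cons ce w)
  obtain c e where ce: "ce = (c, e)" by (cases ce)
  let ?u = "word w"
  have w: "lowlist w" "low c e" using Cons.prems(1) by (auto simp: lowlist_def ce)
  then have lt: "c < 2 * n" "e < 2 * n" by (auto simp: low_def)
  have "?u \<in> Wk (length w)" using w unfolding Wk_def by blast
  then have u: "?u \<in> span (Wk (length w))" by (rule span_base)
  have any: "M x y ?u \<in> span (Wk (Suc (length w)))" if "x < 2 * n" "y < 2 * n" for x y
  proof (cases "low x y")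
    case True
    then show ?thesis using low_Wk u by blast
  next
    case False
    then have "M x y ?u \<in> span (Wk (length w))" using Cons.IH[OF w(1) that] by blast
    then show ?thesis using span_mono[OF Wk_mono[of "length w" "Suc (length w)"]] by auto
  qed
  have "M a b (M c e ?u) = M c e (M a b ?u) + (M a b (M c e ?u) - M c e (M a b ?u))" by simp
  also have "\<dots> \<in> span (Wk (Suc (length w)))"
  proof (rule span_add)
    show "M c e (M a b ?u) \<in> span (Wk (Suc (length w)))"
      using low_Wk[OF w(2)] Cons.IH[OF w(1) Cons.prems(2-4)] .
    have bars: "bar n a < 2 * n" "bar n b < 2 * n" using Cons.prems bar_less by auto
    show "M a b (M c e ?u) - M c e (M a b ?u) \<in> span (Wk (Suc (length w)))"
      unfolding comm[OF Cons.prems(2,3) lt] using any Cons.prems lt bars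
      by (intro span_diff span_scale) (auto simp: span_zero)
  qed
  finally show ?case by (simp add: ce)
qed

lemma Wk_Words: "Wk k \<subseteq> Words"
  by (auto simp: Wk_def Words_def)

text \<open>Thus \<open>span Words\<close> is the submodule generated by \<open>v\<close>.\<close>

lemma M_Words:
  assumes "a < 2 * n" "b < 2 * n" "u \<in> span Words"
  shows "M a b u \<in> span Words"
  using assms(3)
proof (rule M_span)
  fix s assume "s \<in> Words"
  then obtain w where w: "s = word w" "lowlist w" by (auto simp: Words_def)
  then have s: "s \<in> span (Wk (length w))" unfolding Wk_def by (blast intro: span_base)
  have "M a b s \<in> span (Wk (Suc (length w)))"
  proof (cases "low a b")
    case False
    then have "M a b s \<in> span (Wk (length w))" using not_low_word w assms by simp
    then show ?thesis using span_mono[OF Wk_mono[of "length w" "Suc (length w)"]] by auto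
  qed (use low_Wk s in blast)
  then show "M a b s \<in> span Words" using span_mono[OF Wk_Words] by blast
qed

lemma has_weight_word: "lowlist w \<Longrightarrow> has_weight (wwt w) (word w)"
proof (induction w rule: word.induct)
  case (2 a b w)
  then have "low a b" "has_weight (wwt w) (word w)" by (auto simp: lowlist_def)
  then show ?case using has_weight_M by (simp add: low_def)
qed (simp add: v_has_weight)

lemma psum_wwt: "lowlist w \<Longrightarrow> q \<le> n \<Longrightarrow> psum q (wwt w) \<le> psum q hw"
proof (induction w rule: word.induct)
  case (2 a b w)
  then have "low a b" "psum q (wwt w) \<le> psum q hw" by (auto simp: lowlist_def)
  then show ?case using psum_root_fun_low(1)[of a n b q] 2(3) by (simp add: low_def psum_add)
qed simp

text \<open>No letter raises a partial sum and every letter lowers one, so only the empty word keeps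
  the highest weight.\<close>

lemma wwt_agree:
  assumes "lowlist w" "agree n (wwt w) hw"
  shows "w = []"
proof (cases w)
  case (Cons ab w')
  obtain a b where ab: "ab = (a, b)" by (cases ab)
  have l: "low a b" "lowlist w'" using assms(1) by (auto simp: lowlist_def Cons ab)
  then obtain q where q: "q \<le> n" "psum q (root_fun n a b) < 0"
    using psum_root_fun_low(2)[of a n b] by (auto simp: low_def)
  have "psum q (wwt w) < psum q hw"
    using psum_wwt[OF l(2) q(1)] q(2) by (simp add: Cons ab psum_add)
  moreover have "psum q (wwt w) = psum q hw"
    unfolding psum_def using assms(2) q(1) by (intro sum.cong) (auto simp: agree_def)
  ultimately show ?thesis by simp
qed simp

end

context sp_hw
begin

section \<open>A basis of weight vectors\<close>

lemma Words_span_T: "span Words \<subseteq> span T"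
proof (rule span_minimal)
  show "Words \<subseteq> span T"
  proof
    fix x assume "x \<in> Words"
    then obtain w where "x = word w" by (auto simp: Words_def)
    then show "x \<in> span T" using v_T range_T by (cases w rule: word.cases) auto
  qed
qed (rule subspace_span)

text \<open>Chosen among the words so that every basis vector is a weight vector; traces on weight
  spaces then become sums over basis vectors.\<close>

definition B :: "'v set" where
  "B = (SOME B. B \<subseteq> Words \<and> independent B \<and> span B = span Words)"

lemma B: "B \<subseteq> Words" "independent B" "span B = span Words"
proof -
  obtain B' where "B' \<subseteq> Words" "independent B'" "Words \<subseteq> span B'"
    by (rule maximal_independent_subset)
  then have "\<exists>B. B \<subseteq> Words \<and> independent B \<and> span B = span Words"
    by (metis span_eq span_superset subset_trans)
  then have "B \<subseteq> Words \<and> independent B \<and> span B = span Words"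
    unfolding B_def by (rule someI_ex)
  then show "B \<subseteq> Words" "independent B" "span B = span Words" by auto
qed

lemma finite_B: "finite B"
  using independent_span_bound[OF finite_T B(2)] B(3) Words_span_T span_superset by blast

text \<open>Several words may give the same vector. As the vector is nonzero, their weights have the
  same first \<open>n\<close> entries, so the choice is harmless up to \<open>agree\<close>.\<close>

definition wtB :: "'v \<Rightarrow> nat \<Rightarrow> int" where
  "wtB b = (SOME \<mu>. \<exists>w. lowlist w \<and> b = word w \<and> \<mu> = wwt w)"

lemma wtB:
  assumes "b \<in> B"
  obtains w where "lowlist w" "b = word w" "wtB b = wwt w"
proof -
  have "\<exists>\<mu>. \<exists>w. lowlist w \<and> b = word w \<and> \<mu> = wwt w"
    using assms B(1) by (auto simp: Words_def)
  then have "\<exists>w. lowlist w \<and> b = word w \<and> wtB b = wwt w"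
    unfolding wtB_def by (rule someI_ex)
  then show ?thesis using that by blast
qed

lemma has_weight_B: "b \<in> B \<Longrightarrow> has_weight (wtB b) b"
  by (metis wtB has_weight_word)

abbreviation rep :: "'v \<Rightarrow> 'v \<Rightarrow> complex" where
  "rep \<equiv> representation B"

lemma rep_sum: "u \<in> span B \<Longrightarrow> (\<Sum>b\<in>B. scale (rep u b) b) = u"
  by (rule sum_representation_eq[OF B(2) _ finite_B subset_refl])

lemma M_B:
  assumes "a < 2 * n" "b < 2 * n" "u \<in> span B"
  shows "M a b u \<in> span B"
  using M_Words[OF assms(1,2)] assms(3) B(3) by simp

lemma rep_linear_sum:
  assumes "\<And>c. c \<in> B \<Longrightarrow> x c \<in> span B"
  shows "rep (\<Sum>c\<in>B. scale (k c) (x c)) b = (\<Sum>c\<in>B. k c * rep (x c) b)"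
proof -
  have "rep (\<Sum>c\<in>B. scale (k c) (x c)) b = (\<Sum>c\<in>B. rep (scale (k c) (x c)) b)"
    using assms by (subst representation_sum[OF B(2)]) (auto intro: span_scale)
  also have "\<dots> = (\<Sum>c\<in>B. k c * rep (x c) b)"
    using assms by (intro sum.cong refl) (simp add: representation_scale[OF B(2)])
  finally show ?thesis .
qed

lemma rep_M:
  assumes "a < 2 * n" "b < 2 * n" "u \<in> span B"
  shows "rep (M a b u) x = (\<Sum>c\<in>B. rep u c * rep (M a b c) x)"
proof -
  have "M a b u = (\<Sum>c\<in>B. scale (rep u c) (M a b c))"
    by (subst rep_sum[OF assms(3), symmetric]) (simp add: M_sum M_scale)
  then show ?thesis
    using rep_linear_sum[of "M a b" "rep u" x] M_B[OF assms(1,2)] by (simp add: span_base)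
qed

text \<open>\<open>M i i\<close> scales the coordinate of \<open>u\<close> at \<open>b\<close> by
  the weight of \<open>u\<close> and also by the weight of \<open>b\<close>; a nonzero coordinate
  forces the two to agree.\<close>

lemma rep_weight:
  assumes "has_weight \<mu> u" "u \<in> span B" "rep u b \<noteq> 0"
  shows "b \<in> B" "agree n (wtB b) \<mu>"
proof -
  show b: "b \<in> B" using assms(3) by (rule representation_ne_zero)
  have "wtB b i = \<mu> i" if "i < n" for i
  proof -
    have i: "i < 2 * n" using that by simp
    have "of_int (\<mu> i) * rep u b = rep (M i i u) b"
      using assms that by (simp add: has_weight_def representation_scale[OF B(2)])
    also have "\<dots> = (\<Sum>c\<in>B. rep u c * rep (scale (of_int (wtB c i)) c) b)"
      unfolding rep_M[OF i i assms(2)] using has_weight_B that by (intro sum.cong refl) (simp add: has_weight_def)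
    also have "\<dots> = (\<Sum>c\<in>B. if c = b then rep u b * of_int (wtB b i) else 0)"
      by (intro sum.cong refl) (auto simp: representation_scale[OF B(2)] span_base representation_basis[OF B(2)])
    also have "\<dots> = rep u b * of_int (wtB b i)" using b finite_B by simp
    finally show ?thesis using assms(3) by simp
  qed
  then show "agree n (wtB b) \<mu>" by (simp add: agree_def)
qed

text \<open>By \<open>has_weight_span_Bw\<close> this is a basis of the weight space in
  \<open>span B\<close>, so its cardinality is the multiplicity.\<close>

definition Bw :: "(nat \<Rightarrow> int) \<Rightarrow> 'v set" where
  "Bw \<mu> = {b \<in> B. agree n (wtB b) \<mu>}"

definition mult :: "(nat \<Rightarrow> int) \<Rightarrow> nat" where
  "mult \<mu> = card (Bw \<mu>)"

lemma finite_Bw: "finite (Bw \<mu>)"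
  using finite_B by (simp add: Bw_def)

lemma has_weight_cong: "agree n \<mu> \<nu> \<Longrightarrow> has_weight \<mu> u \<longleftrightarrow> has_weight \<nu> u"
  by (simp add: has_weight_def agree_def)

lemma has_weight_Bw: "b \<in> Bw \<mu> \<Longrightarrow> has_weight \<mu> b"
  using has_weight_B has_weight_cong by (auto simp: Bw_def)

lemma has_weight_span_Bw:
  assumes "has_weight \<mu> u" "u \<in> span B"
  shows "u \<in> span (Bw \<mu>)"
proof -
  have "(\<Sum>b\<in>Bw \<mu>. scale (rep u b) b) = (\<Sum>b\<in>B. scale (rep u b) b)"
    using finite_B rep_weight[OF assms] by (intro sum.mono_neutral_left) (auto simp: Bw_def)
  then have "u = (\<Sum>b\<in>Bw \<mu>. scale (rep u b) b)" using rep_sum[OF assms(2)] by simp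
  then show ?thesis by (metis (no_types, lifting) span_base span_scale span_sum)
qed

section \<open>Traces of products of opposite root vectors along a string\<close>

definition trace_prod :: "nat \<Rightarrow> nat \<Rightarrow> (nat \<Rightarrow> int) \<Rightarrow> complex" where
  "trace_prod a b \<mu> = (\<Sum>x\<in>Bw \<mu>. rep (M a b (M b a x)) x)"

text \<open>The intermediate vector is expanded in the weight space where it lies. In this form
  cyclicity of the trace is an exchange of two finite sums.\<close>

lemma trace_prod_alt:
  assumes "a < 2 * n" "b < 2 * n"
  shows "trace_prod a b \<mu> = (\<Sum>x\<in>Bw \<mu>. \<Sum>c\<in>Bw (\<lambda>i. \<mu> i + root_fun n b a i). rep (M b a x) c * rep (M a b c) x)"
  unfolding trace_prod_def
proof (rule sum.cong[OF refl])
  fix x assume x: "x \<in> Bw \<mu>"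
  then have xB: "x \<in> span B" by (simp add: Bw_def span_base)
  have w: "has_weight (\<lambda>i. \<mu> i + root_fun n b a i) (M b a x)" using has_weight_M[OF has_weight_Bw[OF x]] assms by simp
  have "rep (M a b (M b a x)) x = (\<Sum>c\<in>B. rep (M b a x) c * rep (M a b c) x)"
    using rep_M assms M_B xB by simp
  also have "\<dots> = (\<Sum>c\<in>Bw (\<lambda>i. \<mu> i + root_fun n b a i). rep (M b a x) c * rep (M a b c) x)"
    using finite_B rep_weight[OF w] M_B assms xB by (intro sum.mono_neutral_right) (auto simp: Bw_def)
  finally show "rep (M a b (M b a x)) x = (\<Sum>c\<in>Bw (\<lambda>i. \<mu> i + root_fun n b a i). rep (M b a x) c * rep (M a b c) x)" .
qed

lemma Bw_cong: "agree n \<mu> \<nu> \<Longrightarrow> Bw \<mu> = Bw \<nu>"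
  by (auto simp: Bw_def agree_def)

text \<open>Cyclicity of the trace.\<close>

lemma trace_prod_shift:
  assumes "a < 2 * n" "b < 2 * n"
  shows "trace_prod a b (\<lambda>i. \<mu> i + root_fun n a b i) = trace_prod b a \<mu>"
proof -
  have e: "Bw (\<lambda>i. \<mu> i + root_fun n a b i + root_fun n b a i) = Bw \<mu>"
    by (intro Bw_cong) (simp add: agree_def root_fun_def)
  show ?thesis
    unfolding trace_prod_alt[OF assms] trace_prod_alt[OF assms(2,1)] e by (subst sum.swap) (simp add: mult.commute)
qed

text \<open>For b = \<open>bar n a\<close> the two matrix units making up \<open>M a b\<close>
  coincide and add. Long root vectors are thus twice a matrix unit, and their commutator carries an
  extra factor 2.\<close>

definition kappa :: "nat \<Rightarrow> nat \<Rightarrow> int" where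
  "kappa a b = (if b = bar n a then 2 else 1)"

lemma comm_pair:
  assumes "a < 2 * n" "b < 2 * n" "a \<noteq> b" "has_weight \<mu> u"
  shows "M a b (M b a u) - M b a (M a b u) = scale (of_int (kappa a b * (pairing n \<mu> a - pairing n \<mu> b))) u"
proof -
  have bb: "bar n b = a \<longleftrightarrow> b = bar n a" "bar n a = b \<longleftrightarrow> b = bar n a" using assms bar_bar by auto
  have e: "eps n a * eps n (bar n a) = (- 1 :: complex)" using assms(1) by (auto simp: eps_def bar_def)
  have "M a b (M b a u) - M b a (M a b u) = M a a u - M b b u
      - scale (eps n a * eps n b) ((if b = bar n a then M a a u else 0) - (if b = bar n a then M b b u else 0))"
    using comm[OF assms(1,2,2,1), of u] unfolding bb using assms(3) bar_bar[OF assms(1)] by auto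
  also have "\<dots> = scale (of_int (kappa a b)) (M a a u - M b b u)"
    using e by (auto simp: kappa_def scale_left_distrib[of 1 1, simplified] algebra_simps)
  also have "\<dots> = scale (of_int (kappa a b * (pairing n \<mu> a - pairing n \<mu> b))) u"
    by (simp add: has_weight_diag[OF assms(4)] assms scale_left_diff_distrib[symmetric] del: scale_left_diff_distrib)
  finally show ?thesis .
qed

lemma trace_prod_comm:
  assumes "a < 2 * n" "b < 2 * n" "a \<noteq> b"
  shows "trace_prod a b \<mu> = trace_prod b a \<mu> + of_int (kappa a b * (pairing n \<mu> a - pairing n \<mu> b)) * of_nat (mult \<mu>)"
proof -
  have "trace_prod a b \<mu> - trace_prod b a \<mu> = (\<Sum>x\<in>Bw \<mu>. of_int (kappa a b * (pairing n \<mu> a - pairing n \<mu> b)))"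
    unfolding trace_prod_def sum_subtractf[symmetric]
  proof (rule sum.cong[OF refl])
    fix x assume x: "x \<in> Bw \<mu>"
    then have xB: "x \<in> B" "x \<in> span B" by (auto simp: Bw_def span_base)
    have "rep (M a b (M b a x)) x - rep (M b a (M a b x)) x = rep (M a b (M b a x) - M b a (M a b x)) x"
      using xB assms M_B by (simp add: representation_diff[OF B(2)])
    also have "\<dots> = of_int (kappa a b * (pairing n \<mu> a - pairing n \<mu> b))"
      unfolding comm_pair[OF assms has_weight_Bw[OF x]] using xB
      by (simp add: representation_scale[OF B(2)] representation_basis[OF B(2)])
    finally show "rep (M a b (M b a x)) x - rep (M b a (M a b x)) x = of_int (kappa a b * (pairing n \<mu> a - pairing n \<mu> b))" .
  qed
  then show ?thesis by (simp add: mult_def algebra_simps)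
qed

lemma mult_eventually_0:
  assumes "a < 2 * n" "b < 2 * n" "a \<noteq> b"
  shows "\<exists>H. \<forall>h\<ge>H. mult (\<lambda>i. \<mu> i + int h * root_fun n a b i) = 0"
proof -
  obtain i where i: "i < n" "root_fun n a b i \<noteq> 0"
  proof -
    define i where "i = (if a < n then a else a - n)"
    have "i < n" "root_fun n a b i \<noteq> 0" using assms by (auto simp: i_def root_fun_def coord_wt_def)
    then show ?thesis using that by blast
  qed
  define R where "R = Max (insert 0 ((\<lambda>b. \<bar>wtB b i\<bar>) ` B))"
  have R: "\<bar>wtB b i\<bar> \<le> R" if "b \<in> B" for b
    unfolding R_def using that finite_B by (intro Max_ge) auto
  have "Bw (\<lambda>i. \<mu> i + int h * root_fun n a b i) = {}" if h: "h \<ge> nat (R + \<bar>\<mu> i\<bar> + 1)" for h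
  proof (rule ccontr)
    assume "Bw (\<lambda>i. \<mu> i + int h * root_fun n a b i) \<noteq> {}"
    then obtain b' where "b' \<in> B" "wtB b' i = \<mu> i + int h * root_fun n a b i"
      using i(1) by (auto simp: Bw_def agree_def)
    then have "\<bar>\<mu> i + int h * root_fun n a b i\<bar> \<le> R" using R[of b'] by simp
    moreover have "int h \<le> \<bar>int h * root_fun n a b i\<bar>"
      using i(2) mult_left_mono[of 1 "\<bar>root_fun n a b i\<bar>" "int h"] by (simp add: abs_mult)
    ultimately show False using h by linarith
  qed
  then show ?thesis by (metis card.empty mult_def)
qed

text \<open>Commuting the two operators and then using cyclicity passes from \<mu> to the next
  weight of the string; iteration telescopes.\<close>

lemma trace_prod_iter:
  assumes "a < 2 * n" "b < 2 * n" "a \<noteq> b"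
  shows "trace_prod a b \<mu> = (\<Sum>h<H. of_int (kappa a b * (pairing n (\<lambda>i. \<mu> i + int h * root_fun n a b i) a - pairing n (\<lambda>i. \<mu> i + int h * root_fun n a b i) b))
      * of_nat (mult (\<lambda>i. \<mu> i + int h * root_fun n a b i))) + trace_prod a b (\<lambda>i. \<mu> i + int H * root_fun n a b i)"
proof (induction H)
  case (Suc H)
  let ?m = "\<lambda>i. \<mu> i + int H * root_fun n a b i"
  have "(\<lambda>i. ?m i + root_fun n a b i) = (\<lambda>i. \<mu> i + int (Suc H) * root_fun n a b i)"
    by (simp add: fun_eq_iff algebra_simps)
  then have "trace_prod a b ?m = trace_prod a b (\<lambda>i. \<mu> i + int (Suc H) * root_fun n a b i)
     + of_int (kappa a b * (pairing n ?m a - pairing n ?m b)) * of_nat (mult ?m)"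
    using trace_prod_comm[OF assms, of ?m] trace_prod_shift[OF assms(1,2), of ?m] by simp
  then show ?case using Suc by simp
qed simp

text \<open>The traces for a root and its negative differ by the term at h = 0, so their sum counts
  that term once and all later ones twice, as in Freudenthal's formula.\<close>

lemma trace_prod_pair:
  assumes "a < 2 * n" "b < 2 * n" "a \<noteq> b"
    and H: "\<forall>h>H. mult (\<lambda>i. \<mu> i + int h * root_fun n a b i) = 0"
  shows "trace_prod a b \<mu> + trace_prod b a \<mu> = of_int (kappa a b) * (of_int (pairing n \<mu> a - pairing n \<mu> b) * of_nat (mult \<mu>)
     + 2 * (\<Sum>h=1..H. of_int (pairing n (\<lambda>i. \<mu> i + int h * root_fun n a b i) a - pairing n (\<lambda>i. \<mu> i + int h * root_fun n a b i) b)
          * of_nat (mult (\<lambda>i. \<mu> i + int h * root_fun n a b i))))"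
proof -
  let ?g = "\<lambda>h. of_int (kappa a b) * (of_int (pairing n (\<lambda>i. \<mu> i + int h * root_fun n a b i) a - pairing n (\<lambda>i. \<mu> i + int h * root_fun n a b i) b)
          * of_nat (mult (\<lambda>i. \<mu> i + int h * root_fun n a b i))) :: complex"
  have "mult (\<lambda>i. \<mu> i + int (Suc H) * root_fun n a b i) = 0" using H by blast
  then have "Bw (\<lambda>i. \<mu> i + int (Suc H) * root_fun n a b i) = {}" using finite_Bw by (simp add: mult_def)
  then have "trace_prod a b (\<lambda>i. \<mu> i + int (Suc H) * root_fun n a b i) = 0" by (simp add: trace_prod_def)
  then have "trace_prod a b \<mu> = (\<Sum>h<Suc H. ?g h)"
    using trace_prod_iter[OF assms(1-3), of \<mu> "Suc H"] by (simp only: of_int_mult mult.assoc) simp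
  also have "{..<Suc H} = insert 0 {1..H}" by auto
  also have "(\<Sum>h\<in>insert 0 {1..H}. ?g h) = ?g 0 + (\<Sum>h=1..H. ?g h)" by simp
  finally have t: "trace_prod a b \<mu> = ?g 0 + (\<Sum>h=1..H. ?g h)" .
  have "trace_prod a b \<mu> + trace_prod b a \<mu> = 2 * trace_prod a b \<mu> - ?g 0"
    using trace_prod_comm[OF assms(1-3), of \<mu>] by (simp add: mult.assoc)
  also have "\<dots> = ?g 0 + 2 * (\<Sum>h=1..H. ?g h)" unfolding t by simp
  also have "(\<Sum>h=1..H. ?g h) = of_int (kappa a b) * (\<Sum>h=1..H. of_int (pairing n (\<lambda>i. \<mu> i + int h * root_fun n a b i) a - pairing n (\<lambda>i. \<mu> i + int h * root_fun n a b i) b)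
          * of_nat (mult (\<lambda>i. \<mu> i + int h * root_fun n a b i)))"
    by (rule sum_distrib_left[symmetric])
  finally show ?thesis by (simp add: algebra_simps)
qed

lemma trace_prod_diag:
  assumes "a < 2 * n"
  shows "trace_prod a a \<mu> = (of_int (pairing n \<mu> a))\<^sup>2 * of_nat (mult \<mu>)"
proof -
  have "rep (M a a (M a a x)) x = (of_int (pairing n \<mu> a))\<^sup>2" if "x \<in> Bw \<mu>" for x
  proof -
    have "x \<in> B" "x \<in> span B" using that by (auto simp: Bw_def span_base)
    then show ?thesis using has_weight_diag[OF has_weight_Bw[OF that] assms]
      by (simp add: M_scale representation_scale[OF B(2)] representation_basis[OF B(2)] span_scale power2_eq_square)
  qed
  then show ?thesis by (simp add: trace_prod_def mult_def)
qed

end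

section \<open>The Casimir element and Freudenthal's recursion for multiplicities\<close>

lemma sum_double_range:
  fixes f :: "nat \<Rightarrow> 'a::comm_monoid_add"
  shows "(\<Sum>a<2*n. f a) = (\<Sum>i<n. f i + f (i + n))"
proof -
  have "(\<Sum>a<2*n. f a) = (\<Sum>a=0..<n. f a) + (\<Sum>a=n..<2*n. f a)"
    by (simp add: sum.atLeastLessThan_concat lessThan_atLeast0)
  also have "(\<Sum>a=n..<2*n. f a) = (\<Sum>i=0..<n. f (i + n))"
    using sum.shift_bounds_nat_ivl[of f 0 n n] by (simp add: mult_2)
  finally show ?thesis by (simp add: sum.distrib lessThan_atLeast0)
qed

lemma coord_wt_simps:
  assumes "t < n"
  shows "i < n \<Longrightarrow> coord_wt n i t = of_bool (i = t)"
    and "coord_wt n (i + n) t = - of_bool (i = t)"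
  using assms by (auto simp: coord_wt_def)

context sp_hw
begin

text \<open>Each short root occurs for two index pairs, since \<open>M a b\<close> and
  \<open>M (bar n b) (bar n a)\<close> are proportional; each long root occurs once, with a doubled
  vector. The result is twice the Casimir element normalised to (\<lambda>, \<lambda> +
  2\<rho>).\<close>

definition casimir :: "'v \<Rightarrow> 'v" where
  "casimir u = (\<Sum>a<2*n. \<Sum>b<2*n. M a b (M b a u))"

text \<open>The commutator acts as a derivation on each product. The Kronecker deltas collapse one
  index, and every single sum that remains occurs once with each sign.\<close>

lemma casimir_comm:
  assumes "c < 2 * n" "e < 2 * n"
  shows "M c e (casimir u) = casimir (M c e u)"
proof -
  define s where "s = (eps n c * eps n e :: complex)"
  define c' e' where "c' = bar n c" and "e' = bar n e"
  have lt: "c' < 2 * n" "e' < 2 * n" using assms bar_less by (auto simp: c'_def e'_def)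
  let ?I = "{..<2*n}"
  have c1: "M c e (M a b w) - M a b (M c e w) = (if e = a then M c b w else 0) - (if c = b then M a e w else 0)
      - scale s ((if c' = a then M e' b w else 0) - (if e' = b then M a c' w else 0))"
    if "a < 2 * n" "b < 2 * n" for a b w
    using comm[OF assms that] by (simp add: s_def c'_def e'_def)
  have "M c e (casimir u) - casimir (M c e u) = (\<Sum>a\<in>?I. \<Sum>b\<in>?I. M c e (M a b (M b a u)) - M a b (M b a (M c e u)))"
    by (simp add: casimir_def M_sum sum_subtractf)
  also have "\<dots> = (\<Sum>a\<in>?I. \<Sum>b\<in>?I. (M c e (M a b (M b a u)) - M a b (M c e (M b a u)))
      + M a b (M c e (M b a u) - M b a (M c e u)))"
    by (simp add: M_diff)
  also have "\<dots> = (\<Sum>a\<in>?I. \<Sum>b\<in>?I.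
        ((if e = a then M c b (M b a u) else 0) - (if c = b then M a e (M b a u) else 0)
          - scale s ((if c' = a then M e' b (M b a u) else 0) - (if e' = b then M a c' (M b a u) else 0)))
      + ((if e = b then M a b (M c a u) else 0) - (if c = a then M a b (M b e u) else 0)
          - scale s ((if c' = b then M a b (M e' a u) else 0) - (if e' = a then M a b (M b c' u) else 0))))"
  proof (intro sum.cong refl)
    fix a b assume "a \<in> ?I" "b \<in> ?I"
    then have ab: "a < 2 * n" "b < 2 * n" by auto
    have M0: "M a b (if P then x else 0) = (if P then M a b x else 0)" for P x by (simp add: M_zero)
    show "(M c e (M a b (M b a u)) - M a b (M c e (M b a u))) + M a b (M c e (M b a u) - M b a (M c e u))
      = ((if e = a then M c b (M b a u) else 0) - (if c = b then M a e (M b a u) else 0)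
          - scale s ((if c' = a then M e' b (M b a u) else 0) - (if e' = b then M a c' (M b a u) else 0)))
      + ((if e = b then M a b (M c a u) else 0) - (if c = a then M a b (M b e u) else 0)
          - scale s ((if c' = b then M a b (M e' a u) else 0) - (if e' = a then M a b (M b c' u) else 0)))"
      unfolding c1[OF ab] c1[OF ab(2,1)] M_diff M_scale M0 ..
  qed
  also have "\<dots> = 0"
  proof -
    have d1: "(\<Sum>a\<in>?I. \<Sum>b\<in>?I. if x = a then f a b else 0) = (\<Sum>b\<in>?I. f x b)" if "x < 2 * n" for x and f :: "nat \<Rightarrow> nat \<Rightarrow> 'v"
      by (subst sum.swap) (use that in simp)
    have d2: "(\<Sum>a\<in>?I. \<Sum>b\<in>?I. if x = b then f a b else 0) = (\<Sum>a\<in>?I. f a x)" if "x < 2 * n" for x and f :: "nat \<Rightarrow> nat \<Rightarrow> 'v"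
      using that by simp
    show ?thesis
      unfolding sum.distrib sum_subtractf scale_sum_right[symmetric] d1[OF assms(1)] d1[OF assms(2)] d1[OF lt(1)] d1[OF lt(2)]
        d2[OF assms(1)] d2[OF assms(2)] d2[OF lt(1)] d2[OF lt(2)]
      by (simp add: scale_right_diff_distrib)
  qed
  finally show ?thesis by simp
qed

lemma B_hw: "Bw hw = {v}"
proof -
  have "b = v" if "b \<in> Bw hw" for b
    using that wtB[of b] wwt_agree by (metis (mono_tags, lifting) Bw_def mem_Collect_eq word.simps(1))
  moreover have "Bw hw \<noteq> {}"
  proof
    assume "Bw hw = {}"
    moreover have "v \<in> span B"
    proof -
      have "word [] \<in> Words" unfolding Words_def lowlist_def by fastforce
      then show ?thesis using span_base B(3) by auto
    qed
    ultimately have "v \<in> span {}" using has_weight_span_Bw[OF v_has_weight] by simp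
    then show False using v_nonzero by simp
  qed
  ultimately show ?thesis by auto
qed

lemma mult_hw: "mult hw = 1"
  by (simp add: mult_def B_hw)

lemma v_B: "v \<in> B"
  using B_hw by (auto simp: Bw_def)

lemma mult_dominated:
  assumes "mult \<mu> \<noteq> 0" "q \<le> n"
  shows "psum q \<mu> \<le> psum q hw"
proof -
  have "Bw \<mu> \<noteq> {}" using assms(1) by (auto simp: mult_def)
  then obtain b where b: "b \<in> B" "agree n (wtB b) \<mu>" by (auto simp: Bw_def)
  obtain w where "lowlist w" "wtB b = wwt w" using wtB[OF b(1)] by blast
  then have "psum q (wtB b) \<le> psum q hw" using psum_wwt assms(2) by simp
  moreover have "psum q (wtB b) = psum q \<mu>"
    using b(2) assms(2) unfolding psum_def agree_def by (intro sum.cong) auto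
  ultimately show ?thesis by simp
qed

lemma has_weight_add: "has_weight \<mu> x \<Longrightarrow> has_weight \<mu> y \<Longrightarrow> has_weight \<mu> (x + y)"
  by (simp add: has_weight_def M_add scale_right_distrib)

lemma has_weight_zero: "has_weight \<mu> 0"
  by (simp add: has_weight_def M_zero)

lemma has_weight_sum: "(\<And>i. i \<in> S \<Longrightarrow> has_weight \<mu> (f i)) \<Longrightarrow> has_weight \<mu> (sum f S)"
  by (induction S rule: infinite_finite_induct) (simp_all add: has_weight_add has_weight_zero)

lemma has_weight_M_M:
  assumes "has_weight \<mu> u" "a < 2 * n" "b < 2 * n"
  shows "has_weight \<mu> (M a b (M b a u))"
proof -
  have "has_weight (\<lambda>i. \<mu> i + root_fun n b a i + root_fun n a b i) (M a b (M b a u))"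
    using has_weight_M[OF has_weight_M[OF assms(1,3,2)] assms(2,3)] .
  then show ?thesis by (rule iffD1[OF has_weight_cong, rotated]) (simp add: agree_def root_fun_def)
qed

text \<open>The weight space of \<open>hw\<close> is the line through \<open>v\<close>, so
  \<open>v\<close> is an eigenvector; commuting with the letters carries the eigenvalue to every
  word.\<close>

lemma casimir_scalar: "\<exists>C. \<forall>b\<in>B. casimir b = scale C b"
proof -
  have "casimir v \<in> span B"
    unfolding casimir_def by (intro span_sum M_B span_base v_B) auto
  moreover have "has_weight hw (casimir v)"
    unfolding casimir_def by (intro has_weight_sum has_weight_M_M v_has_weight) auto
  ultimately have "casimir v \<in> span {v}" using has_weight_span_Bw B_hw by metis
  then obtain C where C: "casimir v = scale C v"
    by (metis span_singleton rangeE)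
  have "casimir (word w) = scale C (word w)" if "lowlist w" for w
    using that
  proof (induction w rule: word.induct)
    case (2 a b w)
    then have "low a b" "casimir (word w) = scale C (word w)" by (auto simp: lowlist_def)
    then show ?case using casimir_comm[of a b "word w", symmetric] by (simp add: low_def M_scale)
  qed (simp add: C)
  then show ?thesis by (metis wtB)
qed

lemma casimir_trace: "\<exists>C. \<forall>\<mu>. (\<Sum>a<2*n. \<Sum>b<2*n. trace_prod a b \<mu>) = C * of_nat (mult \<mu>)"
proof -
  obtain C where C: "\<And>b. b \<in> B \<Longrightarrow> casimir b = scale C b" using casimir_scalar by blast
  have "(\<Sum>a<2*n. \<Sum>b<2*n. trace_prod a b \<mu>) = C * of_nat (mult \<mu>)" for \<mu>
  proof -
    have "(\<Sum>a<2*n. \<Sum>b<2*n. trace_prod a b \<mu>) = (\<Sum>x\<in>Bw \<mu>. \<Sum>a<2*n. \<Sum>b<2*n. rep (M a b (M b a x)) x)"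
      unfolding trace_prod_def by (subst sum.swap[of _ "Bw \<mu>"]) (simp add: sum.swap[of _ "Bw \<mu>"])
    also have "\<dots> = (\<Sum>x\<in>Bw \<mu>. C)"
    proof (rule sum.cong[OF refl])
      fix x assume "x \<in> Bw \<mu>"
      then have x: "x \<in> B" "x \<in> span B" by (auto simp: Bw_def span_base)
      have "(\<Sum>a<2*n. \<Sum>b<2*n. rep (M a b (M b a x)) x) = rep (casimir x) x"
        unfolding casimir_def using x M_B
        by (subst representation_sum[OF B(2)] | auto intro!: span_sum sum.cong)+
      also have "\<dots> = C"
        using C[OF x(1)] x by (simp add: representation_scale[OF B(2)] representation_basis[OF B(2)])
      finally show "(\<Sum>a<2*n. \<Sum>b<2*n. rep (M a b (M b a x)) x) = C" .
    qed
    finally show ?thesis by (simp add: mult_def)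
  qed
  then show ?thesis by blast
qed

definition real_mult :: "(nat \<Rightarrow> int) \<Rightarrow> real" where
  "real_mult \<mu> = real (mult \<mu>)"

lemma mult_cong: "agree n \<mu> \<nu> \<Longrightarrow> mult \<mu> = mult \<nu>"
  unfolding mult_def by (simp add: Bw_cong)

lemma uniform_bound:
  "\<exists>H0. \<forall>H\<ge>H0. \<forall>a<2*n. \<forall>b<2*n. a \<noteq> b \<longrightarrow> (\<forall>h>H. mult (\<lambda>i. \<mu> i + int h * root_fun n a b i) = 0)"
proof -
  have "\<forall>a b. \<exists>H. a < 2 * n \<longrightarrow> b < 2 * n \<longrightarrow> a \<noteq> b \<longrightarrow> (\<forall>h\<ge>H. mult (\<lambda>i. \<mu> i + int h * root_fun n a b i) = 0)"
    using mult_eventually_0 by blast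
  then obtain g where g: "\<And>a b h. a < 2 * n \<Longrightarrow> b < 2 * n \<Longrightarrow> a \<noteq> b \<Longrightarrow> g a b \<le> h \<Longrightarrow> mult (\<lambda>i. \<mu> i + int h * root_fun n a b i) = 0"
    by metis
  define H0 where "H0 = (\<Sum>a<2*n. \<Sum>b<2*n. g a b)"
  have "g a b \<le> H0" if "a < 2 * n" "b < 2 * n" for a b
  proof -
    have "g a b \<le> (\<Sum>b<2*n. g a b)" using that by (intro member_le_sum) auto
    also have "\<dots> \<le> H0" unfolding H0_def using that by (intro member_le_sum[of a _ "\<lambda>a. \<Sum>b<2*n. g a b"]) auto
    finally show ?thesis .
  qed
  then have "mult (\<lambda>i. \<mu> i + int h * root_fun n a b i) = 0"
    if "H0 \<le> H" "a < 2 * n" "b < 2 * n" "a \<noteq> b" "H < h" for H a b h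
    using that by (intro g) (auto intro: le_trans[of _ H0])
  then show ?thesis by blast
qed

lemma trace_prod_pair_string:
  assumes ab: "a < 2 * n" "b < 2 * n" "a \<noteq> b"
    and H: "\<forall>h>H. mult (\<lambda>i. \<mu> i + int h * root_fun n a b i) = 0"
    and \<nu>: "\<And>h. agree n (\<lambda>i. \<mu> i + int h * root_fun n a b i) (\<nu> h)"
    and g: "\<And>h. pairing n (\<lambda>i. \<mu> i + int h * root_fun n a b i) a - pairing n (\<lambda>i. \<mu> i + int h * root_fun n a b i) b = g h"
  shows "trace_prod a b \<mu> + trace_prod b a \<mu>
    = of_int (kappa a b) * of_real (real_of_int (g 0) * real_mult \<mu> + 2 * (\<Sum>h=1..H. real_of_int (g h) * real_mult (\<nu> h)))"
proof -
  have g0: "pairing n \<mu> a - pairing n \<mu> b = g 0" using g[of 0] by simp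
  show ?thesis
    unfolding trace_prod_pair[OF ab H] g g0 mult_cong[OF \<nu>] real_mult_def by simp
qed

text \<open>The disjunction lists the two index pairs that carry the root
  \<open>\<epsilon>\<^sub>i - \<epsilon>\<^sub>j\<close>; the next lemma does the same for
  \<open>\<epsilon>\<^sub>i + \<epsilon>\<^sub>j\<close>.\<close>

lemma trace_prod_diff_string:
  assumes ij: "i < n" "j < n" "i \<noteq> j" and ab: "(a, b) = (i, j) \<or> (a, b) = (j + n, i + n)"
    and H: "\<forall>h>H. mult (\<lambda>i. \<mu> i + int h * root_fun n a b i) = 0"
  shows "trace_prod a b \<mu> + trace_prod b a \<mu> = of_real (str_diff H real_mult \<mu> i j)"
proof -
  have k: "kappa a b = 1" using ij ab by (auto simp: kappa_def bar_def)
  have lt: "a < 2 * n" "b < 2 * n" "a \<noteq> b" using ij ab by auto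
  have \<nu>: "agree n (\<lambda>t. \<mu> t + int h * root_fun n a b t) (\<mu>(i := \<mu> i + int h, j := \<mu> j - int h))" for h
    using ab by (elim disjE; cases "i = j") (use ij in \<open>simp_all add: agree_def root_fun_def coord_wt_simps\<close>)
  have g: "pairing n (\<lambda>t. \<mu> t + int h * root_fun n a b t) a - pairing n (\<lambda>t. \<mu> t + int h * root_fun n a b t) b
      = \<mu> i - \<mu> j + 2 * int h" for h
    using ab by (elim disjE; cases "i = j") (use ij in \<open>simp_all add: pairing_def root_fun_def coord_wt_simps\<close>)
  show ?thesis
    using trace_prod_pair_string[OF lt H \<nu> g] by (simp add: k str_diff_def)
qed

lemma trace_prod_sum_string:
  assumes ij: "i < n" "j < n" "i \<noteq> j" and ab: "(a, b) = (i, j + n) \<or> (a, b) = (j, i + n)"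
    and H: "\<forall>h>H. mult (\<lambda>i. \<mu> i + int h * root_fun n a b i) = 0"
  shows "trace_prod a b \<mu> + trace_prod b a \<mu> = of_real (str_sum H real_mult \<mu> i j)"
proof -
  have k: "kappa a b = 1" using ij ab by (auto simp: kappa_def bar_def)
  have lt: "a < 2 * n" "b < 2 * n" "a \<noteq> b" using ij ab by auto
  have \<nu>: "agree n (\<lambda>t. \<mu> t + int h * root_fun n a b t) (\<mu>(i := \<mu> i + int h, j := \<mu> j + int h))" for h
    using ab by (elim disjE; cases "i = j") (use ij in \<open>simp_all add: agree_def root_fun_def coord_wt_simps\<close>)
  have g: "pairing n (\<lambda>t. \<mu> t + int h * root_fun n a b t) a - pairing n (\<lambda>t. \<mu> t + int h * root_fun n a b t) b
      = \<mu> i + \<mu> j + 2 * int h" for h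
    using ab by (elim disjE; cases "i = j") (use ij in \<open>simp_all add: pairing_def root_fun_def coord_wt_simps\<close>)
  show ?thesis
    using trace_prod_pair_string[OF lt H \<nu> g] by (simp add: k str_sum_def)
qed

lemma trace_prod_long_string:
  assumes i: "i < n"
    and H: "\<forall>h>H. mult (\<lambda>t. \<mu> t + int h * root_fun n i (i + n) t) = 0"
  shows "trace_prod i (i + n) \<mu> + trace_prod (i + n) i \<mu> = 2 * of_real (str_long H real_mult \<mu> i)"
proof -
  have k: "kappa i (i + n) = 2" using i by (auto simp: kappa_def bar_def)
  have lt: "i < 2 * n" "i + n < 2 * n" "i \<noteq> i + n" using i by auto
  have \<nu>: "agree n (\<lambda>t. \<mu> t + int h * root_fun n i (i + n) t) (\<mu>(i := \<mu> i + 2 * int h))" for h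
    using i by (auto simp: agree_def root_fun_def coord_wt_simps)
  have g: "pairing n (\<lambda>t. \<mu> t + int h * root_fun n i (i + n) t) i - pairing n (\<lambda>t. \<mu> t + int h * root_fun n i (i + n) t) (i + n)
      = 2 * \<mu> i + 4 * int h" for h
    using i by (simp add: pairing_def root_fun_def coord_wt_simps)
  show ?thesis
    using trace_prod_pair_string[OF lt H \<nu> g] by (simp add: k str_long_def)
qed

text \<open>The constant serves all weights, only the cutoff depends on the weight. This uniformity
  allows the constant to be computed later at the highest weight.\<close>

theorem freudenthal_mult:
  "\<exists>C. \<forall>\<mu>. \<exists>H0. \<forall>H\<ge>H0. complex_of_real (freudenthal n H real_mult \<mu>) = C * of_real (real_mult \<mu>)"
proof -
  obtain C where C: "\<And>\<mu>. (\<Sum>a<2*n. \<Sum>b<2*n. trace_prod a b \<mu>) = C * of_nat (mult \<mu>)"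
    using casimir_trace by blast
  have "\<exists>H0. \<forall>H\<ge>H0. complex_of_real (freudenthal n H real_mult \<mu>) = C / 2 * of_real (real_mult \<mu>)" for \<mu>
  proof -
    obtain H0 where H0: "\<And>H a b. H \<ge> H0 \<Longrightarrow> a < 2 * n \<Longrightarrow> b < 2 * n \<Longrightarrow> a \<noteq> b
        \<Longrightarrow> \<forall>h>H. mult (\<lambda>i. \<mu> i + int h * root_fun n a b i) = 0"
      using uniform_bound by blast
    have "complex_of_real (freudenthal n H real_mult \<mu>) = C / 2 * of_real (real_mult \<mu>)" if H: "H \<ge> H0" for H
    proof -
      let ?t = "\<lambda>a b. trace_prod a b \<mu>"
      \<comment> \<open>The 2n by 2n square of indices is folded into n by n; \<open>G i j\<close>
        collects its four blocks.\<close>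
      define G where "G i j = ?t i j + ?t (i + n) (j + n) + ?t i (j + n) + ?t (i + n) j" for i j
      have "(\<Sum>a<2*n. \<Sum>b<2*n. ?t a b) = (\<Sum>i<n. \<Sum>j<n. G i j)"
        unfolding sum_double_range G_def by (simp add: sum.distrib ac_simps)
      also have "2 * \<dots> = (\<Sum>i<n. \<Sum>j<n. G i j + G j i)"
        using sum.swap[of "\<lambda>i j. G j i" "{..<n}" "{..<n}"] by (simp add: sum.distrib)
      also have "\<dots> = 2 * (\<Sum>j<n. \<Sum>i<j. G i j + G j i) + (\<Sum>i<n. G i i + G i i)"
        using sum_pairs[of "\<lambda>i j. G i j + G j i" n] by (simp add: add.commute)
      also have "(\<Sum>j<n. \<Sum>i<j. G i j + G j i)
          = (\<Sum>j<n. \<Sum>i<j. 2 * complex_of_real (str_diff H real_mult \<mu> i j + str_sum H real_mult \<mu> i j))"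
      proof (intro sum.cong refl)
        fix i j assume "j \<in> {..<n}" "i \<in> {..<j}"
        then have ij: "i < n" "j < n" "i \<noteq> j" by auto
        then have lt: "i < 2 * n" "j < 2 * n" "i + n < 2 * n" "j + n < 2 * n"
          "j + n \<noteq> i + n" "i \<noteq> j + n" "j \<noteq> i + n" by auto
        have "?t i j + ?t j i = of_real (str_diff H real_mult \<mu> i j)"
          by (rule trace_prod_diff_string[OF ij disjI1[OF refl] H0[OF H lt(1,2) ij(3)]])
        moreover have "?t (j + n) (i + n) + ?t (i + n) (j + n) = of_real (str_diff H real_mult \<mu> i j)"
          by (rule trace_prod_diff_string[OF ij disjI2[OF refl] H0[OF H lt(4,3,5)]])
        moreover have "?t i (j + n) + ?t (j + n) i = of_real (str_sum H real_mult \<mu> i j)"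
          by (rule trace_prod_sum_string[OF ij disjI1[OF refl] H0[OF H lt(1,4,6)]])
        moreover have "?t j (i + n) + ?t (i + n) j = of_real (str_sum H real_mult \<mu> i j)"
          by (rule trace_prod_sum_string[OF ij disjI2[OF refl] H0[OF H lt(2,3,7)]])
        moreover have "G i j + G j i = (?t i j + ?t j i) + (?t (j + n) (i + n) + ?t (i + n) (j + n))
            + (?t i (j + n) + ?t (j + n) i) + (?t j (i + n) + ?t (i + n) j)"
          by (simp add: G_def)
        ultimately show "G i j + G j i = 2 * complex_of_real (str_diff H real_mult \<mu> i j + str_sum H real_mult \<mu> i j)"
          by simp
      qed
      also have "(\<Sum>i<n. G i i + G i i) = (\<Sum>i<n. 4 * complex_of_real ((real_of_int (\<mu> i))\<^sup>2 * real_mult \<mu> + str_long H real_mult \<mu> i))"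
      proof (intro sum.cong refl)
        fix i assume "i \<in> {..<n}"
        then have i: "i < n" by simp
        have "?t i i = (of_int (\<mu> i))\<^sup>2 * of_nat (mult \<mu>)" "?t (i + n) (i + n) = (of_int (\<mu> i))\<^sup>2 * of_nat (mult \<mu>)"
          using i trace_prod_diag[of i \<mu>] trace_prod_diag[of "i + n" \<mu>] by (simp_all add: pairing_def)
        moreover have "?t i (i + n) + ?t (i + n) i = 2 * of_real (str_long H real_mult \<mu> i)"
          by (rule trace_prod_long_string[OF i H0[OF H]]) (use i in auto)
        moreover have "G i i = ?t i i + ?t (i + n) (i + n) + (?t i (i + n) + ?t (i + n) i)"
          by (simp add: G_def)
        ultimately show "G i i + G i i = 4 * complex_of_real ((real_of_int (\<mu> i))\<^sup>2 * real_mult \<mu> + str_long H real_mult \<mu> i)"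
          by (simp add: real_mult_def)
      qed
      \<comment> \<open>The 2 on the left comes from symmetrising in \<open>i\<close> and
        \<open>j\<close>; the 4 on the right combines it with the double counting in
        \<open>casimir\<close>.\<close>
      finally have "2 * (C * of_nat (mult \<mu>)) = 4 * complex_of_real (freudenthal n H real_mult \<mu>)"
        unfolding C by (simp add: freudenthal_def sum_distrib_left sum_distrib_right sum.distrib algebra_simps)
      then show ?thesis by (simp add: real_mult_def)
    qed
    then show ?thesis by blast
  qed
  then show ?thesis by blast
qed

end

section \<open>sl2 theory and invariance under the Weyl group\<close>

context vector_space
begin

text \<open>Applying \<open>E\<close> to an eigenvector of \<open>F E\<close> with negative
  eigenvalue gives a nonzero eigenvector with an even smaller eigenvalue, because k >= 0. So no
  power of \<open>E\<close> kills \<open>u\<close>, against nilpotency. The family \<open>P\<close>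
  is indexed by weight and \<open>s\<close> rescales the commutator.\<close>

lemma sl2_no_negative_eigenvalue:
  fixes E F :: "'b \<Rightarrow> 'b" and P :: "int \<Rightarrow> 'b set" and s :: int and sc :: "int \<Rightarrow> 'a"
  assumes lin: "Vector_Spaces.linear scale scale E" "Vector_Spaces.linear scale scale F"
    and E: "\<And>k u. u \<in> P k \<Longrightarrow> E u \<in> P (k + 2)"
    and comm: "\<And>k u. u \<in> P k \<Longrightarrow> E (F u) = F (E u) + scale (of_int (s * k)) u"
    and nil: "\<And>k u. u \<in> P k \<Longrightarrow> \<exists>m. (E ^^ m) u = 0"
    and s: "s > 0" and char0: "\<And>z::int. (of_int z :: 'a) = 0 \<longleftrightarrow> z = 0"
    and u: "0 \<le> k" "u \<in> P k" and c: "c > 0" and eig: "F (E u) = scale (of_int (- c)) u"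
  shows "u = 0"
proof (rule ccontr)
  assume "u \<noteq> 0"
  interpret E: Vector_Spaces.linear scale scale E by (rule lin)
  interpret F: Vector_Spaces.linear scale scale F by (rule lin)
  have "(E ^^ m) u \<noteq> 0 \<and> (E ^^ m) u \<in> P (k + 2 * int m) \<and> (\<exists>c>0. F (E ((E ^^ m) u)) = scale (of_int (- c)) ((E ^^ m) u))" for m
  proof (induction m)
    case 0
    show ?case using \<open>u \<noteq> 0\<close> u c eig by auto
  next
    case (Suc m)
    define w where "w = (E ^^ m) u"
    obtain c where w: "w \<noteq> 0" "w \<in> P (k + 2 * int m)" "c > 0" "F (E w) = scale (of_int (- c)) w"
      using Suc unfolding w_def by blast
    have Ew: "E w \<in> P (k + 2 * int (Suc m))" using E[OF w(2)] by (simp add: algebra_simps)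
    have "E w \<noteq> 0"
    proof
      assume "E w = 0"
      then have "scale (of_int (- c)) w = 0" using w(4) F.zero by simp
      then show False using w(1,3) char0[of "- c"] by (simp del: of_int_minus)
    qed
    moreover have "F (E (E w)) = scale (of_int (- (c + s * (k + 2 * int (Suc m))))) (E w)"
    proof -
      have "F (E (E w)) = E (F (E w)) - scale (of_int (s * (k + 2 * int (Suc m)))) (E w)"
        using comm[OF Ew] by simp
      also have "E (F (E w)) = scale (of_int (- c)) (E w)" unfolding w(4) E.scale ..
      finally show ?thesis
        unfolding scale_left_diff_distrib[symmetric] of_int_diff[symmetric] by (simp add: algebra_simps)
    qed
    moreover have "c + s * (k + 2 * int (Suc m)) > 0" using w(3) s u(1) by (intro add_pos_nonneg) auto
    ultimately show ?case using Ew unfolding funpow.simps comp_def w_def[symmetric] by blast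
  qed
  then show False using nil[OF u(2)] by blast
qed

text \<open>On \<open>P k\<close> one has E F^(i+1) = F^i (F E + c) with c = s (i + 1)(k - i) > 0
  for i < k. If F^(i+1) u = 0, induction gives (F E + c) u = 0, a negative eigenvalue, which the
  previous lemma excludes.\<close>

lemma sl2_injective:
  fixes E F :: "'b \<Rightarrow> 'b" and P :: "int \<Rightarrow> 'b set" and s :: int
  assumes lin: "Vector_Spaces.linear scale scale E" "Vector_Spaces.linear scale scale F"
    and P: "\<And>k. subspace (P k)"
    and E: "\<And>k u. u \<in> P k \<Longrightarrow> E u \<in> P (k + 2)"
    and F: "\<And>k u. u \<in> P k \<Longrightarrow> F u \<in> P (k - 2)"
    and comm: "\<And>k u. u \<in> P k \<Longrightarrow> E (F u) = F (E u) + scale (of_int (s * k)) u"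
    and nil: "\<And>k u. u \<in> P k \<Longrightarrow> \<exists>m. (E ^^ m) u = 0"
    and s: "s > 0" and char0: "\<And>z::int. (of_int z :: 'a) = 0 \<longleftrightarrow> z = 0"
    and "u \<in> P k" "int i \<le> k" "(F ^^ i) u = 0"
  shows "u = 0"
  using assms(10-12)
proof (induction i arbitrary: u)
  case (Suc i)
  interpret E: Vector_Spaces.linear scale scale E by (rule lin)
  interpret F: Vector_Spaces.linear scale scale F by (rule lin)
  have Fi: "(F ^^ i) u \<in> P (k - 2 * int i)" if "u \<in> P k" for i u
  proof (induction i)
    case (Suc i)
    have e: "k - 2 * int (Suc i) = k - 2 * int i - 2" by simp
    show ?case unfolding e using F[OF Suc] by simp
  qed (use that in simp)
  have Fadd: "(F ^^ i) (x + y) = (F ^^ i) x + (F ^^ i) y" for i x y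
    by (induction i) (simp_all add: F.add)
  have Fscale: "(F ^^ i) (scale c x) = scale c ((F ^^ i) x)" for i c x
    by (induction i) (simp_all add: F.scale)
  have EF: "E ((F ^^ Suc i) u) = (F ^^ i) (F (E u) + scale (of_int (s * (int (Suc i) * (k - int i)))) u)"
    if "u \<in> P k" for i u
  proof (induction i)
    case 0
    then show ?case using comm[OF that] by simp
  next
    case (Suc i)
    have "E ((F ^^ Suc (Suc i)) u) = E (F ((F ^^ Suc i) u))" by simp
    also have "\<dots> = F (E ((F ^^ Suc i) u)) + scale (of_int (s * (k - 2 * int (Suc i)))) ((F ^^ Suc i) u)"
      by (rule comm[OF Fi[OF that]])
    also have "F (E ((F ^^ Suc i) u)) = (F ^^ Suc i) (F (E u) + scale (of_int (s * (int (Suc i) * (k - int i)))) u)"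
      unfolding Suc by simp
    also have "\<dots> + scale (of_int (s * (k - 2 * int (Suc i)))) ((F ^^ Suc i) u)
        = (F ^^ Suc i) (F (E u) + scale (of_int (s * (int (Suc i) * (k - int i))) + of_int (s * (k - 2 * int (Suc i)))) u)"
      unfolding Fadd Fscale scale_left_distrib by (simp add: add.assoc)
    also have "of_int (s * (int (Suc i) * (k - int i))) + of_int (s * (k - 2 * int (Suc i)))
        = (of_int (s * (int (Suc (Suc i)) * (k - int (Suc i)))) :: 'a)"
      unfolding of_int_add[symmetric] by (rule arg_cong[where f = of_int]) (simp add: algebra_simps)
    finally show ?case .
  qed
  define c where "c = s * (int (Suc i) * (k - int i))"
  have c: "c > 0" unfolding c_def using s Suc.prems(2) by simp
  have FE: "F (E u) \<in> P k" using F[OF E[OF Suc.prems(1)]] by simp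
  have "(F ^^ i) (F (E u) + scale (of_int c) u) = 0"
    using EF[OF Suc.prems(1), of i] Suc.prems(3) E.zero unfolding c_def by simp
  moreover have "F (E u) + scale (of_int c) u \<in> P k"
    using FE Suc.prems(1) P by (intro subspace_add subspace_scale) auto
  ultimately have "F (E u) + scale (of_int c) u = 0"
    using Suc.IH Suc.prems(2) by simp
  then have eig: "F (E u) = scale (of_int (- c)) u"
    by (simp add: eq_neg_iff_add_eq_0)
  show ?case
    by (rule sl2_no_negative_eigenvalue[of E F P s k u c, OF lin E comm nil s char0 _ Suc.prems(1) c eig]) (use Suc.prems(2) in auto)
qed simp

lemma linear_funpow:
  assumes "Vector_Spaces.linear scale scale F"
  shows "Vector_Spaces.linear scale scale (F ^^ m)"
proof (induction m)
  case 0
  then show ?case by (simp add: linear_id id_def[symmetric])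
next
  case (Suc m)
  show ?case unfolding funpow.simps by (rule Vector_Spaces.linear_compose[OF Suc assms])
qed

end

context sp_hw
begin

lemma has_weight_scale: "has_weight \<mu> x \<Longrightarrow> has_weight \<mu> (scale c x)"
  by (simp add: has_weight_def M_scale mult.commute)

text \<open>Here \<open>k\<close> is the value of \<mu> on the coroot, so the weight on the right is
  the reflection of \<mu>. The k-th power of the lowering operator maps the first weight space
  injectively into the second.\<close>

lemma mult_reflect_le:
  assumes ab: "a < 2 * n" "b < 2 * n" "a \<noteq> b"
    and k: "pairing n \<mu> a - pairing n \<mu> b = kappa a b * k" "0 \<le> k"
  shows "mult \<mu> \<le> mult (\<lambda>i. \<mu> i - k * root_fun n a b i)"
proof -
  \<comment> \<open>\<open>\<nu> l\<close> is the weight on the line through \<mu> with coroot value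
    \<open>l\<close>. For the wrong parity the root string contains no such weight and
    \<open>P l\<close> is the zero space.\<close>
  define \<nu> where "\<nu> l = (\<lambda>i. \<mu> i + (l - k) div 2 * root_fun n a b i)" for l
  define P where "P l = (if even (l - k) then {u \<in> span B. has_weight (\<nu> l) u} else {0})" for l
  have kappa: "kappa a b > 0" by (simp add: kappa_def)
  have rtp: "pairing n (root_fun n a b) a - pairing n (root_fun n a b) b = 2 * kappa a b"
    using ab by (auto simp: pairing_def root_fun_def coord_wt_def kappa_def bar_def)
  have wlin: "pairing n (\<nu> l) x = pairing n \<mu> x + (l - k) div 2 * pairing n (root_fun n a b) x" for l x
    by (simp add: pairing_def \<nu>_def)
  have P: "subspace (P l)" for l
    unfolding P_def subspace_def
    by (auto simp: span_zero has_weight_zero span_add has_weight_add span_scale has_weight_scale)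
  have Pspan: "P l \<subseteq> span B" for l by (auto simp: P_def span_zero)
  have E: "M a b u \<in> P (l + 2)" if "u \<in> P l" for l u
  proof (cases "even (l - k)")
    case True
    then have "(l + 2 - k) div 2 = (l - k) div 2 + 1" by (auto elim!: evenE simp: algebra_simps)
    then have "(\<lambda>i. \<nu> l i + root_fun n a b i) = \<nu> (l + 2)" by (simp add: \<nu>_def algebra_simps)
    then show ?thesis using that True has_weight_M[of "\<nu> l" u a b] M_B[of a b u] ab by (simp add: P_def)
  qed (use that in \<open>simp add: P_def M_zero\<close>)
  have F: "M b a u \<in> P (l - 2)" if "u \<in> P l" for l u
  proof (cases "even (l - k)")
    case True
    then have "(l - 2 - k) div 2 = (l - k) div 2 - 1" by (auto elim!: evenE simp: algebra_simps)
    then have "(\<lambda>i. \<nu> l i + root_fun n b a i) = \<nu> (l - 2)" unfolding \<nu>_def by (simp only:) (simp add: fun_eq_iff root_fun_def algebra_simps)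
    then show ?thesis using that True has_weight_M[of "\<nu> l" u b a] M_B[of b a u] ab by (simp add: P_def)
  qed (use that in \<open>simp add: P_def M_zero\<close>)
  \<comment> \<open>One factor \<open>kappa\<close> comes from the commutator, the other from the
    pairing with the root.\<close>
  have comm': "M a b (M b a u) = M b a (M a b u) + scale (of_int ((kappa a b)\<^sup>2 * l)) u" if "u \<in> P l" for l u
  proof (cases "even (l - k)")
    case True
    then have w: "has_weight (\<nu> l) u" using that by (simp add: P_def)
    have p: "pairing n (\<nu> l) a - pairing n (\<nu> l) b = kappa a b * l"
    proof -
      have "pairing n (\<nu> l) a - pairing n (\<nu> l) b = kappa a b * k + (l - k) div 2 * (2 * kappa a b)"
        unfolding wlin k(1)[symmetric] rtp[symmetric] by (simp add: algebra_simps)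
      also have "\<dots> = kappa a b * (k + 2 * ((l - k) div 2))" by (simp add: algebra_simps)
      finally show ?thesis using True by simp
    qed
    have "M a b (M b a u) - M b a (M a b u) = scale (of_int ((kappa a b)\<^sup>2 * l)) u"
      using comm_pair[OF ab w] unfolding p by (simp add: power2_eq_square mult.assoc)
    then show ?thesis by (simp add: algebra_simps)
  qed (use that in \<open>simp add: P_def M_zero\<close>)
  have nil: "\<exists>m. (M a b ^^ m) u = 0" if "u \<in> P l" for l u
  proof -
    obtain H where "mult (\<lambda>i. \<nu> l i + int H * root_fun n a b i) = 0"
      using mult_eventually_0[OF ab] by blast
    then have e: "Bw (\<lambda>i. \<nu> l i + int H * root_fun n a b i) = {}" using finite_Bw by (simp add: mult_def)
    have Pm: "(M a b ^^ m) u \<in> P (l + 2 * int m)" for m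
    proof (induction m)
      case (Suc m)
      have e: "l + 2 * int (Suc m) = l + 2 * int m + 2" by simp
      show ?case unfolding e using E[OF Suc] by simp
    qed (use that in simp)
    show ?thesis
    proof (cases "even (l - k)")
      case True
      then have "(l + 2 * int H - k) div 2 = (l - k) div 2 + int H" by (auto elim!: evenE simp: algebra_simps)
      then have "\<nu> (l + 2 * int H) = (\<lambda>i. \<nu> l i + int H * root_fun n a b i)" by (simp add: \<nu>_def algebra_simps)
      moreover have "even (l + 2 * int H - k)" using True by simp
      ultimately have "(M a b ^^ H) u \<in> span B" "has_weight (\<lambda>i. \<nu> l i + int H * root_fun n a b i) ((M a b ^^ H) u)"
        using Pm[of H] by (auto simp: P_def)
      then have "(M a b ^^ H) u \<in> span {}" using has_weight_span_Bw e by metis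
      then show ?thesis by auto
    next
      case False
      then have "(M a b ^^ 0) u = 0" using that by (simp add: P_def)
      then show ?thesis by blast
    qed
  qed
  define g where "g = M b a ^^ nat k"
  have glin: "Vector_Spaces.linear scale scale g" unfolding g_def by (rule linear_funpow[OF linM])
  have \<nu>k: "\<nu> k = \<mu>" by (simp add: \<nu>_def)
  have BP: "span (Bw \<mu>) \<subseteq> P k"
  proof (rule span_minimal[OF _ P])
    show "Bw \<mu> \<subseteq> P k" using has_weight_Bw by (auto simp: P_def \<nu>k Bw_def span_base)
  qed
  have ker: "u = 0" if "u \<in> P k" "g u = 0" for u
    using sl2_injective[of "M a b" "M b a" P "(kappa a b)\<^sup>2" u k "nat k", OF linM linM P E F comm' nil _ _ that(1)]
      that(2) k(2) kappa unfolding g_def by simp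
  have inj: "inj_on g (span (Bw \<mu>))"
  proof (rule inj_onI)
    fix x y assume xy: "x \<in> span (Bw \<mu>)" "y \<in> span (Bw \<mu>)" "g x = g y"
    then have "g (x - y) = 0" using module_hom.diff[OF glin[unfolded linear_iff_module_hom]] by simp
    moreover have "x - y \<in> P k" using xy BP span_diff by blast
    ultimately show "x = y" using ker[of "x - y"] by simp
  qed
  have ind: "independent (Bw \<mu>)" using B(2) by (rule independent_mono) (auto simp: Bw_def)
  have gi: "independent (g ` Bw \<mu>)"
    using module_hom.independent_injective_image[OF glin[unfolded linear_iff_module_hom] ind inj] .
  have gP: "(M b a ^^ m) u \<in> P (k - 2 * int m)" if "u \<in> P k" for m u
  proof (induction m)
    case (Suc m)
    have e: "k - 2 * int (Suc m) = k - 2 * int m - 2" by simp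
    show ?case unfolding e using F[OF Suc] by simp
  qed (use that in simp)
  have "g ` Bw \<mu> \<subseteq> span (Bw (\<lambda>i. \<mu> i - k * root_fun n a b i))"
  proof
    fix y assume "y \<in> g ` Bw \<mu>"
    then obtain x where x: "x \<in> Bw \<mu>" "y = g x" by blast
    then have "x \<in> P k" using BP span_base by blast
    then have y: "y \<in> P (k - 2 * int (nat k))" using gP x(2) unfolding g_def by blast
    have "k - 2 * int (nat k) = - k" using k(2) by simp
    moreover have "\<nu> (- k) = (\<lambda>i. \<mu> i - k * root_fun n a b i)"
    proof -
      have "(- k - k) div 2 = - k" by presburger
      then show ?thesis by (simp add: \<nu>_def)
    qed
    moreover have "even (- k - k)" by presburger
    ultimately have "y \<in> span B" "has_weight (\<lambda>i. \<mu> i - k * root_fun n a b i) y"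
      using y by (auto simp: P_def)
    then show "y \<in> span (Bw (\<lambda>i. \<mu> i - k * root_fun n a b i))" by (rule has_weight_span_Bw[rotated])
  qed
  then have "card (g ` Bw \<mu>) \<le> card (Bw (\<lambda>i. \<mu> i - k * root_fun n a b i))"
    using independent_span_bound[OF finite_Bw gi] by blast
  moreover have "card (g ` Bw \<mu>) = card (Bw \<mu>)"
    by (rule card_image) (rule inj_on_subset[OF inj span_superset])
  ultimately show ?thesis by (simp add: mult_def)
qed

text \<open>The reflection is an involution, so the inequality at \<mu> and at its reflection gives
  equality. The sign of the coroot value decides which of the two opposite roots is used.\<close>

lemma mult_swap:
  assumes "i < n" "j < n"
  shows "mult (\<mu>(i := \<mu> j, j := \<mu> i)) = mult \<mu>"
proof (cases "i = j")
  case False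
  have le: "mult \<mu> \<le> mult (\<mu>(i := \<mu> j, j := \<mu> i))" for \<mu>
  proof -
    have lt: "i < 2 * n" "j < 2 * n" using assms by auto
    have k: "kappa i j = 1" "kappa j i = 1" using assms by (auto simp: kappa_def bar_def)
    show ?thesis
    proof (cases "\<mu> j \<le> \<mu> i")
      case True
      have "agree n (\<lambda>t. \<mu> t - (\<mu> i - \<mu> j) * root_fun n i j t) (\<mu>(i := \<mu> j, j := \<mu> i))"
        using assms False by (simp add: agree_def root_fun_def coord_wt_simps)
      then show ?thesis
        using mult_reflect_le[OF lt False, of \<mu> "\<mu> i - \<mu> j"] True assms mult_cong by (simp add: pairing_def k)
    next
      case le: False
      have "agree n (\<lambda>t. \<mu> t - (\<mu> j - \<mu> i) * root_fun n j i t) (\<mu>(i := \<mu> j, j := \<mu> i))"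
        using assms False by (simp add: agree_def root_fun_def coord_wt_simps)
      then show ?thesis
        using mult_reflect_le[OF lt(2,1) False[symmetric], of \<mu> "\<mu> j - \<mu> i"] le assms mult_cong by (simp add: pairing_def k)
    qed
  qed
  have "(\<mu>(i := \<mu> j, j := \<mu> i))(i := (\<mu>(i := \<mu> j, j := \<mu> i)) j, j := (\<mu>(i := \<mu> j, j := \<mu> i)) i) = \<mu>"
    using False by auto
  then show ?thesis using le[of \<mu>] le[of "\<mu>(i := \<mu> j, j := \<mu> i)"] by simp
qed simp

lemma mult_flip:
  assumes "i < n"
  shows "mult (\<mu>(i := - \<mu> i)) = mult \<mu>"
proof -
  have le: "mult \<mu> \<le> mult (\<mu>(i := - \<mu> i))" for \<mu>
  proof -
    have lt: "i < 2 * n" "i + n < 2 * n" "i \<noteq> i + n" "i + n \<noteq> i" using assms by auto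
    have k: "kappa i (i + n) = 2" "kappa (i + n) i = 2" using assms by (auto simp: kappa_def bar_def)
    show ?thesis
    proof (cases "0 \<le> \<mu> i")
      case True
      have "agree n (\<lambda>t. \<mu> t - \<mu> i * root_fun n i (i + n) t) (\<mu>(i := - \<mu> i))"
        using assms by (simp add: agree_def root_fun_def coord_wt_simps)
      then show ?thesis
        using mult_reflect_le[OF lt(1-3), of \<mu> "\<mu> i"] True assms mult_cong by (simp add: pairing_def k)
    next
      case False
      have "agree n (\<lambda>t. \<mu> t - (- \<mu> i) * root_fun n (i + n) i t) (\<mu>(i := - \<mu> i))"
        using assms by (simp add: agree_def root_fun_def coord_wt_simps)
      then show ?thesis
        using mult_reflect_le[OF lt(2,1,4), of \<mu> "- \<mu> i"] False assms mult_cong by (simp add: pairing_def k)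
    qed
  qed
  have "(\<mu>(i := - \<mu> i))(i := - (\<mu>(i := - \<mu> i)) i) = \<mu>" by auto
  then show ?thesis using le[of \<mu>] le[of "\<mu>(i := - \<mu> i)"] by simp
qed

end

section \<open>Uniqueness of dominated solutions of Freudenthal's recursion\<close>

text \<open>This is (\<mu>, \<rho>), as \<rho> = (n, n - 1, ..., 1) with entries counted from
  0.\<close>

definition height :: "nat \<Rightarrow> (nat \<Rightarrow> int) \<Rightarrow> int" where
  "height n \<mu> = (\<Sum>i<n. (int n - int i) * \<mu> i)"

text \<open>This is (\<mu>, \<mu> + 2\<rho>), the Casimir eigenvalue for highest weight
  \<mu>.\<close>

definition qform :: "nat \<Rightarrow> (nat \<Rightarrow> int) \<Rightarrow> int" where
  "qform n \<mu> = (\<Sum>i<n. (\<mu> i)\<^sup>2) + 2 * height n \<mu>"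

lemma height_upd:
  assumes "i < n"
  shows "height n (\<mu>(i := a)) = height n \<mu> + (int n - int i) * (a - \<mu> i)"
proof -
  have r: "(\<Sum>t<n. g t) = g i + (\<Sum>t\<in>{..<n} - {i}. g t)" for g :: "nat \<Rightarrow> int"
    using assms by (simp add: sum.remove[of "{..<n}" i])
  have "(\<Sum>t\<in>{..<n} - {i}. (int n - int t) * (\<mu>(i := a)) t) = (\<Sum>t\<in>{..<n} - {i}. (int n - int t) * \<mu> t)"
    by (intro sum.cong) auto
  then show ?thesis unfolding height_def r by (simp add: algebra_simps)
qed

lemma height_upd2:
  assumes "i < n" "j < n" "i \<noteq> j"
  shows "height n (\<mu>(i := a, j := b)) = height n \<mu> + (int n - int i) * (a - \<mu> i) + (int n - int j) * (b - \<mu> j)"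
  using assms by (simp add: height_upd)

lemma height_Suc: "height (Suc n) \<mu> = height n \<mu> + (\<Sum>i<n. \<mu> i) + \<mu> n"
  by (simp add: height_def sum.distrib[symmetric] algebra_simps)

lemma height_psum: "height n \<mu> = (\<Sum>q\<in>{1..n}. psum q \<mu>)"
proof (induction n)
  case (Suc n)
  then show ?case by (simp add: height_Suc psum_def)
qed (simp add: height_def)

lemma freudenthal_diff: "freudenthal n H (\<lambda>\<mu>. f \<mu> - g \<mu>) \<mu> = freudenthal n H f \<mu> - freudenthal n H g \<mu>"
  unfolding freudenthal_def str_diff_def str_sum_def str_long_def
  by (simp add: right_diff_distrib sum_subtractf sum.distrib)

text \<open>With all higher string terms zero only (\<mu>, \<mu>) and the sum of (\<mu>, \<alpha>)
  over positive roots remain, and the positive roots add up to 2\<rho>.\<close>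

lemma freudenthal_extremal:
  assumes d: "\<And>i j h. i < j \<Longrightarrow> j < n \<Longrightarrow> 0 < h \<Longrightarrow> f (\<mu>(i := \<mu> i + h, j := \<mu> j - h)) = 0"
    and s: "\<And>i j h. i < j \<Longrightarrow> j < n \<Longrightarrow> 0 < h \<Longrightarrow> f (\<mu>(i := \<mu> i + h, j := \<mu> j + h)) = 0"
    and l: "\<And>i h. i < n \<Longrightarrow> 0 < h \<Longrightarrow> f (\<mu>(i := \<mu> i + h)) = 0"
  shows "freudenthal n H f \<mu> = real_of_int (qform n \<mu>) * f \<mu>"
proof -
  have "str_diff H f \<mu> i j + str_sum H f \<mu> i j = real_of_int (2 * \<mu> i) * f \<mu>" if "i < j" "j < n" for i j
    using d[OF that] s[OF that] by (simp add: str_diff_def str_sum_def algebra_simps)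
  then have "(\<Sum>j<n. \<Sum>i<j. str_diff H f \<mu> i j + str_sum H f \<mu> i j) = (\<Sum>j<n. \<Sum>i<j. real_of_int (2 * \<mu> i)) * f \<mu>"
    unfolding sum_distrib_right by (intro sum.cong refl) auto
  moreover have "(\<Sum>i<n. str_long H f \<mu> i) = (\<Sum>i<n. real_of_int (2 * \<mu> i)) * f \<mu>"
    unfolding sum_distrib_right
  proof (intro sum.cong refl)
    fix i assume "i \<in> {..<n}"
    then have "f (\<mu>(i := \<mu> i + 2 * int h)) = 0" if "h \<in> {1..H}" for h
      using l[of i "2 * int h"] that by auto
    then show "str_long H f \<mu> i = real_of_int (2 * \<mu> i) * f \<mu>"
      by (simp add: str_long_def)
  qed
  moreover have "(\<Sum>j<n. \<Sum>i<j. 2 * \<mu> i) + (\<Sum>i<n. 2 * \<mu> i) = 2 * height n \<mu>"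
  proof (induction n)
    case (Suc n)
    then show ?case by (simp add: height_Suc sum_distrib_left[symmetric])
  qed (simp add: height_def)
  then have "(\<Sum>j<n. \<Sum>i<j. real_of_int (2 * \<mu> i)) + (\<Sum>i<n. real_of_int (2 * \<mu> i)) = 2 * real_of_int (height n \<mu>)"
    unfolding of_int_sum[symmetric] of_int_add[symmetric] by simp
  ultimately show ?thesis
    unfolding freudenthal_def qform_def by (simp add: distrib_right[symmetric] del: of_int_mult)
qed

lemma abel_summation:
  fixes x g :: "nat \<Rightarrow> int"
  shows "(\<Sum>i<n. x i * g i) = (\<Sum>i<n. x i) * g n + (\<Sum>i<n. (\<Sum>t<Suc i. x t) * (g i - g (Suc i)))"
  by (induction n) (simp_all add: algebra_simps)

text \<open>The difference of the two values is (\<nu> - \<mu>, \<nu> + \<mu> + 2\<rho>). The second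
  vector is positive and strictly decreasing, so Abel summation writes this as a sum of nonnegative
  partial sums with positive weights; it vanishes only if all partial sums do.\<close>

lemma qform_dominated:
  assumes dom: "\<And>i j. i < j \<Longrightarrow> j < n \<Longrightarrow> \<mu> j \<le> \<mu> i" "\<And>i. i < n \<Longrightarrow> 0 \<le> \<mu> i"
    and dom': "\<And>i j. i < j \<Longrightarrow> j < n \<Longrightarrow> \<nu> j \<le> \<nu> i" "\<And>i. i < n \<Longrightarrow> 0 \<le> \<nu> i"
    and le: "\<And>q. q \<le> n \<Longrightarrow> psum q \<mu> \<le> psum q \<nu>" and eq: "qform n \<mu> = qform n \<nu>"
  shows "agree n \<mu> \<nu>"
proof -
  define x where "x i = \<nu> i - \<mu> i" for i
  \<comment> \<open>The value 0 at \<open>n\<close> removes the boundary term of Abel summation and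
    makes the last gap positive too.\<close>
  define g where "g i = (if i < n then \<nu> i + \<mu> i + 2 * (int n - int i) else 0)" for i
  have g: "g (Suc i) < g i" if "i < n" for i
    using that dom(1)[of i "Suc i"] dom'(1)[of i "Suc i"] dom(2)[of i] dom'(2)[of i] by (auto simp: g_def)
  have S: "0 \<le> (\<Sum>t<Suc i. x t)" if "i < n" for i
    using le[of "Suc i"] that by (simp add: psum_def x_def sum_subtractf)
  have "(\<Sum>i<n. x i * g i) = qform n \<nu> - qform n \<mu>"
  proof -
    have "(\<Sum>i<n. x i * g i) = (\<Sum>i<n. ((\<nu> i)\<^sup>2 + 2 * ((int n - int i) * \<nu> i)) - ((\<mu> i)\<^sup>2 + 2 * ((int n - int i) * \<mu> i)))"
      by (intro sum.cong refl) (simp add: x_def g_def algebra_simps power2_eq_square)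
    then show ?thesis
      by (simp add: qform_def height_def sum_subtractf sum.distrib sum_distrib_left)
  qed
  then have z: "(\<Sum>i<n. (\<Sum>t<Suc i. x t) * (g i - g (Suc i))) = 0"
    using abel_summation[of x g n] eq by (simp add: g_def)
  have nn: "0 \<le> (\<Sum>t<Suc i. x t) * (g i - g (Suc i))" if "i \<in> {..<n}" for i
    using S[of i] g[of i] that by (intro mult_nonneg_nonneg) auto
  have "(\<Sum>t<Suc i. x t) = 0" if "i < n" for i
  proof -
    have "(\<Sum>t<Suc i. x t) * (g i - g (Suc i)) = 0"
      using sum_nonneg_eq_0_iff[of "{..<n}" "\<lambda>i. (\<Sum>t<Suc i. x t) * (g i - g (Suc i))"] nn z that by auto
    then show ?thesis using g[OF that] by simp
  qed
  then have s: "(\<Sum>t<i. x t) = 0" if "i \<le> n" for i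
    using that by (cases i) auto
  have "x i = 0" if "i < n" for i
    using s[of i] s[of "Suc i"] that by simp
  then show ?thesis by (auto simp: agree_def x_def)
qed

lemma mult_formula_cong: "agree n \<mu> \<nu> \<Longrightarrow> mult_formula n p K \<mu> = mult_formula n p K \<nu>"
proof -
  assume a: "agree n \<mu> \<nu>"
  have "wnorm n \<mu> = wnorm n \<nu>" unfolding wnorm_def using a by (intro sum.cong) (auto simp: agree_def)
  moreover have "nonzero_count n \<mu> = nonzero_count n \<nu>" unfolding nonzero_count_sum using a by (intro sum.cong) (auto simp: agree_def)
  ultimately show ?thesis by (simp add: mult_formula_def)
qed

lemma mult_formula_swap:
  assumes "i < n" "j < n"
  shows "mult_formula n p K (\<mu>(i := \<mu> j, j := \<mu> i)) = mult_formula n p K \<mu>"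
proof (cases "i = j")
  case False
  have "(\<Sum>t<n. \<phi> ((\<mu>(i := \<mu> j, j := \<mu> i)) t)) = (\<Sum>t<n. \<phi> (\<mu> t))" for \<phi> :: "int \<Rightarrow> 'a::comm_monoid_add"
    using sum_fun_upd2[OF assms False, of \<phi> \<mu> "\<mu> j" "\<mu> i"] sum_fun_upd2[OF assms False, of \<phi> \<mu> "\<mu> i" "\<mu> j"]
    by (simp add: ac_simps)
  note this[of abs] this[of "\<lambda>x. of_bool (x \<noteq> 0) :: nat"]
  then show ?thesis by (simp only: mult_formula_def wnorm_def nonzero_count_sum)
qed simp

lemma mult_formula_flip:
  assumes "i < n"
  shows "mult_formula n p K (\<mu>(i := - \<mu> i)) = mult_formula n p K \<mu>"
proof -
  have "(\<Sum>t<n. \<phi> ((\<mu>(i := - \<mu> i)) t)) = (\<Sum>t<n. \<phi> (\<mu> t))" if "\<phi> (- \<mu> i) = \<phi> (\<mu> i)" for \<phi> :: "int \<Rightarrow> 'a::comm_monoid_add"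
    using sum_fun_upd[OF assms, of \<phi> \<mu> "- \<mu> i"] sum_fun_upd[OF assms, of \<phi> \<mu> "\<mu> i"] that by simp
  note this[of abs] this[of "\<lambda>x. of_bool (x \<noteq> 0) :: nat"]
  then show ?thesis by (simp only: mult_formula_def wnorm_def nonzero_count_sum) simp
qed

section \<open>The formula at and below the highest weight\<close>

context
  fixes n p k :: nat and hw :: "nat \<Rightarrow> int"
  assumes p: "1 \<le> p" "p \<le> n" and hw_eq: "hw = (\<lambda>i. int k * omega 1 i + omega p i)"
begin

lemma psum_hw: "q \<le> n \<Longrightarrow> psum q hw = (if q = 0 then 0 else int k + int (min q p))"
proof -
  have 1: "(\<Sum>i<q. omega m i) = int (min q m)" for m
    by (induction q) (auto simp: omega_def)
  have "psum q hw = int k * int (min q 1) + int (min q p)"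
    unfolding psum_def hw_eq by (simp add: sum.distrib sum_distrib_left[symmetric] 1)
  then show ?thesis by auto
qed

lemma hw_dominant: "i < j \<Longrightarrow> hw j \<le> hw i" "0 \<le> hw i"
  by (auto simp: hw_eq omega_def)

lemma hw_norm: "wnorm n hw = int k + int p" and hw_nonzero_count: "nonzero_count n hw = p"
proof -
  have "wnorm n hw = psum n hw"
    unfolding wnorm_def psum_def using hw_dominant(2) by (intro sum.cong) auto
  then show "wnorm n hw = int k + int p" using psum_hw[of n] p by auto
  have "{i. i < n \<and> hw i \<noteq> 0} = {..<p}"
    using p by (auto simp: hw_eq omega_def)
  then show "nonzero_count n hw = p" by (simp add: nonzero_count_def)
qed

lemma mult_formula_hw: "mult_formula n p (int k + int p) hw = 1"
  using gen_coeff_leading[OF p(1)] by (simp add: mult_formula_def shell_coeff_def hw_norm hw_nonzero_count)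

text \<open>Two bounds give min(k + p, k + q): a partial sum is at most N <= k + p, and since at
  least l - q nonzero entries lie beyond position q it is at most N - (l - q) <= k + q.\<close>

lemma mult_formula_dominated:
  assumes "mult_formula n p (int k + int p) \<mu> \<noteq> 0" "q \<le> n"
  shows "psum q \<mu> \<le> psum q hw"
proof (cases "q = 0")
  case False
  define l where "l = nonzero_count n \<mu>"
  define N where "N = wnorm n \<mu>"
  have NK: "N \<le> int k + int p" and ev: "even (int k + int p - N)"
    and m: "gen_coeff n p l (nat ((int k + int p - N) div 2)) \<noteq> 0"
    using assms(1) by (auto simp: mult_formula_def shell_coeff_def l_def N_def split: if_splits)
  have Nl: "N - int l \<le> int k" if "1 \<le> l"
  proof -
    have "p \<le> l + 2 * nat ((int k + int p - N) div 2)" by (rule gen_coeff_support[OF m that])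
    then have "int p \<le> int l + 2 * ((int k + int p - N) div 2)" using NK by linarith
    then show ?thesis using ev by simp
  qed
  have split: "(\<Sum>i<n. g i) = (\<Sum>i<q. g i) + (\<Sum>i=q..<n. g i)" for g :: "nat \<Rightarrow> int"
    using assms(2) by (simp add: lessThan_atLeast0 sum.atLeastLessThan_concat)
  have l: "int l = (\<Sum>i<n. of_bool (\<mu> i \<noteq> 0))" unfolding l_def nonzero_count_sum by simp
  have "(\<Sum>i<q. of_bool (\<mu> i \<noteq> 0) :: int) \<le> (\<Sum>i<q. 1)" by (rule sum_mono) simp
  then have lq: "int l - int q \<le> (\<Sum>i=q..<n. of_bool (\<mu> i \<noteq> 0))" unfolding l split by simp
  have "(\<Sum>i=q..<n. of_bool (\<mu> i \<noteq> 0)) \<le> (\<Sum>i=q..<n. \<bar>\<mu> i\<bar>)" by (rule sum_mono) auto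
  moreover have "psum q \<mu> \<le> (\<Sum>i<q. \<bar>\<mu> i\<bar>)" unfolding psum_def by (rule sum_mono) simp
  moreover have "N = (\<Sum>i<q. \<bar>\<mu> i\<bar>) + (\<Sum>i=q..<n. \<bar>\<mu> i\<bar>)" unfolding N_def wnorm_def split ..
  moreover have "0 \<le> (\<Sum>i=q..<n. \<bar>\<mu> i\<bar>)" by (rule sum_nonneg) simp
  \<comment> \<open>The bound N - l <= k was obtained for l >= 1; the zero weight is covered
    here.\<close>
  moreover have "N = 0" if "l = 0"
  proof -
    have "{i. i < n \<and> \<mu> i \<noteq> 0} = {}" using that by (simp add: l_def nonzero_count_def)
    then show ?thesis unfolding N_def wnorm_def by (intro sum.neutral) auto
  qed
  ultimately have "psum q \<mu> \<le> N" "psum q \<mu> \<le> int k + int q"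
    using lq Nl by (cases "l = 0"; linarith)+
  then show ?thesis using NK False psum_hw[OF assms(2)] by (simp add: min_def)
qed (simp add: psum_def)

end

lemma psum_upd:
  "psum q (\<mu>(i := a)) = psum q \<mu> + (if i < q then a - \<mu> i else 0)"
proof (cases "i < q")
  case True
  then show ?thesis using sum_fun_upd[of i q "\<lambda>x. x" \<mu> a] sum_fun_upd[of i q "\<lambda>x. x" \<mu> "\<mu> i"]
    by (simp add: psum_def)
next
  case False
  then show ?thesis unfolding psum_def by (auto intro!: sum.cong)
qed

text \<open>Adding a positive root whose first nonzero entry is at \<open>i\<close> raises
  \<open>psum (Suc i)\<close>, so \<open>f\<close> vanishes on all strings above \<mu>.\<close>

lemma freudenthal_at_dominating:
  assumes "\<And>\<nu> q. f \<nu> \<noteq> 0 \<Longrightarrow> q \<le> n \<Longrightarrow> psum q \<nu> \<le> psum q \<mu>"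
  shows "freudenthal n H f \<mu> = real_of_int (qform n \<mu>) * f \<mu>"
proof -
  have z: "f \<nu> = 0" if "psum q \<mu> < psum q \<nu>" "q \<le> n" for \<nu> q
    using assms[of \<nu> q] that by force
  show ?thesis
  proof (rule freudenthal_extremal)
    fix i j h assume ij: "i < j" "j < n" "(0::int) < h"
    then have "psum (Suc i) \<mu> < psum (Suc i) (\<mu>(i := \<mu> i + h, j := \<mu> j - h))"
      and "psum (Suc i) \<mu> < psum (Suc i) (\<mu>(i := \<mu> i + h, j := \<mu> j + h))"
      by (auto simp: psum_upd)
    then show "f (\<mu>(i := \<mu> i + h, j := \<mu> j - h)) = 0" "f (\<mu>(i := \<mu> i + h, j := \<mu> j + h)) = 0"
      using z ij by (meson Suc_leI less_trans)+
  next
    fix i h assume ij: "i < n" "(0::int) < h"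
    then have "psum (Suc i) \<mu> < psum (Suc i) (\<mu>(i := \<mu> i + h))" by (simp add: psum_upd)
    then show "f (\<mu>(i := \<mu> i + h)) = 0" using z ij by (meson Suc_leI)
  qed
qed

theorem (in sp_hw) mult_eq_mult_formula:
  assumes p: "1 \<le> p" "p \<le> n" and hw_eq: "hw = (\<lambda>i. int k * omega 1 i + omega p i)"
  shows "real_mult \<mu> = mult_formula n p (int k + int p) \<mu>"
proof (rule ccontr)
  assume ne: "real_mult \<mu> \<noteq> mult_formula n p (int k + int p) \<mu>"
  define K where "K = int k + int p"
  define D where "D \<mu> = real_mult \<mu> - mult_formula n p K \<mu>" for \<mu>
  note dominated = mult_formula_dominated[OF p hw_eq, folded K_def]
  have K: "K \<le> int (nat K)" by (simp add: K_def)
  have D_cong: "D \<mu> = D \<nu>" if "agree n \<mu> \<nu>" for \<mu> \<nu>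
    using mult_cong[OF that] mult_formula_cong[OF that] by (simp add: D_def real_mult_def)
  have D_le: "psum q \<mu> \<le> psum q hw" if "D \<mu> \<noteq> 0" "q \<le> n" for \<mu> q
  proof (cases "mult \<mu> = 0")
    case True
    then have "mult_formula n p K \<mu> \<noteq> 0" using that(1) by (simp add: D_def real_mult_def)
    then show ?thesis using dominated that(2) by blast
  qed (use mult_dominated that in blast)
  have D_hw: "D hw = 0" using mult_formula_hw[OF p hw_eq] by (simp add: D_def real_mult_def mult_hw K_def)
  have bounded: "\<exists>R. \<forall>\<mu>. D \<mu> \<noteq> 0 \<longrightarrow> height n \<mu> \<le> R"
  proof -
    have "height n \<mu> \<le> (\<Sum>q\<in>{1..n}. psum q hw)" if "D \<mu> \<noteq> 0" for \<mu>
      unfolding height_psum by (intro sum_mono D_le[OF that]) simp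
    then show ?thesis by blast
  qed
  then obtain R where R: "\<And>\<mu>. D \<mu> \<noteq> 0 \<Longrightarrow> height n \<mu> \<le> R" by blast
  \<comment> \<open>A weight of maximal height in the support of \<open>D\<close> is found by
    minimising R - height, which is nonnegative there.\<close>
  obtain \<mu> where \<mu>: "D \<mu> \<noteq> 0" and min: "\<And>\<nu>. D \<nu> \<noteq> 0 \<Longrightarrow> nat (R - height n \<mu>) \<le> nat (R - height n \<nu>)"
    using ex_has_least_nat[of "\<lambda>\<mu>. D \<mu> \<noteq> 0" \<mu> "\<lambda>\<mu>. nat (R - height n \<mu>)"] ne unfolding D_def K_def by auto
  have max: "D \<nu> = 0" if "height n \<mu> < height n \<nu>" for \<nu>
    using min[of \<nu>] R[of \<nu>] R[OF \<mu>] that by fastforce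
  have dom: "\<mu> j \<le> \<mu> i" if ij: "i < j" "j < n" for i j
  proof (rule ccontr)
    assume "\<not> \<mu> j \<le> \<mu> i"
    then have "0 < (int j - int i) * (\<mu> j - \<mu> i)" using ij by simp
    moreover have "height n (\<mu>(i := \<mu> j, j := \<mu> i)) = height n \<mu> + (int j - int i) * (\<mu> j - \<mu> i)"
      using ij by (simp add: height_upd2 algebra_simps)
    ultimately have "D (\<mu>(i := \<mu> j, j := \<mu> i)) = 0" by (intro max) simp
    then show False using \<mu> ij mult_swap[of i j \<mu>] mult_formula_swap[of i n j p K \<mu>] by (simp add: D_def real_mult_def)
  qed
  have nonneg: "0 \<le> \<mu> i" if i: "i < n" for i
  proof (rule ccontr)
    assume "\<not> 0 \<le> \<mu> i"
    then have "0 < (int n - int i) * (- 2 * \<mu> i)" using i mult_pos_pos[of "int n - int i" "- 2 * \<mu> i"] by simp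
    moreover have "height n (\<mu>(i := - \<mu> i)) = height n \<mu> + (int n - int i) * (- 2 * \<mu> i)"
      using i by (simp add: height_upd algebra_simps)
    ultimately have "D (\<mu>(i := - \<mu> i)) = 0" by (intro max) simp
    then show False using \<mu> i mult_flip[of i \<mu>] mult_formula_flip[of i n p K \<mu>] by (simp add: D_def real_mult_def)
  qed
  have freudenthal_F: "\<exists>H0. \<forall>H\<ge>H0. freudenthal n H (mult_formula n p K) \<nu> = real_of_int (K * (K - 2 * int p + 2 * int n + 2)) * mult_formula n p K \<nu>"
    if "\<And>i j. i < j \<Longrightarrow> j < n \<Longrightarrow> \<nu> j \<le> \<nu> i" "\<And>i. i < n \<Longrightarrow> 0 \<le> \<nu> i" for \<nu>
  proof -
    have "freudenthal n H (mult_formula n p K) \<nu> = real_of_int (K * (K - 2 * int p + 2 * int n + 2)) * mult_formula n p K \<nu>"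
      if "H \<ge> nat (int (nat K) + wnorm n \<nu>)" for H
      by (rule freudenthal_mult_formula[OF _ _ K]) (use \<open>\<And>i j. i < j \<Longrightarrow> j < n \<Longrightarrow> \<nu> j \<le> \<nu> i\<close> \<open>\<And>i. i < n \<Longrightarrow> 0 \<le> \<nu> i\<close> that in auto)
    then show ?thesis by blast
  qed
  obtain C where C: "\<And>\<mu>. \<exists>H0. \<forall>H\<ge>H0. complex_of_real (freudenthal n H real_mult \<mu>) = C * of_real (real_mult \<mu>)"
    using freudenthal_mult by blast
  \<comment> \<open>The eigenvalue of each recursion is read off at \<open>hw\<close>, where both
    functions are 1 and no higher string term survives; so the two eigenvalues coincide and
    \<open>D\<close> satisfies the same recursion.\<close>
  have C_eq: "C = of_int (qform n hw)"
  proof -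
    obtain H where "complex_of_real (freudenthal n H real_mult hw) = C * of_real (real_mult hw)" using C by blast
    moreover have "freudenthal n H real_mult hw = real_of_int (qform n hw) * real_mult hw"
      by (rule freudenthal_at_dominating) (use mult_dominated in \<open>auto simp: real_mult_def\<close>)
    ultimately show ?thesis by (simp add: real_mult_def mult_hw)
  qed
  have c_eq: "K * (K - 2 * int p + 2 * int n + 2) = qform n hw"
  proof -
    obtain H where "freudenthal n H (mult_formula n p K) hw = real_of_int (K * (K - 2 * int p + 2 * int n + 2)) * mult_formula n p K hw"
      using freudenthal_F[of hw] hw_dominant[OF p hw_eq] by blast
    moreover have "freudenthal n H (mult_formula n p K) hw = real_of_int (qform n hw) * mult_formula n p K hw"
      by (rule freudenthal_at_dominating) (use dominated in auto)
    moreover have "mult_formula n p K hw = 1" using mult_formula_hw[OF p hw_eq] by (simp add: K_def)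
    ultimately show ?thesis by (simp only: mult_1_right of_int_eq_iff)
  qed
  obtain H1 where H1: "\<And>H. H \<ge> H1 \<Longrightarrow> complex_of_real (freudenthal n H real_mult \<mu>) = C * of_real (real_mult \<mu>)" using C by blast
  obtain H2 where H2: "\<And>H. H \<ge> H2 \<Longrightarrow> freudenthal n H (mult_formula n p K) \<mu> = real_of_int (qform n hw) * mult_formula n p K \<mu>"
    using freudenthal_F[of \<mu>] dom nonneg unfolding c_eq by blast
  define H where "H = max H1 H2"
  have "complex_of_real (freudenthal n H real_mult \<mu>) = of_real (real_of_int (qform n hw) * real_mult \<mu>)"
    using H1[of H] by (simp add: C_eq H_def)
  then have "freudenthal n H real_mult \<mu> = real_of_int (qform n hw) * real_mult \<mu>" by (rule of_real_eq_iff[THEN iffD1])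
  then have "freudenthal n H D \<mu> = real_of_int (qform n hw) * D \<mu>"
    using H2[of H] unfolding D_def[abs_def] freudenthal_diff by (simp add: H_def right_diff_distrib)
  moreover have "freudenthal n H D \<mu> = real_of_int (qform n \<mu>) * D \<mu>"
  proof (rule freudenthal_extremal; rule max)
    fix i j h assume ij: "i < j" "j < n" "(0::int) < h"
    have "0 < (int j - int i) * h" "0 < (2 * int n - int i - int j) * h" using ij by auto
    then show "height n \<mu> < height n (\<mu>(i := \<mu> i + h, j := \<mu> j - h))" "height n \<mu> < height n (\<mu>(i := \<mu> i + h, j := \<mu> j + h))"
      using ij by (simp_all add: height_upd2 algebra_simps)
  qed (simp add: height_upd)
  ultimately have "qform n \<mu> = qform n hw" using \<mu> by simp
  then have "agree n \<mu> hw"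
    using dom nonneg hw_dominant[OF p hw_eq] D_le[OF \<mu>] by (intro qform_dominated) auto
  then show False using D_cong D_hw \<mu> by simp
qed

section \<open>Matrix representations of the symplectic Lie algebra\<close>

lemma eps_bar: "a < 2 * n \<Longrightarrow> eps n (bar n a) = - eps n a"
  by (auto simp: eps_def bar_def)

lemma eps_sq: "eps n a * eps n a = 1"
  by (simp add: eps_def)

lemma bar_inj: "a < 2 * n \<Longrightarrow> b < 2 * n \<Longrightarrow> bar n a = bar n b \<longleftrightarrow> a = b"
  by (metis bar_bar)

lemma bar_swap: "a < 2 * n \<Longrightarrow> b < 2 * n \<Longrightarrow> bar n a = b \<longleftrightarrow> a = bar n b"
  by (metis bar_bar)

lemma J_entry: "x < 2 * n \<Longrightarrow> y < 2 * n \<Longrightarrow> J_mat n $$ (x, y) = (if y = bar n x then eps n x else 0)"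
  by (auto simp: J_mat_def bar_def eps_def)

text \<open>\<open>J_mat\<close> has one nonzero entry in each row and column, so an entry of the
  defining equation has only two terms; multiplying by a sign solves it for one entry of
  \<open>X\<close>.\<close>

lemma sp_iff:
  "X \<in> sp n \<longleftrightarrow> X \<in> carrier_mat (2*n) (2*n) \<and>
     (\<forall>x<2*n. \<forall>y<2*n. X $$ (x, y) = - (eps n x * eps n y * X $$ (bar n y, bar n x)))"
proof (cases "X \<in> carrier_mat (2*n) (2*n)")
  case True
  have J: "J_mat n \<in> carrier_mat (2*n) (2*n)" by (simp add: J_mat_def)
  have e: "(transpose_mat X * J_mat n + J_mat n * X) $$ (x, y)
      = - eps n y * X $$ (bar n y, x) + eps n x * X $$ (bar n x, y)" if "x < 2 * n" "y < 2 * n" for x y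
  proof -
    have "(transpose_mat X * J_mat n) $$ (x, y) = (\<Sum>z<2*n. X $$ (z, x) * J_mat n $$ (z, y))"
      using True J that by (simp add: scalar_prod_def lessThan_atLeast0)
    also have "\<dots> = (\<Sum>z<2*n. if z = bar n y then - eps n y * X $$ (z, x) else 0)"
      using that by (intro sum.cong refl) (auto simp: J_entry bar_bar eps_bar)
    also have "\<dots> = - eps n y * X $$ (bar n y, x)" using that bar_less by simp
    finally have 1: "(transpose_mat X * J_mat n) $$ (x, y) = - eps n y * X $$ (bar n y, x)" .
    have "(J_mat n * X) $$ (x, y) = (\<Sum>z<2*n. J_mat n $$ (x, z) * X $$ (z, y))"
      using True J that by (simp add: scalar_prod_def lessThan_atLeast0)
    also have "\<dots> = (\<Sum>z<2*n. if z = bar n x then eps n x * X $$ (z, y) else 0)"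
      using that by (intro sum.cong refl) (auto simp: J_entry)
    also have "\<dots> = eps n x * X $$ (bar n x, y)" using that bar_less by simp
    finally show ?thesis using True J that 1 by simp
  qed
  have "X \<in> sp n \<longleftrightarrow> (\<forall>x<2*n. \<forall>y<2*n. (transpose_mat X * J_mat n + J_mat n * X) $$ (x, y) = 0)"
  proof
    assume "X \<in> sp n"
    then have z: "transpose_mat X * J_mat n + J_mat n * X = 0\<^sub>m (2*n) (2*n)" by (simp add: sp_def)
    show "\<forall>x<2*n. \<forall>y<2*n. (transpose_mat X * J_mat n + J_mat n * X) $$ (x, y) = 0"
      by (intro allI impI) (simp only: z index_zero_mat(1))
  next
    assume "\<forall>x<2*n. \<forall>y<2*n. (transpose_mat X * J_mat n + J_mat n * X) $$ (x, y) = 0"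
    then have "transpose_mat X * J_mat n + J_mat n * X = 0\<^sub>m (2*n) (2*n)"
      using True J by (intro eq_matI) (simp_all only: index_zero_mat, auto)
    then show "X \<in> sp n" using True by (simp add: sp_def)
  qed
  also have "\<dots> \<longleftrightarrow> (\<forall>x<2*n. \<forall>y<2*n. X $$ (x, y) = - (eps n x * eps n y * X $$ (bar n y, bar n x)))"
  proof
    assume a: "\<forall>x<2*n. \<forall>y<2*n. (transpose_mat X * J_mat n + J_mat n * X) $$ (x, y) = 0"
    show "\<forall>x<2*n. \<forall>y<2*n. X $$ (x, y) = - (eps n x * eps n y * X $$ (bar n y, bar n x))"
    proof (intro allI impI)
      fix x y assume xy: "x < 2 * n" "y < 2 * n"
      then have "- eps n y * X $$ (bar n y, bar n x) + (- eps n x) * X $$ (x, y) = 0"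
        using a e[of "bar n x" y] bar_less by (simp add: bar_bar eps_bar)
      then have "(- eps n x) * X $$ (x, y) = - (- eps n y * X $$ (bar n y, bar n x))"
        by (simp only: add_eq_0_iff)
      then have "eps n x * X $$ (x, y) = - eps n y * X $$ (bar n y, bar n x)"
        by (metis minus_minus mult_minus_left)
      then have "eps n x * (eps n x * X $$ (x, y)) = eps n x * (- eps n y * X $$ (bar n y, bar n x))" by simp
      then show "X $$ (x, y) = - (eps n x * eps n y * X $$ (bar n y, bar n x))"
        by (simp add: mult.assoc[symmetric] eps_sq)
    qed
  next
    assume a: "\<forall>x<2*n. \<forall>y<2*n. X $$ (x, y) = - (eps n x * eps n y * X $$ (bar n y, bar n x))"
    show "\<forall>x<2*n. \<forall>y<2*n. (transpose_mat X * J_mat n + J_mat n * X) $$ (x, y) = 0"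
    proof (intro allI impI)
      fix x y assume xy: "x < 2 * n" "y < 2 * n"
      have "X $$ (bar n x, y) = - (eps n (bar n x) * eps n y * X $$ (bar n y, bar n (bar n x)))"
        using a xy bar_less by blast
      then have "eps n x * X $$ (bar n x, y) = (eps n x * eps n x) * eps n y * X $$ (bar n y, x)"
        using xy by (simp add: bar_bar eps_bar)
      then show "(transpose_mat X * J_mat n + J_mat n * X) $$ (x, y) = 0"
        unfolding e[OF xy] by (simp add: eps_sq)
    qed
  qed
  finally show ?thesis using True by simp
qed (simp add: sp_def)

section \<open>Root vectors as matrices and their commutators\<close>

definition Fe :: "nat \<Rightarrow> nat \<Rightarrow> nat \<Rightarrow> nat \<Rightarrow> nat \<Rightarrow> complex" where
  "Fe n a b x y = of_bool (x = a) * of_bool (y = b) - eps n a * eps n b * (of_bool (x = bar n b) * of_bool (y = bar n a))"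

text \<open>A matrix unit made antisymmetric under the symplectic adjoint, hence an element of
  \<open>sp n\<close>.\<close>

definition Fmat :: "nat \<Rightarrow> nat \<Rightarrow> nat \<Rightarrow> complex mat" where
  "Fmat n a b = mat (2*n) (2*n) (\<lambda>(x, y). Fe n a b x y)"

lemma Fmat_carrier[simp]: "Fmat n a b \<in> carrier_mat (2*n) (2*n)"
  by (simp add: Fmat_def)

lemma Fmat_entry: "x < 2 * n \<Longrightarrow> y < 2 * n \<Longrightarrow> Fmat n a b $$ (x, y) = Fe n a b x y"
  by (simp add: Fmat_def)

lemma Fe_sym:
  assumes "a < 2 * n" "b < 2 * n"
  shows "Fe n a b x y = - (eps n a * eps n b) * Fe n (bar n b) (bar n a) x y"
proof -
  have "(eps n a * eps n b) * (eps n b * eps n a) = (eps n a * eps n a) * (eps n b * eps n b :: complex)"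
    by (simp only: mult_ac)
  then have "(eps n a * eps n b) * (eps n b * eps n a) = (1 :: complex)" by (simp add: eps_sq)
  then show ?thesis
    using assms by (simp add: Fe_def eps_bar bar_bar algebra_simps)
qed

lemma Fmat_sp:
  assumes "a < 2 * n" "b < 2 * n"
  shows "Fmat n a b \<in> sp n"
  unfolding sp_iff
proof (intro conjI allI impI)
  fix x y assume xy: "x < 2 * n" "y < 2 * n"
  have e: "eps n x * eps n y * (eps n a * eps n b) * (of_bool (bar n y = bar n b) * of_bool (bar n x = bar n a))
      = (of_bool (x = a) * of_bool (y = b) :: complex)"
  proof (cases "x = a \<and> y = b")
    case True
    have "eps n a * eps n b * (eps n a * eps n b) = (eps n a * eps n a) * (eps n b * eps n b :: complex)"
      by (simp only: mult_ac)
    then show ?thesis using True by (simp add: eps_sq)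
  qed (use bar_inj assms xy in auto)
  have e2: "eps n x * eps n y * (of_bool (bar n y = a) * of_bool (bar n x = b))
      = eps n a * eps n b * (of_bool (x = bar n b) * of_bool (y = bar n a) :: complex)"
    using assms xy by (auto simp: bar_swap eps_bar bar_bar)
  have "eps n x * eps n y * Fe n a b (bar n y) (bar n x)
     = eps n x * eps n y * (of_bool (bar n y = a) * of_bool (bar n x = b))
       - eps n x * eps n y * (eps n a * eps n b) * (of_bool (bar n y = bar n b) * of_bool (bar n x = bar n a))"
    by (simp add: Fe_def algebra_simps)
  also have "\<dots> = - Fe n a b x y" unfolding e e2 by (simp add: Fe_def)
  finally show "Fmat n a b $$ (x, y) = - (eps n x * eps n y * Fmat n a b $$ (bar n y, bar n x))"
    using xy bar_less by (simp add: Fmat_entry)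
qed simp

lemma Fe_product:
  assumes "a < 2 * n" "b < 2 * n"
  shows "(\<Sum>z<2*n. Fe n a b x z * g z) = of_bool (x = a) * g b - eps n a * eps n b * (of_bool (x = bar n b) * g (bar n a))"
proof -
  have "(\<Sum>z<2*n. Fe n a b x z * g z)
      = (\<Sum>z<2*n. (if z = b then of_bool (x = a) * g z else 0) - (if z = bar n a then eps n a * eps n b * (of_bool (x = bar n b) * g z) else 0))"
    by (intro sum.cong refl) (simp add: Fe_def algebra_simps)
  then show ?thesis using assms bar_less by (simp add: sum_subtractf)
qed

lemma Fe_commutator:
  assumes l: "a < 2 * n" "b < 2 * n" "c < 2 * n" "e < 2 * n"
  shows "(\<Sum>z<2*n. Fe n a b x z * Fe n c e z y) - (\<Sum>z<2*n. Fe n c e x z * Fe n a b z y)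
    = of_bool (b = c) * Fe n a e x y - of_bool (a = e) * Fe n c b x y
      - eps n a * eps n b * (of_bool (bar n a = c) * Fe n (bar n b) e x y - of_bool (bar n b = e) * Fe n c (bar n a) x y)"
proof -
  define sa sb sc se :: complex where "sa = eps n a" and "sb = eps n b" and "sc = eps n c" and "se = eps n e"
  have sq: "sa * sa = 1" "sb * sb = 1" by (simp_all add: sa_def sb_def eps_sq)
  \<comment> \<open>In \<open>k1\<close> to \<open>k4\<close> a Kronecker delta ties two indices, so
    that the product of four signs collapses to the sign of the surviving root vector.\<close>
  have k1: "of_bool (bar n c = bar n b) * (sc * se * (sa * sb)) = of_bool (b = c) * (sa * se)"
  proof (cases "b = c")
    case True
    then have "sc = sb" by (simp add: sb_def sc_def)
    then have "sc * se * (sa * sb) = (sb * sb) * (sa * se)" by (simp only: mult_ac)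
    then show ?thesis using True by (simp add: sq)
  qed (use bar_inj l in auto)
  have k2: "of_bool (bar n a = bar n e) * (sa * sb * (sc * se)) = of_bool (a = e) * (sc * sb)"
  proof (cases "a = e")
    case True
    then have "se = sa" by (simp add: sa_def se_def)
    then have "sa * sb * (sc * se) = (sa * sa) * (sc * sb)" by (simp only: mult_ac)
    then show ?thesis using True by (simp add: sq)
  qed (use bar_inj l in auto)
  have k3: "of_bool (bar n c = a) * (sc * se) = sa * sb * of_bool (bar n a = c) * (- sb * se)"
  proof (cases "bar n a = c")
    case True
    then have "sc = - sa" "bar n c = a" using l by (auto simp: sa_def sc_def eps_bar bar_bar)
    moreover have "sa * sb * (- sb * se) = - (sb * sb) * (sa * se)" by (simp only: mult_ac mult_minus_left mult_minus_right)
    ultimately show ?thesis using True by (simp add: sq)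
  qed (use bar_swap l in auto)
  have k4: "of_bool (b = bar n e) * (sc * se) = sa * sb * of_bool (bar n b = e) * (sc * - sa)"
  proof (cases "bar n b = e")
    case True
    then have "se = - sb" "b = bar n e" using l by (auto simp: sb_def se_def eps_bar bar_bar)
    moreover have "sa * sb * (sc * - sa) = - (sa * sa) * (sc * sb)" by (simp only: mult_ac mult_minus_left mult_minus_right)
    ultimately show ?thesis using True by (simp add: sq)
  qed (use bar_swap l in auto)
  let ?d = "\<lambda>x y. of_bool (x = y) :: complex"
  have bars: "bar n (bar n a) = a" "bar n (bar n b) = b" "eps n (bar n a) = - sa" "eps n (bar n b) = - sb"
    using l by (simp_all add: bar_bar eps_bar sa_def sb_def)
  have "(\<Sum>z<2*n. Fe n a b x z * Fe n c e z y) - (\<Sum>z<2*n. Fe n c e x z * Fe n a b z y)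
    = ?d x a * ?d y e * ?d b c - ?d x a * ?d y (bar n c) * (?d b (bar n e) * (sc * se))
      - sa * sb * (?d x (bar n b) * ?d y e * ?d (bar n a) c) + ?d x (bar n b) * ?d y (bar n c) * (?d (bar n a) (bar n e) * (sa * sb * (sc * se)))
      - (?d x c * ?d y b * ?d e a - sa * sb * (?d x c * ?d y (bar n a) * ?d e (bar n b))
      - ?d x (bar n e) * ?d y b * (?d (bar n c) a * (sc * se)) + ?d x (bar n e) * ?d y (bar n a) * (?d (bar n c) (bar n b) * (sc * se * (sa * sb))))"
    unfolding Fe_product[OF l(1,2)] Fe_product[OF l(3,4)]
    by (simp add: Fe_def sa_def[symmetric] sb_def[symmetric] sc_def[symmetric] se_def[symmetric] algebra_simps)
  also have "\<dots> = ?d b c * (?d x a * ?d y e - sa * se * (?d x (bar n e) * ?d y (bar n a)))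
      - ?d a e * (?d x c * ?d y b - sc * sb * (?d x (bar n b) * ?d y (bar n c)))
      - sa * sb * (?d (bar n a) c * (?d x (bar n b) * ?d y e - (- sb * se) * (?d x (bar n e) * ?d y b))
         - ?d (bar n b) e * (?d x c * ?d y (bar n a) - (sc * - sa) * (?d x a * ?d y (bar n c))))"
    unfolding k1 k2 k3 k4 by (simp only: eq_commute[of e]) (simp add: algebra_simps)
  also have "\<dots> = of_bool (b = c) * Fe n a e x y - of_bool (a = e) * Fe n c b x y
      - eps n a * eps n b * (of_bool (bar n a = c) * Fe n (bar n b) e x y - of_bool (bar n b = e) * Fe n c (bar n a) x y)"
    unfolding Fe_def bars sa_def[symmetric] sb_def[symmetric] sc_def[symmetric] se_def[symmetric] ..
  finally show ?thesis .
qed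

text \<open>The nested two-term combinations match the shape in which \<open>is_rep\<close> states
  linearity, so that the representation can be applied term by term. The zero summand in
  \<open>Fmat_sym\<close> serves the same purpose.\<close>

lemma Fmat_commutator:
  assumes l: "a < 2 * n" "b < 2 * n" "c < 2 * n" "e < 2 * n"
  shows "Fmat n a b * Fmat n c e - Fmat n c e * Fmat n a b
    = 1 \<cdot>\<^sub>m (of_bool (b = c) \<cdot>\<^sub>m Fmat n a e + (- of_bool (a = e)) \<cdot>\<^sub>m Fmat n c b)
      + (- eps n a * eps n b) \<cdot>\<^sub>m (of_bool (bar n a = c) \<cdot>\<^sub>m Fmat n (bar n b) e + (- of_bool (bar n b = e)) \<cdot>\<^sub>m Fmat n c (bar n a))"
    (is "?L = ?R")
proof (rule eq_matI)
  fix x y assume "x < dim_row ?R" "y < dim_col ?R"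
  then have xy: "x < 2 * n" "y < 2 * n" by (simp_all add: Fmat_def)
  have prod: "(Fmat n a b * Fmat n c e) $$ (x, y) = (\<Sum>z<2*n. Fe n a b x z * Fe n c e z y)" for a b c e
  proof -
    have "(Fmat n a b * Fmat n c e) $$ (x, y) = (\<Sum>z<2*n. Fmat n a b $$ (x, z) * Fmat n c e $$ (z, y))"
      using xy by (simp add: Fmat_def scalar_prod_def lessThan_atLeast0)
    then show ?thesis using xy by (simp add: Fmat_entry)
  qed
  have "?L $$ (x, y) = (Fmat n a b * Fmat n c e) $$ (x, y) - (Fmat n c e * Fmat n a b) $$ (x, y)"
    using xy by (simp add: Fmat_def)
  moreover have "?R $$ (x, y) = of_bool (b = c) * Fe n a e x y - of_bool (a = e) * Fe n c b x y
      - eps n a * eps n b * (of_bool (bar n a = c) * Fe n (bar n b) e x y - of_bool (bar n b = e) * Fe n c (bar n a) x y)"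
    using xy by (simp add: Fmat_def algebra_simps)
  ultimately show "?L $$ (x, y) = ?R $$ (x, y)"
    unfolding prod using Fe_commutator[OF l, of x y] by simp
qed (simp_all add: Fmat_def)

lemma Fmat_sym:
  assumes "a < 2 * n" "b < 2 * n"
  shows "Fmat n a b = (- (eps n a * eps n b)) \<cdot>\<^sub>m Fmat n (bar n b) (bar n a) + 0 \<cdot>\<^sub>m Fmat n (bar n b) (bar n a)"
  using Fe_sym[OF assms] by (intro eq_matI) (simp_all add: Fmat_def)

section \<open>Matrices as operators on functions\<close>

definition csc :: "complex \<Rightarrow> (nat \<Rightarrow> complex) \<Rightarrow> nat \<Rightarrow> complex" where
  "csc c u = (\<lambda>i. c * u i)"

interpretation cv: vector_space csc
  by unfold_locales (auto simp: csc_def fun_eq_iff algebra_simps)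

text \<open>The abstract module theory lives on a whole type, so vectors of dimension
  \<open>d\<close> are modelled by functions that vanish from \<open>d\<close> on;
  \<open>vfun\<close> and \<open>vec d\<close> translate between the two.\<close>

definition oper :: "nat \<Rightarrow> complex mat \<Rightarrow> (nat \<Rightarrow> complex) \<Rightarrow> nat \<Rightarrow> complex" where
  "oper d A u = (\<lambda>i. if i < d then \<Sum>j<d. A $$ (i, j) * u j else 0)"

definition vfun :: "complex vec \<Rightarrow> nat \<Rightarrow> complex" where
  "vfun w = (\<lambda>i. if i < dim_vec w then vec_index w i else 0)"

lemma vec_vfun: "w \<in> carrier_vec d \<Longrightarrow> vec d (vfun w) = w"
  by (auto simp: vfun_def)

lemma vfun_vec: "(\<And>i. i \<ge> d \<Longrightarrow> u i = 0) \<Longrightarrow> vfun (vec d u) = u"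
  by (auto simp: vfun_def fun_eq_iff)

lemma oper_support: "i \<ge> d \<Longrightarrow> oper d A u i = 0"
  by (simp add: oper_def)

lemma oper_linear: "Vector_Spaces.linear csc csc (oper d A)"
  unfolding Vector_Spaces.linear_iff
  by (auto simp: vector_space_def oper_def csc_def fun_eq_iff algebra_simps sum.distrib sum_distrib_left cv.vector_space_axioms)

lemma oper_mult:
  assumes "A \<in> carrier_mat d d" "A' \<in> carrier_mat d d"
  shows "oper d (A * A') u = oper d A (oper d A' u)"
proof
  fix i show "oper d (A * A') u i = oper d A (oper d A' u) i"
  proof (cases "i < d")
    case True
    have "oper d (A * A') u i = (\<Sum>j<d. (\<Sum>k<d. A $$ (i, k) * A' $$ (k, j)) * u j)"
      using assms True by (simp add: oper_def scalar_prod_def lessThan_atLeast0)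
    also have "\<dots> = (\<Sum>k<d. A $$ (i, k) * (\<Sum>j<d. A' $$ (k, j) * u j))"
      unfolding sum_distrib_left sum_distrib_right by (subst sum.swap) (simp add: mult.assoc)
    finally show ?thesis using True by (simp add: oper_def)
  qed (simp add: oper_def)
qed

lemma oper_comb:
  assumes "A \<in> carrier_mat d d" "A' \<in> carrier_mat d d"
  shows "oper d (a \<cdot>\<^sub>m A + b \<cdot>\<^sub>m A') u = csc a (oper d A u) + csc b (oper d A' u)"
  using assms by (auto simp: oper_def csc_def fun_eq_iff algebra_simps sum.distrib sum_distrib_left)

lemma oper_diff:
  assumes "A \<in> carrier_mat d d" "A' \<in> carrier_mat d d"
  shows "oper d (A - A') u = oper d A u - oper d A' u"
  using assms by (auto simp: oper_def fun_eq_iff algebra_simps sum_subtractf)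

lemma mult_vec_oper:
  assumes "A \<in> carrier_mat d d" "w \<in> carrier_vec d"
  shows "A *\<^sub>v w = vec d (oper d A (vfun w))"
  using assms by (intro eq_vecI) (auto simp: oper_def vfun_def scalar_prod_def lessThan_atLeast0)

lemma sp_comb:
  assumes "X \<in> sp n" "Y \<in> sp n"
  shows "a \<cdot>\<^sub>m X + b \<cdot>\<^sub>m Y \<in> sp n"
proof -
  have c: "X \<in> carrier_mat (2*n) (2*n)" "Y \<in> carrier_mat (2*n) (2*n)" using assms by (auto simp: sp_def)
  show ?thesis unfolding sp_iff
  proof (intro conjI allI impI)
    show "a \<cdot>\<^sub>m X + b \<cdot>\<^sub>m Y \<in> carrier_mat (2*n) (2*n)" using c by simp
    fix x y assume xy: "x < 2 * n" "y < 2 * n"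
    then have "X $$ (x, y) = - (eps n x * eps n y * X $$ (bar n y, bar n x))"
      "Y $$ (x, y) = - (eps n x * eps n y * Y $$ (bar n y, bar n x))"
      using assms unfolding sp_iff by blast+
    then show "(a \<cdot>\<^sub>m X + b \<cdot>\<^sub>m Y) $$ (x, y) = - (eps n x * eps n y * (a \<cdot>\<^sub>m X + b \<cdot>\<^sub>m Y) $$ (bar n y, bar n x))"
      using c xy bar_less by (simp add: algebra_simps)
  qed
qed

text \<open>\<open>X\<close> is the sum of X_ab / 2 times \<open>Fmat n a b\<close> over all index
  pairs: by \<open>sp_iff\<close> each entry is produced twice. Anything closed under two-term
  combinations that holds for these generators therefore holds on \<open>sp n\<close>.\<close>

lemma sp_spanned:
  assumes G: "\<And>a b. a < 2 * n \<Longrightarrow> b < 2 * n \<Longrightarrow> Fmat n a b \<in> G"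
    and comb: "\<And>X Y c e. X \<in> G \<Longrightarrow> Y \<in> G \<Longrightarrow> c \<cdot>\<^sub>m X + e \<cdot>\<^sub>m Y \<in> G"
    and zero: "0\<^sub>m (2*n) (2*n) \<in> G" and X: "X \<in> sp n"
  shows "X \<in> G"
proof -
  have fin: "finite S \<Longrightarrow> S \<subseteq> {..<2*n} \<times> {..<2*n} \<Longrightarrow>
    mat (2*n) (2*n) (\<lambda>(x, y). \<Sum>(a, b)\<in>S. X $$ (a, b) / 2 * Fe n a b x y) \<in> G" for S
  proof (induction S rule: finite_induct)
    case empty
    have "mat (2*n) (2*n) (\<lambda>(x, y). \<Sum>(a, b)\<in>{}. X $$ (a, b) / 2 * Fe n a b x y) = 0\<^sub>m (2*n) (2*n)"
      by (intro eq_matI) auto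
    then show ?case using zero by (simp only:)
  next
    case (insert ab S)
    obtain a b where ab: "ab = (a, b)" by (cases ab)
    have "mat (2*n) (2*n) (\<lambda>(x, y). \<Sum>(a, b)\<in>insert ab S. X $$ (a, b) / 2 * Fe n a b x y)
      = (X $$ (a, b) / 2) \<cdot>\<^sub>m Fmat n a b + 1 \<cdot>\<^sub>m mat (2*n) (2*n) (\<lambda>(x, y). \<Sum>(a, b)\<in>S. X $$ (a, b) / 2 * Fe n a b x y)"
      using insert(1,2) by (intro eq_matI) (auto simp: ab Fmat_def)
    moreover have "Fmat n a b \<in> G" using G insert(4) ab by auto
    ultimately show ?case using comb insert by simp
  qed
  have "mat (2*n) (2*n) (\<lambda>(x, y). \<Sum>(a, b)\<in>{..<2*n} \<times> {..<2*n}. X $$ (a, b) / 2 * Fe n a b x y) = X"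
  proof (intro eq_matI)
    have c: "X \<in> carrier_mat (2*n) (2*n)" using X by (simp add: sp_def)
    fix x y assume "x < dim_row X" "y < dim_col X"
    then have xy: "x < 2 * n" "y < 2 * n" using c by auto
    have "(\<Sum>(a, b)\<in>{..<2*n} \<times> {..<2*n}. X $$ (a, b) / 2 * Fe n a b x y)
      = (\<Sum>a<2*n. \<Sum>b<2*n. X $$ (a, b) / 2 * Fe n a b x y)"
      by (simp add: sum.cartesian_product)
    also have "\<dots> = (\<Sum>a<2*n. \<Sum>b<2*n. (if b = y then if a = x then X $$ (a, b) / 2 else 0 else 0)
        - (if b = bar n x then if a = bar n y then X $$ (a, b) / 2 * (eps n a * eps n b) else 0 else 0))"
      using xy by (intro sum.cong refl) (auto simp: Fe_def bar_swap bar_bar right_diff_distrib)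
    also have "\<dots> = (\<Sum>a<2*n. (if a = x then X $$ (a, y) / 2 else 0) - (if a = bar n y then X $$ (a, bar n x) / 2 * (eps n a * eps n (bar n x)) else 0))"
      using xy bar_less by (intro sum.cong refl) (simp add: sum_subtractf)
    also have "\<dots> = X $$ (x, y) / 2 - X $$ (bar n y, bar n x) / 2 * (eps n (bar n y) * eps n (bar n x))"
      using xy bar_less by (simp add: sum_subtractf)
    also have "\<dots> = X $$ (x, y)"
    proof -
      have "X $$ (x, y) = - (eps n x * eps n y * X $$ (bar n y, bar n x))"
        using X xy unfolding sp_iff by blast
      then show ?thesis using xy by (simp add: eps_bar field_simps)
    qed
    finally show "mat (2*n) (2*n) (\<lambda>(x, y). \<Sum>(a, b)\<in>{..<2*n} \<times> {..<2*n}. X $$ (a, b) / 2 * Fe n a b x y) $$ (x, y) = X $$ (x, y)"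
      using xy by simp
  qed (use X in \<open>auto simp: sp_def\<close>)
  then show ?thesis using fin[of "{..<2*n} \<times> {..<2*n}"] by simp
qed

section \<open>Cartan elements and root spaces\<close>

lemma cartan_entry: "x < 2 * n \<Longrightarrow> y < 2 * n \<Longrightarrow> cartan n \<theta> $$ (x, y) = (if x = y then if x < n then \<theta> x else - \<theta> (x - n) else 0)"
  by (simp add: cartan_def)

lemma cartan_unit: "i < n \<Longrightarrow> cartan n (\<lambda>j. of_bool (j = i)) = Fmat n i i"
  by (intro eq_matI) (auto simp: cartan_def Fmat_def Fe_def eps_sq bar_def)

lemma cartan_sp: "cartan n \<theta> \<in> sp n"
  unfolding sp_iff
proof (intro conjI allI impI)
  fix x y assume xy: "x < 2 * n" "y < 2 * n"
  show "cartan n \<theta> $$ (x, y) = - (eps n x * eps n y * cartan n \<theta> $$ (bar n y, bar n x))"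
    using xy bar_less by (auto simp: cartan_entry bar_inj) (auto simp: bar_def eps_def)
qed (simp add: cartan_def)

definition wsig :: "nat \<Rightarrow> (nat \<Rightarrow> complex) \<Rightarrow> nat \<Rightarrow> complex" where
  "wsig n \<theta> a = (if a < n then \<theta> a else - \<theta> (a - n))"

lemma wt_eval_root_fun:
  assumes "a < 2 * n" "b < 2 * n" "agree n \<alpha> (root_fun n a b)"
  shows "wt_eval n \<alpha> \<theta> = wsig n \<theta> a - wsig n \<theta> b"
proof -
  have c: "(\<Sum>i<n. of_int (coord_wt n a i) * \<theta> i) = wsig n \<theta> a" if "a < 2 * n" for a
  proof (cases "a < n")
    case True
    have "(\<Sum>i<n. of_int (coord_wt n a i) * \<theta> i) = (\<Sum>i<n. if i = a then \<theta> i else 0)"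
      using True by (intro sum.cong refl) (auto simp: coord_wt_def)
    then show ?thesis using True by (simp add: wsig_def)
  next
    case False
    have "(\<Sum>i<n. of_int (coord_wt n a i) * \<theta> i) = (\<Sum>i<n. if i = a - n then - \<theta> i else 0)"
      using False by (intro sum.cong refl) (auto simp: coord_wt_def)
    also have "\<dots> = - \<theta> (a - n)" using False that by (subst sum.delta) auto
    finally show ?thesis using False by (simp add: wsig_def)
  qed
  have "wt_eval n \<alpha> \<theta> = (\<Sum>i<n. of_int (coord_wt n a i) * \<theta> i - of_int (coord_wt n b i) * \<theta> i)"
    unfolding wt_eval_def
  proof (rule sum.cong[OF refl])
    fix i assume "i \<in> {..<n}"
    then have "\<alpha> i = coord_wt n a i - coord_wt n b i" using assms(3) by (simp add: agree_def root_fun_def)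
    then show "of_int (\<alpha> i) * \<theta> i = of_int (coord_wt n a i) * \<theta> i - of_int (coord_wt n b i) * \<theta> i"
      by (simp only: of_int_diff left_diff_distrib)
  qed
  then show ?thesis using c assms by (simp add: sum_subtractf)
qed

lemma Fmat_root_space:
  assumes "a < 2 * n" "b < 2 * n" "agree n \<alpha> (root_fun n a b)"
  shows "Fmat n a b \<in> root_space n \<alpha>"
proof -
  have "cartan n \<theta> * Fmat n a b - Fmat n a b * cartan n \<theta> = wt_eval n \<alpha> \<theta> \<cdot>\<^sub>m Fmat n a b" for \<theta>
  proof (rule eq_matI)
    fix x y assume "x < dim_row (wt_eval n \<alpha> \<theta> \<cdot>\<^sub>m Fmat n a b)" "y < dim_col (wt_eval n \<alpha> \<theta> \<cdot>\<^sub>m Fmat n a b)"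
    then have xy: "x < 2 * n" "y < 2 * n" by (simp_all add: Fmat_def)
    have c: "cartan n \<theta> \<in> carrier_mat (2*n) (2*n)" by (simp add: cartan_def)
    have ce: "cartan n \<theta> $$ (x, y) = (if x = y then wsig n \<theta> x else 0)" if "x < 2 * n" "y < 2 * n" for x y
      using that by (simp add: cartan_entry wsig_def)
    have "(cartan n \<theta> * Fmat n a b) $$ (x, y) = (\<Sum>z<2*n. cartan n \<theta> $$ (x, z) * Fe n a b z y)"
      using c xy by (simp add: Fmat_def scalar_prod_def lessThan_atLeast0)
    also have "\<dots> = (\<Sum>z<2*n. if z = x then wsig n \<theta> x * Fe n a b z y else 0)"
      using xy by (intro sum.cong refl) (auto simp: ce)
    finally have 1: "(cartan n \<theta> * Fmat n a b) $$ (x, y) = wsig n \<theta> x * Fe n a b x y" using xy by simp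
    have "(Fmat n a b * cartan n \<theta>) $$ (x, y) = (\<Sum>z<2*n. Fe n a b x z * cartan n \<theta> $$ (z, y))"
      using c xy by (simp add: Fmat_def scalar_prod_def lessThan_atLeast0)
    also have "\<dots> = (\<Sum>z<2*n. if z = y then Fe n a b x z * wsig n \<theta> y else 0)"
      using xy by (intro sum.cong refl) (auto simp: ce)
    finally have 2: "(Fmat n a b * cartan n \<theta>) $$ (x, y) = Fe n a b x y * wsig n \<theta> y" using xy by simp
    have bar: "wsig n \<theta> (bar n a) = - wsig n \<theta> a" if "a < 2 * n" for a
      using that by (auto simp: wsig_def bar_def)
    \<comment> \<open>The commutator with a diagonal matrix scales entry (x, y) by a difference of
      weights, and this difference is the same at both possible nonzero entries of
      \<open>Fe\<close>.\<close>
    have 3: "(wsig n \<theta> x - wsig n \<theta> y) * Fe n a b x y = (wsig n \<theta> a - wsig n \<theta> b) * Fe n a b x y"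
    proof (cases "(x = a \<and> y = b) \<or> (x = bar n b \<and> y = bar n a)")
      case False
      then have "Fe n a b x y = 0" by (auto simp: Fe_def)
      then show ?thesis by simp
    qed (use assms bar in auto)
    have 4: "(cartan n \<theta> * Fmat n a b - Fmat n a b * cartan n \<theta>) $$ (x, y)
        = (cartan n \<theta> * Fmat n a b) $$ (x, y) - (Fmat n a b * cartan n \<theta>) $$ (x, y)"
      using xy c by (simp add: Fmat_def)
    have 5: "(wt_eval n \<alpha> \<theta> \<cdot>\<^sub>m Fmat n a b) $$ (x, y) = (wsig n \<theta> a - wsig n \<theta> b) * Fe n a b x y"
      using xy wt_eval_root_fun[OF assms, of \<theta>] by (simp add: Fmat_def)
    show "(cartan n \<theta> * Fmat n a b - Fmat n a b * cartan n \<theta>) $$ (x, y) = (wt_eval n \<alpha> \<theta> \<cdot>\<^sub>m Fmat n a b) $$ (x, y)"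
      unfolding 4 5 1 2 3[symmetric] by (simp add: algebra_simps)
  qed (simp_all add: Fmat_def cartan_def)
  then show ?thesis using Fmat_sp[OF assms(1,2)] by (simp add: root_space_def)
qed

text \<open>\<open>hpos\<close> orders the indices as 0, ..., n - 1, 2n - 1, ..., n, that is by
  decreasing coordinate weight. The cases \<open>2\<close> and \<open>3\<close> give sums of two
  coordinates and have to be matched with the smaller index first.\<close>

lemma rt_positive:
  assumes "a < 2 * n" "b < 2 * n" "hpos n a < hpos n b"
  shows "\<exists>\<alpha>\<in>pos_roots n. agree n \<alpha> (root_fun n a b)"
proof -
  define i where "i = (if a < n then a else a - n)"
  define j where "j = (if b < n then b else b - n)"
  have ij: "i < n" "j < n" using assms by (auto simp: i_def j_def)
  consider "a = i" "b = j" "i < j" | "a = i" "b = j + n" "i < j" | "a = i" "b = j + n" "j < i" | "a = i" "b = j + n" "i = j"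
    | "a = i + n" "b = j + n" "j < i"
    using assms unfolding hpos_def i_def j_def by (auto split: if_splits) linarith+
  then show ?thesis
  proof cases
    case 1
    then show ?thesis using ij
      by (intro bexI[of _ "\<lambda>l. (if l = i then 1 else 0) - (if l = j then 1 else 0)"])
        (auto simp: agree_def root_fun_def coord_wt_def pos_roots_def)
  next
    case 2
    then show ?thesis using ij
      by (intro bexI[of _ "\<lambda>l. (if l = i then 1 else 0) + (if l = j then 1 else 0)"])
        (auto simp: agree_def root_fun_def coord_wt_def pos_roots_def)
  next
    case 3
    then show ?thesis using ij
      by (intro bexI[of _ "\<lambda>l. (if l = j then 1 else 0) + (if l = i then 1 else 0)"])
        (auto simp: agree_def root_fun_def coord_wt_def pos_roots_def)
  next
    case 4
    then show ?thesis using ij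
      by (intro bexI[of _ "\<lambda>l. if l = i then 2 else 0"])
        (auto simp: agree_def root_fun_def coord_wt_def pos_roots_def)
  next
    case 5
    then show ?thesis using ij
      by (intro bexI[of _ "\<lambda>l. (if l = j then 1 else 0) - (if l = i then 1 else 0)"])
        (auto simp: agree_def root_fun_def coord_wt_def pos_roots_def)
  qed
qed

section \<open>Linear independence of lists of vectors\<close>

definition unitf :: "nat \<Rightarrow> nat \<Rightarrow> complex" where
  "unitf i = (\<lambda>j. of_bool (j = i))"

lemma supported_span:
  assumes "\<And>i. i \<ge> d \<Longrightarrow> u i = 0"
  shows "u \<in> cv.span (unitf ` {..<d})"
proof -
  have "u = (\<Sum>i<d. csc (u i) (unitf i))"
  proof
    fix j
    have "(\<Sum>i<d. csc (u i) (unitf i)) j = (\<Sum>i<d. csc (u i) (unitf i) j)"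
      by (induction d) simp_all
    also have "\<dots> = (\<Sum>i<d. if i = j then u j else 0)"
      by (intro sum.cong refl) (auto simp: csc_def unitf_def)
    also have "\<dots> = u j" using assms[of j] by (cases "j < d") auto
    finally show "u j = (\<Sum>i<d. csc (u i) (unitf i)) j" ..
  qed
  then show ?thesis
    by (metis (no_types, lifting) cv.span_base cv.span_scale cv.span_sum imageI)
qed

lemma sum_fun_apply: "(\<Sum>i\<in>S. f i) j = (\<Sum>i\<in>S. f i j)"
  by (induction S rule: infinite_finite_induct) simp_all

text \<open>A list with repetitions has dependent entries although its set may be independent, hence
  the conjunct \<open>distinct\<close>.\<close>

lemma cv_independent_list:
  "distinct us \<and> cv.independent (set us) \<longleftrightarrow>
     (\<forall>c. (\<Sum>j<length us. csc (c j) (us ! j)) = 0 \<longrightarrow> (\<forall>j<length us. c j = 0))" (is "?L \<longleftrightarrow> ?R")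
proof
  assume L: ?L
  show ?R
  proof (intro allI impI)
    fix c j assume c: "(\<Sum>j<length us. csc (c j) (us ! j)) = 0" and j: "j < length us"
    have bij: "bij_betw ((!) us) {..<length us} (set us)"
      using L by (intro bij_betw_nth) auto
    define f where "f x = c (the_inv_into {..<length us} ((!) us) x)" for x
    have f: "f (us ! j) = c j" if "j < length us" for j
      unfolding f_def using bij that by (subst the_inv_into_f_f) (auto simp: bij_betw_def)
    have "(\<Sum>x\<in>set us. csc (f x) x) = (\<Sum>j<length us. csc (f (us ! j)) (us ! j))"
      by (rule sum.reindex_bij_betw[OF bij, symmetric])
    also have "\<dots> = (\<Sum>j<length us. csc (c j) (us ! j))" by (intro sum.cong refl) (simp add: f)
    finally have "(\<Sum>x\<in>set us. csc (f x) x) = 0" using c by simp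
    then have "f (us ! j) = 0"
      using L j cv.independentD[of "set us" "set us" f "us ! j"] by simp
    then show "c j = 0" using f j by simp
  qed
next
  assume R: ?R
  have d: "distinct us"
    unfolding distinct_conv_nth
  proof (intro allI impI notI)
    fix i j assume ij: "i < length us" "j < length us" "i \<noteq> j" "us ! i = us ! j"
    \<comment> \<open>The coefficients 1 and -1 at two positions holding the same vector give a
      nontrivial relation.\<close>
    define c where "c t = (if t = i then 1 else if t = j then - 1 else 0 :: complex)" for t
    have "(\<Sum>t<length us. csc (c t) (us ! t)) = (\<Sum>t\<in>{i, j}. csc (c t) (us ! t))"
      using ij by (intro sum.mono_neutral_right) (auto simp: c_def)
    also have "\<dots> = 0" using ij by (simp add: c_def cv.scale_minus_left)
    finally have "c i = 0" using R ij by blast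
    then show False by (simp add: c_def)
  qed
  have "cv.independent (set us)"
  proof (rule cv.independent_if_scalars_zero)
    fix f x assume z: "(\<Sum>x\<in>set us. csc (f x) x) = 0" and x: "x \<in> set us"
    have bij: "bij_betw ((!) us) {..<length us} (set us)"
      using d by (intro bij_betw_nth) auto
    have "(\<Sum>j<length us. csc (f (us ! j)) (us ! j)) = 0"
      unfolding sum.reindex_bij_betw[OF bij, of "\<lambda>x. csc (f x) x"] using z .
    then have "\<forall>j<length us. f (us ! j) = 0" using R by (rule_tac spec[where x = "\<lambda>j. f (us ! j)", THEN mp]) auto
    then show "f x = 0" using x by (metis in_set_conv_nth)
  qed simp
  then show ?L using d by simp
qed

lemma lin_indep_iff:
  assumes "set vs \<subseteq> carrier_vec d"
  shows "lin_indep d vs \<longleftrightarrow> distinct (map vfun vs) \<and> cv.independent (set (map vfun vs))"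
proof -
  let ?k = "length vs"
  have dims: "dim_vec (vs ! j) = d" if "j < ?k" for j using assms nth_mem[OF that] by (auto dest!: subsetD)
  have e: "mat_of_cols d vs *\<^sub>v vec ?k c = 0\<^sub>v d \<longleftrightarrow> (\<Sum>j<?k. csc (c j) (map vfun vs ! j)) = 0" for c
  proof -
    have ent: "vec_index (mat_of_cols d vs *\<^sub>v vec ?k c) i = (\<Sum>j<?k. csc (c j) (map vfun vs ! j)) i" if "i < d" for i
    proof -
      have "vec_index (mat_of_cols d vs *\<^sub>v vec ?k c) i = (\<Sum>j<?k. vec_index (vs ! j) i * c j)"
        using that by (simp add: scalar_prod_def mat_of_cols_index lessThan_atLeast0)
      also have "\<dots> = (\<Sum>j<?k. csc (c j) (map vfun vs ! j) i)"
        using that dims by (intro sum.cong refl) (simp add: csc_def vfun_def)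
      finally show ?thesis by (simp add: sum_fun_apply)
    qed
    have out: "(\<Sum>j<?k. csc (c j) (map vfun vs ! j)) i = 0" if "i \<ge> d" for i
      using that dims by (simp add: sum_fun_apply csc_def vfun_def)
    show ?thesis
    proof
      assume a: "mat_of_cols d vs *\<^sub>v vec ?k c = 0\<^sub>v d"
      show "(\<Sum>j<?k. csc (c j) (map vfun vs ! j)) = 0"
      proof
        fix i show "(\<Sum>j<?k. csc (c j) (map vfun vs ! j)) i = 0 i"
          using ent[of i] out[of i] a by (cases "i < d") auto
      qed
    next
      assume a: "(\<Sum>j<?k. csc (c j) (map vfun vs ! j)) = 0"
      show "mat_of_cols d vs *\<^sub>v vec ?k c = 0\<^sub>v d"
      proof (rule eq_vecI)
        fix i assume "i < dim_vec (0\<^sub>v d :: complex vec)"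
        then have "i < d" by simp
        then show "vec_index (mat_of_cols d vs *\<^sub>v vec ?k c) i = vec_index (0\<^sub>v d) i"
          unfolding ent[OF \<open>i < d\<close>] a by simp
      qed simp
    qed
  qed
  have "lin_indep d vs \<longleftrightarrow> (\<forall>c. mat_of_cols d vs *\<^sub>v vec ?k c = 0\<^sub>v d \<longrightarrow> (\<forall>j<?k. c j = 0))"
  proof
    assume a: "lin_indep d vs"
    show "\<forall>c. mat_of_cols d vs *\<^sub>v vec ?k c = 0\<^sub>v d \<longrightarrow> (\<forall>j<?k. c j = 0)"
    proof (intro allI impI)
      fix c j assume "mat_of_cols d vs *\<^sub>v vec ?k c = 0\<^sub>v d" "j < ?k"
      then have "vec ?k c = 0\<^sub>v ?k" using a by (simp add: lin_indep_def)
      then have "vec_index (vec ?k c) j = vec_index (0\<^sub>v ?k) j" by simp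
      then show "c j = 0" using \<open>j < ?k\<close> by simp
    qed
  next
    assume a: "\<forall>c. mat_of_cols d vs *\<^sub>v vec ?k c = 0\<^sub>v d \<longrightarrow> (\<forall>j<?k. c j = 0)"
    show "lin_indep d vs"
      unfolding lin_indep_def
    proof (intro ballI impI)
      fix x assume x: "x \<in> carrier_vec ?k" "mat_of_cols d vs *\<^sub>v x = 0\<^sub>v d"
      have "vec ?k (vec_index x) = x" using x(1) by auto
      then have "\<forall>j<?k. vec_index x j = 0" using a[rule_format, of "vec_index x"] x(2) by simp
      then show "x = 0\<^sub>v ?k" using x(1) by auto
    qed
  qed
  then show ?thesis unfolding e cv_independent_list length_map .
qed

section \<open>From an irreducible matrix representation to the abstract module\<close>

context
  fixes n d :: nat and \<rho> :: "complex mat \<Rightarrow> complex mat" and hw :: "nat \<Rightarrow> int"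
  assumes irr: "irreducible_rep n d \<rho>" and hwt: "has_highest_weight n d \<rho> hw"
begin

lemma rho_carrier: "X \<in> sp n \<Longrightarrow> \<rho> X \<in> carrier_mat d d"
  using irr by (simp add: irreducible_rep_def is_rep_def)

lemma rho_comb:
  assumes "X \<in> sp n" "Y \<in> sp n"
  shows "oper d (\<rho> (a \<cdot>\<^sub>m X + b \<cdot>\<^sub>m Y)) u = csc a (oper d (\<rho> X) u) + csc b (oper d (\<rho> Y) u)"
proof -
  have "\<rho> (a \<cdot>\<^sub>m X + b \<cdot>\<^sub>m Y) = a \<cdot>\<^sub>m \<rho> X + b \<cdot>\<^sub>m \<rho> Y"
    using irr assms by (simp add: irreducible_rep_def is_rep_def)
  then show ?thesis using oper_comb rho_carrier assms by simp
qed

lemma rho_commutator: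
  assumes "X \<in> sp n" "Y \<in> sp n"
  shows "oper d (\<rho> (X * Y - Y * X)) u = oper d (\<rho> X) (oper d (\<rho> Y) u) - oper d (\<rho> Y) (oper d (\<rho> X) u)"
proof -
  have "\<rho> (X * Y - Y * X) = \<rho> X * \<rho> Y - \<rho> Y * \<rho> X"
    using irr assms by (simp add: irreducible_rep_def is_rep_def)
  moreover have "\<rho> X * \<rho> Y \<in> carrier_mat d d" "\<rho> Y * \<rho> X \<in> carrier_mat d d"
    using rho_carrier assms by (meson mult_carrier_mat)+
  ultimately show ?thesis using oper_diff oper_mult rho_carrier assms by simp
qed

text \<open>Fixed once by choice, so that the locale \<open>sp_hw\<close> can be interpreted with a
  constant vector.\<close>

definition hwv :: "nat \<Rightarrow> complex" where
  "hwv = vfun (SOME v. v \<in> weight_space n d \<rho> hw \<and> v \<noteq> 0\<^sub>v d \<and>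
      (\<forall>\<alpha> \<in> pos_roots n. \<forall>X \<in> root_space n \<alpha>. \<rho> X *\<^sub>v v = 0\<^sub>v d))"

lemma hwv:
  obtains v where "hwv = vfun v" "v \<in> carrier_vec d" "v \<noteq> 0\<^sub>v d"
    "\<And>\<theta>. \<rho> (cartan n \<theta>) *\<^sub>v v = wt_eval n hw \<theta> \<cdot>\<^sub>v v"
    "\<And>\<alpha> X. \<alpha> \<in> pos_roots n \<Longrightarrow> X \<in> root_space n \<alpha> \<Longrightarrow> \<rho> X *\<^sub>v v = 0\<^sub>v d"
proof -
  have "\<exists>v. v \<in> weight_space n d \<rho> hw \<and> v \<noteq> 0\<^sub>v d \<and>
      (\<forall>\<alpha> \<in> pos_roots n. \<forall>X \<in> root_space n \<alpha>. \<rho> X *\<^sub>v v = 0\<^sub>v d)"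
    using hwt by (auto simp: has_highest_weight_def)
  from someI_ex[OF this] show ?thesis
    using that[OF hwv_def] by (auto simp: weight_space_def)
qed

lemma hwv_support: "i \<ge> d \<Longrightarrow> hwv i = 0"
  by (rule hwv) (auto simp: vfun_def)

lemma oper_hwv_vec:
  assumes "X \<in> sp n" "hwv = vfun v" "v \<in> carrier_vec d"
  shows "oper d (\<rho> X) hwv = vfun (\<rho> X *\<^sub>v v)"
  using mult_vec_oper[OF rho_carrier[OF assms(1)] assms(3)] assms(2)
  by (simp add: vfun_vec oper_support)

lemma vfun_zero: "vfun (0\<^sub>v d) = 0"
  by (auto simp: vfun_def fun_eq_iff)

lemma vfun_smult: "vfun (c \<cdot>\<^sub>v v) = csc c (vfun v)"
  by (auto simp: vfun_def csc_def fun_eq_iff)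

definition Mop :: "nat \<Rightarrow> nat \<Rightarrow> (nat \<Rightarrow> complex) \<Rightarrow> nat \<Rightarrow> complex" where
  "Mop a b = oper d (\<rho> (Fmat n a b))"

lemma sp_hw_rep: "sp_hw csc n Mop hwv hw (unitf ` {..<d})"
proof (intro sp_hw.intro sp_hw_axioms.intro)
  show "vector_space csc" by (rule cv.vector_space_axioms)
  show "Vector_Spaces.linear csc csc (Mop a b)" for a b
    unfolding Mop_def by (rule oper_linear)
  show "Mop a b (Mop c e u) - Mop c e (Mop a b u) = (if b = c then Mop a e u else 0) - (if a = e then Mop c b u else 0)
        - csc (eps n a * eps n b) ((if bar n a = c then Mop (bar n b) e u else 0) - (if bar n b = e then Mop c (bar n a) u else 0))"
    if l: "a < 2 * n" "b < 2 * n" "c < 2 * n" "e < 2 * n" for a b c e u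
  proof -
    have sp: "Fmat n a e \<in> sp n" "Fmat n c b \<in> sp n" "Fmat n (bar n b) e \<in> sp n" "Fmat n c (bar n a) \<in> sp n"
      using l bar_less Fmat_sp by auto
    have "Mop a b (Mop c e u) - Mop c e (Mop a b u) = oper d (\<rho> (Fmat n a b * Fmat n c e - Fmat n c e * Fmat n a b)) u"
      unfolding Mop_def using rho_commutator Fmat_sp l by simp
    also have "\<dots> = csc 1 (csc (of_bool (b = c)) (Mop a e u) + csc (- of_bool (a = e)) (Mop c b u))
       + csc (- eps n a * eps n b) (csc (of_bool (bar n a = c)) (Mop (bar n b) e u) + csc (- of_bool (bar n b = e)) (Mop c (bar n a) u))"
      unfolding Fmat_commutator[OF l] Mop_def using sp by (simp only: rho_comb sp_comb)
    also have "\<dots> = (if b = c then Mop a e u else 0) - (if a = e then Mop c b u else 0)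
        - csc (eps n a * eps n b) ((if bar n a = c then Mop (bar n b) e u else 0) - (if bar n b = e then Mop c (bar n a) u else 0))"
      by (auto simp: csc_def fun_eq_iff algebra_simps)
    finally show ?thesis .
  qed
  show "Mop a b u = - csc (eps n a * eps n b) (Mop (bar n b) (bar n a) u)" if l: "a < 2 * n" "b < 2 * n" for a b u
  proof -
    have "Mop a b u = csc (- (eps n a * eps n b)) (Mop (bar n b) (bar n a) u) + csc 0 (Mop (bar n b) (bar n a) u)"
      unfolding Mop_def by (subst Fmat_sym[OF l]) (use l bar_less Fmat_sp in \<open>simp only: rho_comb\<close>)
    then show ?thesis by (simp add: csc_def fun_eq_iff)
  qed
  obtain v where v: "hwv = vfun v" "v \<in> carrier_vec d" "v \<noteq> 0\<^sub>v d"
    "\<And>\<theta>. \<rho> (cartan n \<theta>) *\<^sub>v v = wt_eval n hw \<theta> \<cdot>\<^sub>v v"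
    "\<And>\<alpha> X. \<alpha> \<in> pos_roots n \<Longrightarrow> X \<in> root_space n \<alpha> \<Longrightarrow> \<rho> X *\<^sub>v v = 0\<^sub>v d"
    using hwv by blast
  show "Mop a b hwv = 0" if l: "a < 2 * n" "b < 2 * n" "hpos n a < hpos n b" for a b
  proof -
    obtain \<alpha> where "\<alpha> \<in> pos_roots n" "agree n \<alpha> (root_fun n a b)" using rt_positive[OF l] by blast
    then have "\<rho> (Fmat n a b) *\<^sub>v v = 0\<^sub>v d" using v(5) Fmat_root_space l by blast
    then show ?thesis
      unfolding Mop_def using oper_hwv_vec[OF Fmat_sp[OF l(1,2)] v(1,2)] vfun_zero by simp
  qed
  show "Mop i i hwv = csc (of_int (hw i)) hwv" if i: "i < n" for i
  proof -
    have "wt_eval n hw (\<lambda>j. of_bool (j = i)) = (\<Sum>j<n. if j = i then of_int (hw i) else 0)"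
      unfolding wt_eval_def by (intro sum.cong refl) auto
    then have "\<rho> (Fmat n i i) *\<^sub>v v = of_int (hw i) \<cdot>\<^sub>v v"
      using v(4)[of "\<lambda>j. of_bool (j = i)"] i by (simp add: cartan_unit)
    then show ?thesis
      unfolding Mop_def using oper_hwv_vec[OF Fmat_sp v(1,2)] i v(1) vfun_smult by simp
  qed
  show "hwv \<noteq> 0"
  proof
    assume "hwv = 0"
    then have "vec d (vfun v) = 0\<^sub>v d" unfolding v(1) by auto
    then show False using v(2,3) vec_vfun by simp
  qed
  show "finite (unitf ` {..<d})" by simp
  show "Mop a b u \<in> cv.span (unitf ` {..<d})" for a b u
    unfolding Mop_def by (rule supported_span) (rule oper_support)
  show "hwv \<in> cv.span (unitf ` {..<d})"
    by (rule supported_span) (rule hwv_support)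
qed

interpretation R: sp_hw csc n Mop hwv hw "unitf ` {..<d}"
  by (rule sp_hw_rep)

lemma span_Words_support:
  assumes "u \<in> cv.span R.Words" "i \<ge> d"
  shows "u i = 0"
proof -
  have "cv.subspace {u. \<forall>i\<ge>d. u i = 0}"
    by (auto simp: cv.subspace_def csc_def)
  moreover have "R.Words \<subseteq> {u. \<forall>i\<ge>d. u i = 0}"
  proof
    fix x assume "x \<in> R.Words"
    then obtain w where "x = R.word w" by (auto simp: R.Words_def)
    then show "x \<in> {u. \<forall>i\<ge>d. u i = 0}"
      by (cases w rule: R.word.cases) (auto simp: hwv_support Mop_def oper_support)
  qed
  ultimately show ?thesis using cv.span_minimal assms by blast
qed

lemma sp_zero: "0\<^sub>m (2*n) (2*n) \<in> sp n"
  unfolding sp_iff using bar_less by auto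

text \<open>Stability under the root vectors is \<open>M_Words\<close>; \<open>sp_spanned\<close>
  extends it to the whole Lie algebra.\<close>

lemma rho_Words:
  assumes "X \<in> sp n" "u \<in> cv.span R.Words"
  shows "oper d (\<rho> X) u \<in> cv.span R.Words"
proof -
  let ?G = "{X \<in> sp n. \<forall>u\<in>cv.span R.Words. oper d (\<rho> X) u \<in> cv.span R.Words}"
  have "X \<in> ?G"
  proof (rule sp_spanned[OF _ _ _ assms(1)])
    show "Fmat n a b \<in> ?G" if "a < 2 * n" "b < 2 * n" for a b
      using that Fmat_sp R.M_Words by (auto simp: Mop_def)
    show "c \<cdot>\<^sub>m X + e \<cdot>\<^sub>m Y \<in> ?G" if "X \<in> ?G" "Y \<in> ?G" for X Y c e
      using that sp_comb by (auto simp: rho_comb intro!: cv.span_add cv.span_scale)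
    have "0\<^sub>m (2*n) (2*n) = 0 \<cdot>\<^sub>m 0\<^sub>m (2*n) (2*n) + (0 :: complex) \<cdot>\<^sub>m 0\<^sub>m (2*n) (2*n)"
      by (intro eq_matI) auto
    then have "oper d (\<rho> (0\<^sub>m (2*n) (2*n))) u = 0" for u
      using rho_comb[OF sp_zero sp_zero, of 0 0 u] by (simp add: csc_def fun_eq_iff)
    then show "0\<^sub>m (2*n) (2*n) \<in> ?G" using sp_zero by (simp add: cv.span_zero)
  qed
  then show ?thesis using assms(2) by blast
qed

text \<open>Irreducibility enters here: the submodule generated by the highest weight vector is
  nonzero, hence everything.\<close>

lemma span_Words_all:
  assumes "\<And>i. i \<ge> d \<Longrightarrow> u i = 0"
  shows "u \<in> cv.span R.Words"
proof -
  define W where "W = vec d ` cv.span R.Words"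
  have sub: "is_subspace d W"
    unfolding is_subspace_def
  proof (intro conjI ballI allI)
    show "W \<subseteq> carrier_vec d" by (auto simp: W_def)
    have "0\<^sub>v d = vec d (0 :: nat \<Rightarrow> complex)" by auto
    then show "0\<^sub>v d \<in> W" unfolding W_def using cv.span_zero by blast
    fix v assume "v \<in> W"
    then obtain x where x: "v = vec d x" "x \<in> cv.span R.Words" by (auto simp: W_def)
    show "a \<cdot>\<^sub>v v \<in> W" for a
    proof -
      have "a \<cdot>\<^sub>v v = vec d (csc a x)" by (auto simp: x csc_def)
      then show ?thesis unfolding W_def using cv.span_scale[OF x(2)] by blast
    qed
    fix w assume "w \<in> W"
    then obtain y where y: "w = vec d y" "y \<in> cv.span R.Words" by (auto simp: W_def)
    have "v + w = vec d (x + y)" by (auto simp: x y)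
    then show "v + w \<in> W" unfolding W_def using cv.span_add[OF x(2) y(2)] by blast
  qed
  have inv: "\<rho> X *\<^sub>v w \<in> W" if Xw: "X \<in> sp n" "w \<in> W" for X w
  proof -
    obtain x where x: "w = vec d x" "x \<in> cv.span R.Words" using Xw(2) unfolding W_def by blast
    have "\<rho> X *\<^sub>v w = vec d (oper d (\<rho> X) x)"
      using mult_vec_oper[OF rho_carrier[OF Xw(1)], of w] x vfun_vec[of d x] span_Words_support[OF x(2)] by simp
    then show ?thesis unfolding W_def using rho_Words[OF Xw(1) x(2)] by blast
  qed
  have "W = {0\<^sub>v d} \<or> W = carrier_vec d"
    using irr sub inv unfolding irreducible_rep_def by blast
  moreover have "W \<noteq> {0\<^sub>v d}"
  proof
    assume "W = {0\<^sub>v d}"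
    have "hwv = R.word []" by simp
    then have "hwv \<in> R.Words" unfolding R.Words_def R.lowlist_def by fastforce
    then have "vec d hwv \<in> W" unfolding W_def using cv.span_base by blast
    then have "vec d hwv = 0\<^sub>v d" using \<open>W = {0\<^sub>v d}\<close> by simp
    then have "vfun (vec d hwv) = 0" using vfun_zero by simp
    then show False using vfun_vec[of d hwv] hwv_support R.v_nonzero by simp
  qed
  ultimately have "vec d u \<in> W" by simp
  then obtain x where x: "vec d u = vec d x" "x \<in> cv.span R.Words" by (auto simp: W_def)
  have "vfun (vec d u) = vfun (vec d x)" using x by simp
  then have "u = x" using vfun_vec assms span_Words_support[OF x(2)] by simp
  then show ?thesis using x by simp
qed

text \<open>\<open>has_weight\<close> speaks of the n coordinate elements only. A general Cartan
  element is built up one coordinate at a time from two-term combinations.\<close>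

lemma cartan_weight:
  assumes "R.has_weight \<mu> u"
  shows "oper d (\<rho> (cartan n \<theta>)) u = csc (wt_eval n \<mu> \<theta>) u"
proof -
  have "m \<le> n \<Longrightarrow> oper d (\<rho> (cartan n (\<lambda>i. if i < m then \<theta> i else 0))) u = csc (\<Sum>i<m. of_int (\<mu> i) * \<theta> i) u" for m
  proof (induction m)
    case 0
    have "cartan n (\<lambda>i. if i < 0 then \<theta> i else 0) = 0 \<cdot>\<^sub>m 0\<^sub>m (2*n) (2*n) + 0 \<cdot>\<^sub>m 0\<^sub>m (2*n) (2*n)"
      by (intro eq_matI) (auto simp: cartan_def)
    then show ?case using rho_comb[OF sp_zero sp_zero, of 0 0 u] by (simp add: csc_def fun_eq_iff)
  next
    case (Suc m)
    have m: "Fmat n m m \<in> sp n" using Suc.prems by (intro Fmat_sp) auto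
    have "cartan n (\<lambda>i. if i < Suc m then \<theta> i else 0) = 1 \<cdot>\<^sub>m cartan n (\<lambda>i. if i < m then \<theta> i else 0) + \<theta> m \<cdot>\<^sub>m Fmat n m m"
      using Suc.prems by (intro eq_matI) (auto simp: cartan_def Fmat_def Fe_def bar_def eps_sq less_Suc_eq)
    then have "oper d (\<rho> (cartan n (\<lambda>i. if i < Suc m then \<theta> i else 0))) u
        = csc 1 (csc (\<Sum>i<m. of_int (\<mu> i) * \<theta> i) u) + csc (\<theta> m) (Mop m m u)"
      using rho_comb[OF cartan_sp m] Suc by (simp add: Mop_def)
    also have "Mop m m u = csc (of_int (\<mu> m)) u" using assms Suc.prems by (simp add: R.has_weight_def)
    finally show ?case by (simp add: csc_def fun_eq_iff algebra_simps)
  qed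
  from this[of n] show ?thesis
  proof -
    have "cartan n (\<lambda>i. if i < n then \<theta> i else 0) = cartan n \<theta>"
      by (intro eq_matI) (auto simp: cartan_def)
    then show ?thesis using \<open>n \<le> n \<Longrightarrow> _\<close> by (simp add: wt_eval_def)
  qed
qed

lemma weight_space_iff:
  assumes "w \<in> carrier_vec d"
  shows "w \<in> weight_space n d \<rho> \<mu> \<longleftrightarrow> R.has_weight \<mu> (vfun w)"
proof
  assume w: "w \<in> weight_space n d \<rho> \<mu>"
  show "R.has_weight \<mu> (vfun w)"
    unfolding R.has_weight_def
  proof (intro allI impI)
    fix i assume i: "i < n"
    then have sp: "Fmat n i i \<in> sp n" by (intro Fmat_sp) auto
    have "wt_eval n \<mu> (\<lambda>j. of_bool (j = i)) = (\<Sum>j<n. if j = i then of_int (\<mu> i) else 0)"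
      unfolding wt_eval_def by (intro sum.cong refl) auto
    moreover have "\<rho> (cartan n (\<lambda>j. of_bool (j = i))) *\<^sub>v w = wt_eval n \<mu> (\<lambda>j. of_bool (j = i)) \<cdot>\<^sub>v w"
      using w unfolding weight_space_def by blast
    ultimately have "\<rho> (Fmat n i i) *\<^sub>v w = of_int (\<mu> i) \<cdot>\<^sub>v w"
      using i by (simp add: cartan_unit)
    moreover have "Mop i i (vfun w) = vfun (\<rho> (Fmat n i i) *\<^sub>v w)"
      unfolding Mop_def mult_vec_oper[OF rho_carrier[OF sp] assms] using vfun_vec oper_support by metis
    ultimately show "Mop i i (vfun w) = csc (of_int (\<mu> i)) (vfun w)" by (simp add: vfun_smult)
  qed
next
  assume w: "R.has_weight \<mu> (vfun w)"
  have "\<rho> (cartan n \<theta>) *\<^sub>v w = wt_eval n \<mu> \<theta> \<cdot>\<^sub>v w" for \<theta>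
    unfolding mult_vec_oper[OF rho_carrier[OF cartan_sp] assms] cartan_weight[OF w]
    using assms by (auto simp: csc_def vfun_def)
  then show "w \<in> weight_space n d \<rho> \<mu>" using assms by (simp add: weight_space_def)
qed

text \<open>The basis \<open>R.Bw\<close> attains the maximal length. Every independent list of
  weight vectors lies in its span, because the words span all vectors, and so is no longer.\<close>

lemma weight_mult_eq: "weight_mult n d \<rho> \<mu> = R.mult \<mu>"
  unfolding weight_mult_def subspace_dim_def
proof (rule Greatest_equality)
  have BwB: "R.Bw \<mu> \<subseteq> R.B" by (auto simp: R.Bw_def)
  obtain us where us: "set us = R.Bw \<mu>" "distinct us"
    using finite_distinct_list[OF R.finite_Bw] by blast
  have supp: "u i = 0" if "u \<in> set us" "i \<ge> d" for u i
    using that us BwB R.B(1) span_Words_support cv.span_base by blast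
  let ?vs = "map (vec d) us"
  have m: "map vfun ?vs = us"
    unfolding map_map by (rule map_idI) (simp add: vfun_vec supp)
  have "cv.independent (set us)" unfolding us(1) using R.B(2) BwB by (rule cv.independent_mono)
  moreover have "set ?vs \<subseteq> carrier_vec d" by auto
  ultimately have "lin_indep d ?vs" using lin_indep_iff[of ?vs d, unfolded m] us(2) by simp
  moreover have "set ?vs \<subseteq> weight_space n d \<rho> \<mu>"
  proof
    fix x assume "x \<in> set ?vs"
    then obtain u where u: "u \<in> set us" "x = vec d u" by auto
    then have "R.has_weight \<mu> (vfun x)" using R.has_weight_Bw us(1) vfun_vec[of d u] supp by simp
    then show "x \<in> weight_space n d \<rho> \<mu>" using weight_space_iff[of x] u by simp
  qed
  moreover have "length ?vs = R.mult \<mu>"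
    using us distinct_card[of us] by (simp add: R.mult_def)
  ultimately show "\<exists>vs. length vs = R.mult \<mu> \<and> set vs \<subseteq> weight_space n d \<rho> \<mu> \<and> lin_indep d vs" by blast
next
  fix k assume "\<exists>vs. length vs = k \<and> set vs \<subseteq> weight_space n d \<rho> \<mu> \<and> lin_indep d vs"
  then obtain vs where vs: "length vs = k" "set vs \<subseteq> weight_space n d \<rho> \<mu>" "lin_indep d vs" by blast
  have c: "set vs \<subseteq> carrier_vec d" using vs(2) by (auto simp: weight_space_def)
  let ?us = "map vfun vs"
  have us: "distinct ?us" "cv.independent (set ?us)" using lin_indep_iff[OF c] vs(3) by auto
  have "set ?us \<subseteq> cv.span (R.Bw \<mu>)"
  proof
    fix u assume "u \<in> set ?us"
    then obtain w where w: "w \<in> set vs" "u = vfun w" by auto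
    then have wc: "w \<in> carrier_vec d" "R.has_weight \<mu> u" using c vs(2) weight_space_iff by auto
    have "u \<in> cv.span R.Words" by (rule span_Words_all) (use w wc in \<open>auto simp: vfun_def\<close>)
    then show "u \<in> cv.span (R.Bw \<mu>)" using R.has_weight_span_Bw[OF wc(2)] R.B(3) by simp
  qed
  then have "card (set ?us) \<le> card (R.Bw \<mu>)"
    using cv.independent_span_bound[OF R.finite_Bw us(2)] by blast
  then show "k \<le> R.mult \<mu>" using distinct_card[OF us(1)] vs(1) by (simp add: R.mult_def)
qed

lemma weight_mult_eq_mult_formula:
  assumes "1 \<le> p" "p \<le> n" "hw = (\<lambda>i. int k * omega 1 i + omega p i)"
  shows "real (weight_mult n d \<rho> \<mu>) = mult_formula n p (int k + int p) \<mu>"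
  using R.mult_eq_mult_formula[OF assms] weight_mult_eq by (simp add: R.real_mult_def)

end

lemma Zc_nonzero_count: "Zc n \<mu> = int (n - nonzero_count n \<mu>)"
proof -
  have "card ({i. i < n \<and> \<mu> i = 0} \<union> {i. i < n \<and> \<mu> i \<noteq> 0}) = card {i. i < n \<and> \<mu> i = 0} + card {i. i < n \<and> \<mu> i \<noteq> 0}"
    by (rule card_Un_disjoint) auto
  moreover have "{i. i < n \<and> \<mu> i = 0} \<union> {i. i < n \<and> \<mu> i \<noteq> 0} = {..<n}" by auto
  ultimately show ?thesis by (simp add: Zc_def nonzero_count_def)
qed

theorem theorem3p1:
  fixes n k p d :: nat and \<rho> :: "complex mat \<Rightarrow> complex mat" and \<mu> :: "nat \<Rightarrow> int"
  assumes "n \<ge> 2" and "1 \<le> p" and "p \<le> n"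
    and "irreducible_rep n d \<rho>"
    and "has_highest_weight n d \<rho> (\<lambda>i. int k * omega 1 i + omega p i)"
  shows "real (weight_mult n d \<rho> \<mu>) =
    (let N = int n; P = int p; Z = Zc n \<mu>; r = (int k + P - wnorm n \<mu>) div 2 in
     if wnorm n \<mu> \<le> int k + P \<and> even (int k + P - wnorm n \<mu>) then
      (\<Sum>j = 1..P. (-1) ^ nat (j - 1) *
        (\<Sum>t = 0..(P - j) div 2.
          (real_of_int (N - P + j + 1) / real_of_int (N - P + j + t + 1)) *
          ibinom (N - P + j + 2*t) t *
          (\<Sum>\<beta> = 0..P - j - 2*t.
             2 ^ nat (P - j - 2*t - \<beta>) * ibinom (N - Z) \<beta> * ibinom Z (P - j - 2*t - \<beta>) *
             (\<Sum>\<alpha> = 0..\<beta>. ibinom \<beta> \<alpha> *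
                (\<Sum>i = 0..j - 1. ibinom (r - i - P + \<alpha> + t + j + N - 1) (N - 1))))))
     else 0)"
proof -
  have F: "real (weight_mult n d \<rho> \<mu>) = mult_formula n p (int k + int p) \<mu>"
    by (rule weight_mult_eq_mult_formula[OF assms(4,5,2,3) refl])
  show ?thesis
  proof (cases "wnorm n \<mu> \<le> int k + int p \<and> even (int k + int p - wnorm n \<mu>)")
    case True
    have n: "1 \<le> n" using assms(1) by simp
    define r where "r = nat ((int k + int p - wnorm n \<mu>) div 2)"
    have r: "(int k + int p - wnorm n \<mu>) div 2 = int r" using True by (simp add: r_def)
    have "mult_formula n p (int k + int p) \<mu> = gen_coeff n p (nonzero_count n \<mu>) r"
      using True by (simp add: mult_formula_def shell_coeff_def r_def)
    also note gen_coeff_formula[OF n assms(3) nonzero_count_le[of n \<mu>], where r = r, folded Zc_nonzero_count]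
    finally show ?thesis
      unfolding F Let_def r if_P[OF True] .
  next
    case False
    then show ?thesis unfolding F Let_def if_not_P[OF False] mult_formula_def shell_coeff_def by simp
  qed
qed

end
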